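(* Let $0<\alpha<1$, $\kappa\in\mathbb{R}$, $\kappa_+:=\max\{\kappa,0\}$, and let $u$ be the solution of the reaction-subdiffusion problem described in the context. Let $U_h^n$ be the solution of the fully discrete scheme described in the context, with offset parameter $\theta\in[0,1)$ and discrete kernels $A^{(n)}_{n-k}$, and let $e_h^n:=u(x_h,t_n)-U_h^n$. Assume: (A1) $A^{(n)}_0\ge A^{(n)}_1\ge\cdots\ge A^{(n)}_{n-1}>0$ for $1\le n\le N$; (A2) there is a constant $\pi_A>0$ with $A^{(n)}_{n-k}\ge\frac{1}{\pi_A\tau_k}\int_{t_{k-1}}^{t_k}\omega_{1-\alpha}(t_n-s)\,ds$ for $1\le k\le n\le N$; (A3) there is a constant $\rho>0$ with $\rho_k:=\tau_k/\tau_{k+1}\le\rho$ for $1\le k\le N-1$; (regularity) for some $\sigma\in(0,1)\cup(1,2)$, $|\partial_t^{l}u(x,t)|\le C_u(1+t^{\sigma-l})$ for $0<t\le T$, $l=1,2$, and $\|\partial_x^{4}u(t)\|_{L^\infty}\le C_u$; moreover, when $\theta>0$, $u$ is smooth enough in space that $|\partial_t^{l}(\Delta_h+\kappa)u(x_h,t)|\le C_u(1+t^{\sigma-l})$ for $0<t\le T$, $l=1,2$, $x_h\in\Omega_h$; (error convolution structure) there are non-negative numbers $G_{\mathrm{loc}}^k,G_{\mathrm{his}}^k$ $(1\le k\le N)$ such that the local consistency error $(R_t)_h^k:=(\mathcal{D}_t^\alpha u)(x_h,t_{k-\theta})-\mathcal{D}^\alpha_\tau u_h^{k-\theta}$, where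 $u_h^k:=u(x_h,t_k)$, satisfies $$\|(R_t)_h^k\|\le A^{(k)}_0G_{\mathrm{loc}}^k+\sum_{j=1}^{k-1}\big(A^{(k)}_{k-j-1}-A^{(k)}_{k-j}\big)G_{\mathrm{his}}^j,\qquad 1\le k\le N.$$ Put $\mathcal{G}^k:=A^{(k)}_0(G_{\mathrm{loc}}^k+G_{\mathrm{his}}^k)$ and $$\Xi_t^n:=\Gamma(2-\alpha)\,\pi_A\Big(\sum_{j=2}^n\tau_j\max_{j\le k\le n}t_k^{\alpha-1}\mathcal{G}^k+\tau_1^\alpha\mathcal{G}^1\Big),\qquad 1\le n\le N.$$ If the maximum step size satisfies $$\max_{1\le n\le N}\tau_n\le\frac{1}{\sqrt[\alpha]{4\max(1,\rho)\,\pi_A\,\Gamma(2-\alpha)\,\kappa_+}}$$ (no restriction if $\kappa_+=0$), then with $C=C_uE_\alpha\big(4\max(1,\rho)\pi_A\kappa_+t_n^\alpha\big)$ the following hold for $1\le n\le N$. (i) If $0<\theta<\theta^{(n)}$ for $1\le n\le N$, then $$\|e_h^n\|\le C\Big(\|e_h^0\|+\frac{\tau_1^{\sigma+\alpha}}{\sigma}+t_n^\alpha h^2+t_n^\alpha\max_{2\le k\le n}t_{k-1}^{\sigma-2}\tau_k^2+(\rho+1)\max_{1\le k\le n}\Xi_t^k\Big).$$ (ii) If $\theta=0$, then $$\|e_h^n\|\le C\Big(\|e_h^0\|+t_n^\alpha h^2+(\rho+1)\max_{1\le k\le n}\Xi_t^k\Big).$$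
   Context: Continuous problem: on $\Omega=(x_l,x_r)$, $\mathcal{D}_t^\alpha u-\Delta u=\kappa u+f$ for $x\in\Omega$, $0<t\le T$; $u=u_0(x)$ at $t=0$; $u=0$ on $\partial\Omega$ for $0<t<T$. Here $\mathcal{D}_t^\alpha u:=\int_0^t\omega_{1-\alpha}(t-s)\,\partial_su(s)\,ds$ is the Caputo derivative and $\omega_\beta(t):=t^{\beta-1}/\Gamma(\beta)$. Time mesh: $0=t_0<t_1<\cdots<t_N=T$, $\tau_k:=t_k-t_{k-1}$. Notation: $\nabla_\tau v^k:=v^k-v^{k-1}$, $t_{n-\theta}:=\theta t_{n-1}+(1-\theta)t_n$, $v^{n-\theta}:=\theta v^{n-1}+(1-\theta)v^n$. Discrete Caputo derivative: $\mathcal{D}_\tau^\alpha v^{n-\theta}:=\sum_{k=1}^nA^{(n)}_{n-k}\nabla_\tau v^k$ for $1\le n\le N$, with given real kernels $A^{(n)}_{n-k}$. Space grid: $h=(x_r-x_l)/M$, $x_i=x_l+ih$, $\overline\Omega_h=\{x_i:0\le i\le M\}$, $\Omega_h=\overline\Omega_h\cap\Omega$, $\partial\Omega_h=\overline\Omega_h\cap\partial\Omega$. $\Delta_h$ is the standard second-order central difference approximation of $\Delta$. For grid functions vanishing on $\partial\Omega_h$, $\langle v_h,w_h\rangle:=h\sum_{x\in\Omega_h}v_h(x)w_h(x)$ and $\|v_h\|:=\sqrt{\langle v_h,v_h\rangle}$. Fully discrete scheme: $\mathcal{D}^\alpha_\tau U_h^{n-\theta}=\Delta_hU_h^{n-\theta}+\kappa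 U_h^{n-\theta}+f_h^{n-\theta}$ on $\Omega_h$ for $1\le n\le N$, where $f_h^{n-\theta}:=f(x_h,t_{n-\theta})$; $U_h^0=u_0(x_h)$ on $\Omega_h$; $U_h^n=0$ on $\partial\Omega_h$ for $n\ge0$. $\theta^{(n)}:=\dfrac{A^{(n)}_0-A^{(n)}_1}{2A^{(n)}_0-A^{(n)}_1}$, with the convention $A^{(1)}_1:=0$ when $n=1$. $E_\alpha(z):=\sum_{j=0}^\infty z^j/\Gamma(j\alpha+1)$ is the Mittag-Leffler function. A maximum over an empty index set, and an empty sum, is $0$. $C_u$ denotes a generic positive constant, possibly different at each occurrence, depending only on the regularity of $u$, on $T$, $\kappa$ and $\pi_A$; it is independent of the time steps $\tau_k$, of $n$, $N$, $h$, and hides no factor that blows up as $\alpha\to1^-$. *)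

theory Defs
  imports "HOL-Analysis.Analysis"
begin

definition omega :: "real \<Rightarrow> real \<Rightarrow> real" where
  "omega \<beta> t = t powr (\<beta> - 1) / Gamma \<beta>"

definition mittag_leffler :: "real \<Rightarrow> real \<Rightarrow> real" where
  "mittag_leffler \<alpha> z = (\<Sum>j. z ^ j / Gamma (real j * \<alpha> + 1))"

text \<open>The maximum over an empty index set is 0; used for finite index sets only.\<close>

definition max_over :: "nat set \<Rightarrow> (nat \<Rightarrow> real) \<Rightarrow> real" where
  "max_over I f = (if I = {} then 0 else Max (f ` I))"


section \<open>The continuous problem\<close>

text \<open>The endpoints of the range of integration, where the derivative may fail to exist or may
  depend on values of \<^term>\<open>v\<close> outside the time interval, form a null set.\<close>

definition caputo_integrand :: "real \<Rightarrow> (real \<Rightarrow> real) \<Rightarrow> real \<Rightarrow> real \<Rightarrow> real" where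
  "caputo_integrand \<alpha> v t s = omega (1 - \<alpha>) (t - s) * deriv v s"

definition caputo :: "real \<Rightarrow> (real \<Rightarrow> real) \<Rightarrow> real \<Rightarrow> real" where
  "caputo \<alpha> v t = integral {0..t} (caputo_integrand \<alpha> v t)"

text \<open>Classical solutions on \<open>(xl, xr)\<close>, \<open>0 < t \<le> T\<close>. Functions of space and time are written
  \<open>u x t\<close>; only values of \<open>u\<close> on the closed rectangle matter. Continuity on that rectangle gives
  the initial and boundary conditions their meaning.\<close>

definition subdiffusion_solution ::
  "real \<Rightarrow> real \<Rightarrow> real \<Rightarrow> real \<Rightarrow> real \<Rightarrow> (real \<Rightarrow> real \<Rightarrow> real) \<Rightarrow> (real \<Rightarrow> real)
    \<Rightarrow> (real \<Rightarrow> real \<Rightarrow> real) \<Rightarrow> bool" where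
  "subdiffusion_solution xl xr T \<alpha> \<kappa> f u0 u \<longleftrightarrow>
     continuous_on ({xl..xr} \<times> {0..T}) (\<lambda>(x, t). u x t) \<and>
     (\<forall>x\<in>{xl<..<xr}. \<forall>t\<in>{0<..<T}. u x differentiable (at t)) \<and>
     (\<forall>x\<in>{xl<..<xr}. \<forall>t\<in>{0<..T}. caputo_integrand \<alpha> (u x) t integrable_on {0..t}) \<and>
     (\<forall>x\<in>{xl<..<xr}. \<forall>t\<in>{0<..T}. \<forall>l<2. ((deriv ^^ l) (\<lambda>y. u y t)) differentiable (at x)) \<and>
     (\<forall>x\<in>{xl<..<xr}. \<forall>t\<in>{0<..T}.
        caputo \<alpha> (u x) t - (deriv ^^ 2) (\<lambda>y. u y t) x = \<kappa> * u x t + f x t) \<and>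
     (\<forall>x\<in>{xl<..<xr}. u x 0 = u0 x) \<and>
     (\<forall>t\<in>{0<..<T}. u xl t = 0 \<and> u xr t = 0)"

text \<open>Time derivatives on \<open>(0, T]\<close>, one-sided at \<open>T\<close>.\<close>

definition dt :: "real \<Rightarrow> (real \<Rightarrow> real) \<Rightarrow> real \<Rightarrow> real" where
  "dt T v t = vector_derivative v (at t within {0<..T})"

definition time_regular :: "real \<Rightarrow> real \<Rightarrow> real \<Rightarrow> (real \<Rightarrow> real) \<Rightarrow> bool" where
  "time_regular T \<sigma> C v \<longleftrightarrow>
     (\<forall>t\<in>{0<..T}. \<forall>l<2. ((dt T ^^ l) v) differentiable (at t within {0<..T})) \<and>
     (\<forall>t\<in>{0<..T}. \<forall>l\<in>{1, 2}. \<bar>(dt T ^^ l) v t\<bar> \<le> C * (1 + t powr (\<sigma> - real l)))"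

text \<open>The bound on the fourth derivative is the \<open>L\<^sup>\<infinity>\<close> bound: for an everywhere existing derivative,
  essential supremum and supremum agree (Denjoy-Clarkson).\<close>

definition space_regular :: "real \<Rightarrow> real \<Rightarrow> real \<Rightarrow> (real \<Rightarrow> real) \<Rightarrow> bool" where
  "space_regular xl xr C w \<longleftrightarrow>
     (\<forall>x\<in>{xl<..<xr}. \<forall>l<4. ((deriv ^^ l) w) differentiable (at x)) \<and>
     (\<forall>x\<in>{xl<..<xr}. \<bar>(deriv ^^ 4) w x\<bar> \<le> C)"


section \<open>The fully discrete scheme\<close>

text \<open>A grid function is a function of the index \<open>i\<close> of the point \<open>x\<^sub>i\<close>, \<open>0 \<le> i \<le> M\<close>; the interior
  points are those with \<open>1 \<le> i < M\<close>.\<close>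

definition mesh_width :: "real \<Rightarrow> real \<Rightarrow> nat \<Rightarrow> real" where
  "mesh_width xl xr M = (xr - xl) / real M"

definition grid_point :: "real \<Rightarrow> real \<Rightarrow> nat \<Rightarrow> nat \<Rightarrow> real" where
  "grid_point xl xr M i = xl + real i * mesh_width xl xr M"

definition discrete_laplacian :: "real \<Rightarrow> (nat \<Rightarrow> real) \<Rightarrow> nat \<Rightarrow> real" where
  "discrete_laplacian h v i = (v (i + 1) - 2 * v i + v (i - 1)) / h ^ 2"

definition grid_inner :: "real \<Rightarrow> nat \<Rightarrow> (nat \<Rightarrow> real) \<Rightarrow> (nat \<Rightarrow> real) \<Rightarrow> real" where
  "grid_inner h M v w = h * (\<Sum>i\<in>{1..<M}. v i * w i)"

definition grid_norm :: "real \<Rightarrow> nat \<Rightarrow> (nat \<Rightarrow> real) \<Rightarrow> real" where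
  "grid_norm h M v = sqrt (grid_inner h M v v)"

definition time_mesh :: "real \<Rightarrow> nat \<Rightarrow> (nat \<Rightarrow> real) \<Rightarrow> bool" where
  "time_mesh T N t \<longleftrightarrow> t 0 = 0 \<and> t N = T \<and> (\<forall>k\<in>{1..N}. t (k - 1) < t k)"

definition step :: "(nat \<Rightarrow> real) \<Rightarrow> nat \<Rightarrow> real" where
  "step t k = t k - t (k - 1)"

text \<open>\<open>offset \<theta> v n\<close> is \<open>v\<^sup>n\<^sup>-\<^sup>\<theta>\<close>; applied to the mesh itself it gives the time \<open>t\<close> with index \<open>n - \<theta>\<close>.\<close>

definition offset :: "real \<Rightarrow> (nat \<Rightarrow> real) \<Rightarrow> nat \<Rightarrow> real" where
  "offset \<theta> v n = \<theta> * v (n - 1) + (1 - \<theta>) * v n"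

text \<open>\<open>A n j\<close> is the kernel with superscript \<open>(n)\<close> and subscript \<open>j\<close>.\<close>

definition discrete_caputo :: "(nat \<Rightarrow> nat \<Rightarrow> real) \<Rightarrow> (nat \<Rightarrow> real) \<Rightarrow> nat \<Rightarrow> real" where
  "discrete_caputo A v n = (\<Sum>k\<in>{1..n}. A n (n - k) * (v k - v (k - 1)))"

text \<open>\<open>U n i\<close> is the discrete solution at \<open>t\<^sub>n\<close> and \<open>x\<^sub>i\<close>.\<close>

definition discrete_solution ::
  "real \<Rightarrow> real \<Rightarrow> nat \<Rightarrow> nat \<Rightarrow> (nat \<Rightarrow> real) \<Rightarrow> real \<Rightarrow> (nat \<Rightarrow> nat \<Rightarrow> real) \<Rightarrow> real
    \<Rightarrow> (real \<Rightarrow> real \<Rightarrow> real) \<Rightarrow> (real \<Rightarrow> real) \<Rightarrow> (nat \<Rightarrow> nat \<Rightarrow> real) \<Rightarrow> bool" where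
  "discrete_solution xl xr M N t \<theta> A \<kappa> f u0 U \<longleftrightarrow>
     (\<forall>n\<in>{1..N}. \<forall>i\<in>{1..<M}.
        discrete_caputo A (\<lambda>k. U k i) n =
          discrete_laplacian (mesh_width xl xr M) (\<lambda>i. offset \<theta> (\<lambda>k. U k i) n) i
          + \<kappa> * offset \<theta> (\<lambda>k. U k i) n
          + f (grid_point xl xr M i) (offset \<theta> t n)) \<and>
     (\<forall>i\<in>{1..<M}. U 0 i = u0 (grid_point xl xr M i)) \<and>
     (\<forall>n\<in>{0..N}. U n 0 = 0 \<and> U n M = 0)"

definition kernels_A1 :: "nat \<Rightarrow> (nat \<Rightarrow> nat \<Rightarrow> real) \<Rightarrow> bool" where
  "kernels_A1 N A \<longleftrightarrow>
     (\<forall>n\<in>{1..N}. (\<forall>j. j + 1 < n \<longrightarrow> A n j \<ge> A n (j + 1)) \<and> A n (n - 1) > 0)"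

definition kernels_A2 :: "nat \<Rightarrow> (nat \<Rightarrow> real) \<Rightarrow> real \<Rightarrow> real \<Rightarrow> (nat \<Rightarrow> nat \<Rightarrow> real) \<Rightarrow> bool" where
  "kernels_A2 N t \<alpha> \<pi>A A \<longleftrightarrow>
     (\<forall>n\<in>{1..N}. \<forall>k\<in>{1..n}.
        A n (n - k) \<ge> 1 / (\<pi>A * step t k) *
          integral {t (k - 1)..t k} (\<lambda>s. omega (1 - \<alpha>) (t n - s)))"

definition mesh_A3 :: "nat \<Rightarrow> (nat \<Rightarrow> real) \<Rightarrow> real \<Rightarrow> bool" where
  "mesh_A3 N t \<rho> \<longleftrightarrow> (\<forall>k\<in>{1..N - 1}. step t k / step t (k + 1) \<le> \<rho>)"

definition theta_bound :: "(nat \<Rightarrow> nat \<Rightarrow> real) \<Rightarrow> nat \<Rightarrow> real" where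
  "theta_bound A n =
     (let A1 = (if n = 1 then 0 else A n 1) in (A n 0 - A1) / (2 * A n 0 - A1))"


section \<open>Local consistency error\<close>

definition consistency_error ::
  "real \<Rightarrow> real \<Rightarrow> nat \<Rightarrow> (nat \<Rightarrow> real) \<Rightarrow> real \<Rightarrow> real \<Rightarrow> (nat \<Rightarrow> nat \<Rightarrow> real)
    \<Rightarrow> (real \<Rightarrow> real \<Rightarrow> real) \<Rightarrow> nat \<Rightarrow> nat \<Rightarrow> real" where
  "consistency_error xl xr M t \<alpha> \<theta> A u k i =
     (let x = grid_point xl xr M i in
        caputo \<alpha> (u x) (offset \<theta> t k) - discrete_caputo A (\<lambda>j. u x (t j)) k)"

definition error_convolution_structure ::
  "real \<Rightarrow> real \<Rightarrow> nat \<Rightarrow> nat \<Rightarrow> (nat \<Rightarrow> real) \<Rightarrow> real \<Rightarrow> real \<Rightarrow> (nat \<Rightarrow> nat \<Rightarrow> real)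
    \<Rightarrow> (real \<Rightarrow> real \<Rightarrow> real) \<Rightarrow> (nat \<Rightarrow> real) \<Rightarrow> (nat \<Rightarrow> real) \<Rightarrow> bool" where
  "error_convolution_structure xl xr M N t \<alpha> \<theta> A u Gloc Ghis \<longleftrightarrow>
     (\<forall>k\<in>{1..N}. Gloc k \<ge> 0 \<and> Ghis k \<ge> 0 \<and>
        grid_norm (mesh_width xl xr M) M (consistency_error xl xr M t \<alpha> \<theta> A u k)
          \<le> A k 0 * Gloc k + (\<Sum>j\<in>{1..<k}. (A k (k - j - 1) - A k (k - j)) * Ghis j))"

definition cal_G :: "(nat \<Rightarrow> nat \<Rightarrow> real) \<Rightarrow> (nat \<Rightarrow> real) \<Rightarrow> (nat \<Rightarrow> real) \<Rightarrow> nat \<Rightarrow> real" where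
  "cal_G A Gloc Ghis k = A k 0 * (Gloc k + Ghis k)"

definition Xi :: "(nat \<Rightarrow> real) \<Rightarrow> real \<Rightarrow> real \<Rightarrow> (nat \<Rightarrow> real) \<Rightarrow> nat \<Rightarrow> real" where
  "Xi t \<alpha> \<pi>A G n =
     Gamma (2 - \<alpha>) * \<pi>A *
       ((\<Sum>j\<in>{2..n}. step t j * max_over {j..n} (\<lambda>k. t k powr (\<alpha> - 1) * G k))
        + step t 1 powr \<alpha> * G 1)"

end

theory Submission
  imports Defs
begin

text \<open>
  Why the estimate holds. A mesh kernel \<open>A\<close> satisfying (A1) can be inverted: there are nonnegative
  complementary weights \<open>P n j\<close> (\<open>cweight A n j\<close> below) with \<open>\<Sum>j=k..n. P n j * A j (j - k) = 1\<close> for all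
  \<open>k\<close>, so that summing a discrete Caputo derivative against them telescopes to \<open>v n - v 0\<close>. They play
  the part of the fractional integral of order \<open>\<alpha>\<close>, and (A2) compares them with it: for
  every \<open>\<beta> > 0\<close>, \<open>\<Sum>j=1..n-1. P n j * omega (1 - \<alpha> + \<beta>) (t j) \<le> \<pi>A * max 1 \<rho> * omega (1 + \<beta>) (t n)\<close>
  (\<open>cweight_omega_partial_sum\<close>). The proof expresses \<open>omega (1 - \<alpha> + \<beta>)\<close> as the convolution of
  \<open>omega (1 - \<alpha>)\<close> with \<open>omega \<beta>\<close> and compares the two factors interval by interval: by Chebyshev's integral
  inequality if \<open>\<beta> \<le> 1\<close>, at the cost of the step ratio \<open>\<rho>\<close> if \<open>\<beta> > 1\<close>. Inserting the powers
  \<open>\<beta> = (m + 1) * \<alpha>\<close> into the Mittag-Leffler series gives the discrete Gronwall inequality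
  (\<open>discrete_gronwall\<close>).

  The scheme supplies the differential inequality to which it applies. The restriction on \<open>\<theta>\<close> makes the
  quadratic form of the discrete derivative coercive, \<open>D (v\<^sup>2) \<le> 2 v D v\<close> with the factor \<open>v\<close> taken at the
  offset point (\<open>discrete_caputo_energy\<close>), and the discrete Laplacian is dissipative. Hence the error is
  controlled by the sums, weighted with \<open>P\<close>, of the norms of three residuals
  (\<open>error_le_weighted_sizes\<close>).

  The consistency error: interchanging the order of summation turns the history terms into
  \<open>P n j * A j 0 * Ghis j\<close>, and the remaining sum is at most \<open>(\<rho> + 1) * Xi\<close> by comparison with a
  monotone grid function whose increments are \<open>step t j\<close> times the maximum in \<open>Xi\<close>. Only
  \<open>Gamma (2 - \<alpha>)\<close> enters here, which keeps the constant bounded as \<open>\<alpha>\<close> tends to 1.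

  The spatial error is \<open>O(h\<^sup>2)\<close> and the weights \<open>P\<close> sum to at most \<open>\<pi>A * t n powr \<alpha> / Gamma (1 + \<alpha>)\<close>.

  The averaging error, present if \<open>\<theta> > 0\<close>, is a linear interpolation error in time. It is of second
  order on all steps but the first. On the first step the singularity of the time derivatives leaves
  \<open>O(step t 1 powr \<sigma>)\<close>, and the weight of that step contributes the factor \<open>step t 1 powr \<alpha>\<close>.
\<close>

section \<open>Complementary weights of a discrete kernel\<close>

lemma sum_triangle_swap:
  fixes f :: "nat \<Rightarrow> nat \<Rightarrow> real"
  shows "(\<Sum>j\<in>{1..n}. \<Sum>k\<in>{1..j}. f j k) = (\<Sum>k\<in>{1..n}. \<Sum>j\<in>{k..n}. f j k)"
proof (induction n)
  case (Suc n)
  have "(\<Sum>k\<in>{1..Suc n}. \<Sum>j\<in>{k..Suc n}. f j k)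
      = (\<Sum>k\<in>{1..n}. \<Sum>j\<in>{k..Suc n}. f j k) + f (Suc n) (Suc n)" by simp
  also have "(\<Sum>k\<in>{1..n}. \<Sum>j\<in>{k..Suc n}. f j k) = (\<Sum>k\<in>{1..n}. (\<Sum>j\<in>{k..n}. f j k) + f (Suc n) k)"
    by (intro sum.cong refl) (auto simp: sum.nat_ivl_Suc')
  finally show ?case using Suc by (simp add: sum.distrib)
qed simp

lemma kernels_A1_antimono:
  assumes "kernels_A1 N A" "n \<in> {1..N}" "j \<le> k" "k < n"
  shows "A n k \<le> A n j"
  using assms(3,4)
proof (induction k rule: dec_induct)
  case (step k)
  then have "A n (k + 1) \<le> A n k" using assms(1,2) unfolding kernels_A1_def by auto
  with step show ?case by auto
qed simp

lemma kernels_A1_pos: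
  assumes "kernels_A1 N A" "n \<in> {1..N}" "j < n"
  shows "0 < A n j"
proof -
  have "0 < A n (n - 1)" using assms(1,2) unfolding kernels_A1_def by auto
  also have "\<dots> \<le> A n j" by (rule kernels_A1_antimono[OF assms(1,2)]) (use assms(3) in auto)
  finally show ?thesis .
qed

text \<open>The recursion that forces the sums in \<open>comp_kernel_identity\<close> to stay equal to 1. The last argument is the
  distance \<open>n - j\<close> from the current time level, along which the recursion runs.\<close>

fun comp_kernel :: "(nat \<Rightarrow> nat \<Rightarrow> real) \<Rightarrow> nat \<Rightarrow> nat \<Rightarrow> real" where
  "comp_kernel A n d =
     (if d = 0 then 1
      else (\<Sum>e<d. (A (n - e) (d - e - 1) - A (n - e) (d - e)) * comp_kernel A n e)) / A (n - d) 0"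

declare comp_kernel.simps [simp del]

lemma comp_kernel_nonneg:
  assumes "kernels_A1 N A" "n \<in> {1..N}" "d < n"
  shows "0 \<le> comp_kernel A n d"
  using assms(3)
proof (induction d rule: less_induct)
  case (less d)
  have "0 \<le> (A (n - e) (d - e - 1) - A (n - e) (d - e)) * comp_kernel A n e" if "e < d" for e
  proof -
    have "A (n - e) (d - e) \<le> A (n - e) (d - e - 1)"
      by (rule kernels_A1_antimono[OF assms(1)]) (use that less.prems assms(2) in auto)
    moreover have "0 \<le> comp_kernel A n e" using less that by auto
    ultimately show ?thesis by simp
  qed
  moreover have "0 < A (n - d) 0"
    by (rule kernels_A1_pos[OF assms(1)]) (use less.prems assms(2) in auto)
  ultimately show ?case
    by (subst comp_kernel.simps) (auto intro!: sum_nonneg divide_nonneg_pos)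
qed

text \<open>By its recursion, the newest weight turns the sum for \<open>Suc d\<close> into the sum for \<open>d\<close>, all kernel
  indices being lowered by one.\<close>

lemma comp_kernel_identity:
  assumes "kernels_A1 N A" "n \<in> {1..N}" "d < n"
  shows "(\<Sum>e\<le>d. A (n - e) (d - e) * comp_kernel A n e) = 1"
  using assms(3)
proof (induction d)
  case 0
  have "0 < A n 0" using kernels_A1_pos[OF assms(1,2)] 0 by auto
  then show ?case by (simp add: comp_kernel.simps)
next
  case (Suc d)
  have "0 < A (n - Suc d) 0"
    by (rule kernels_A1_pos[OF assms(1)]) (use Suc.prems assms(2) in auto)
  then have eq: "A (n - Suc d) 0 * comp_kernel A n (Suc d)
      = (\<Sum>e<Suc d. (A (n - e) (Suc d - e - 1) - A (n - e) (Suc d - e)) * comp_kernel A n e)"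
    by (subst comp_kernel.simps) (simp del: sum.lessThan_Suc)
  have "(\<Sum>e\<le>Suc d. A (n - e) (Suc d - e) * comp_kernel A n e)
      = (\<Sum>e<Suc d. A (n - e) (Suc d - e) * comp_kernel A n e) + A (n - Suc d) 0 * comp_kernel A n (Suc d)"
    by (simp add: lessThan_Suc_atMost)
  also have "\<dots> = (\<Sum>e<Suc d. A (n - e) (Suc d - e - 1) * comp_kernel A n e)"
    unfolding eq by (simp add: algebra_simps sum_subtractf del: sum.lessThan_Suc)
  also have "\<dots> = (\<Sum>e\<le>d. A (n - e) (d - e) * comp_kernel A n e)"
    by (rule sum.cong) auto
  finally show ?case using Suc by simp
qed

text \<open>The weights indexed by time level, as in sums over the mesh.\<close>

definition cweight :: "(nat \<Rightarrow> nat \<Rightarrow> real) \<Rightarrow> nat \<Rightarrow> nat \<Rightarrow> real" where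
  "cweight A n j = comp_kernel A n (n - j)"

lemma cweight_nonneg:
  assumes "kernels_A1 N A" "n \<in> {1..N}" "j \<in> {1..n}"
  shows "0 \<le> cweight A n j"
  unfolding cweight_def using comp_kernel_nonneg[OF assms(1,2)] assms(3) by auto

lemma cweight_identity:
  assumes "kernels_A1 N A" "n \<in> {1..N}" "k \<in> {1..n}"
  shows "(\<Sum>j\<in>{k..n}. cweight A n j * A j (j - k)) = 1"
proof -
  have "(\<Sum>j\<in>{k..n}. cweight A n j * A j (j - k)) = (\<Sum>e\<le>n - k. A (n - e) (n - k - e) * comp_kernel A n e)"
    by (rule sum.reindex_bij_witness[of _ "\<lambda>e. n - e" "\<lambda>j. n - j"])
       (use assms(3) in \<open>auto simp: cweight_def\<close>)
  also have "\<dots> = 1" by (rule comp_kernel_identity[OF assms(1,2)]) (use assms(3) in auto)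
  finally show ?thesis .
qed

text \<open>Applied to increments \<open>x k = v k - v (k - 1)\<close>, this inverts the discrete derivative: the right-hand
  side telescopes.\<close>

lemma cweight_invert:
  assumes "kernels_A1 N A" "n \<in> {1..N}"
  shows "(\<Sum>j\<in>{1..n}. cweight A n j * (\<Sum>k\<in>{1..j}. A j (j - k) * x k)) = (\<Sum>k\<in>{1..n}. x k)"
proof -
  have "(\<Sum>j\<in>{1..n}. cweight A n j * (\<Sum>k\<in>{1..j}. A j (j - k) * x k))
      = (\<Sum>k\<in>{1..n}. \<Sum>j\<in>{k..n}. cweight A n j * A j (j - k) * x k)"
    unfolding sum_distrib_left sum_triangle_swap by (simp add: mult.assoc)
  also have "\<dots> = (\<Sum>k\<in>{1..n}. (\<Sum>j\<in>{k..n}. cweight A n j * A j (j - k)) * x k)"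
    by (simp add: sum_distrib_right)
  also have "\<dots> = (\<Sum>k\<in>{1..n}. x k)"
    using cweight_identity[OF assms] by (intro sum.cong) auto
  finally show ?thesis .
qed

text \<open>Leaving out the newest levels of a nonnegative sum only decreases the coefficient of each \<open>x k\<close>,
  which is 1 for the full sum.\<close>

lemma cweight_invert_partial:
  assumes "kernels_A1 N A" "n \<in> {1..N}" and x: "\<And>k. k \<in> {1..n} \<Longrightarrow> 0 \<le> x k" and "m \<le> n"
  shows "(\<Sum>j\<in>{1..m}. cweight A n j * (\<Sum>k\<in>{1..j}. A j (j - k) * x k)) \<le> (\<Sum>k\<in>{1..m}. x k)"
proof -
  have "(\<Sum>j\<in>{1..m}. cweight A n j * (\<Sum>k\<in>{1..j}. A j (j - k) * x k))
      = (\<Sum>k\<in>{1..m}. \<Sum>j\<in>{k..m}. cweight A n j * A j (j - k) * x k)"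
    unfolding sum_distrib_left sum_triangle_swap by (simp add: mult.assoc)
  also have "\<dots> = (\<Sum>k\<in>{1..m}. (\<Sum>j\<in>{k..m}. cweight A n j * A j (j - k)) * x k)"
    by (simp add: sum_distrib_right)
  also have "\<dots> \<le> (\<Sum>k\<in>{1..m}. 1 * x k)"
  proof (rule sum_mono, rule mult_right_mono)
    fix k assume k: "k \<in> {1..m}"
    have "(\<Sum>j\<in>{k..m}. cweight A n j * A j (j - k)) \<le> (\<Sum>j\<in>{k..n}. cweight A n j * A j (j - k))"
    proof (rule sum_mono2)
      fix j assume "j \<in> {k..n} - {k..m}"
      then have "j \<in> {1..n}" "j \<in> {1..N}" "j - k < j" using k assms by auto
      then show "0 \<le> cweight A n j * A j (j - k)"
        using cweight_nonneg[OF assms(1,2)] kernels_A1_pos[OF assms(1)] by (simp add: less_imp_le)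
    qed (use assms in auto)
    also have "\<dots> = 1" using cweight_identity[OF assms(1,2)] k assms by auto
    finally show "(\<Sum>j\<in>{k..m}. cweight A n j * A j (j - k)) \<le> 1" .
    show "0 \<le> x k" using x k assms by auto
  qed
  finally show ?thesis by simp
qed

lemma cweight_diag:
  assumes "kernels_A1 N A" "n \<in> {1..N}" "k \<in> {1..n}"
  shows "cweight A n k * A k 0 \<le> 1"
proof -
  have "(\<Sum>j\<in>{k}. cweight A n j * A j (j - k)) \<le> (\<Sum>j\<in>{k..n}. cweight A n j * A j (j - k))"
  proof (rule sum_mono2)
    fix j assume "j \<in> {k..n} - {k}"
    then have "j \<in> {1..n}" "j \<in> {1..N}" "j - k < j" using assms by auto
    then show "0 \<le> cweight A n j * A j (j - k)"
      using cweight_nonneg[OF assms(1,2)] kernels_A1_pos[OF assms(1)] by (simp add: less_imp_le)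
  qed (use assms in auto)
  then show ?thesis using cweight_identity[OF assms] by simp
qed

text \<open>The history part of the error convolution structure collapses to diagonal terms: the two halves of
  each kernel difference are full convolutions, with \<open>G\<close> shifted by one level in the first, and
  \<open>cweight_invert\<close> evaluates both.\<close>

lemma cweight_history:
  assumes "kernels_A1 N A" "n \<in> {1..N}"
  shows "(\<Sum>k\<in>{1..n}. cweight A n k * (\<Sum>j\<in>{1..<k}. (A k (k - j - 1) - A k (k - j)) * G j))
       = (\<Sum>j\<in>{1..<n}. cweight A n j * A j 0 * G j)"
proof -
  \<comment> \<open>\<open>A k (k - j - 1)\<close> is the kernel that belongs to level \<open>j + 1\<close>; nothing is shifted into level 1\<close>
  define y where "y k = (if k = 1 then 0 else G (k - 1))" for k
  define z where "z k = G k" for k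
  have split: "(\<Sum>j\<in>{1..<k}. (A k (k - j - 1) - A k (k - j)) * G j)
      = (\<Sum>j\<in>{1..k}. A k (k - j) * y j) - (\<Sum>j\<in>{1..k}. A k (k - j) * z j) + A k 0 * G k"
    if "k \<in> {1..n}" for k
  proof -
    obtain l where l: "k = Suc l" using \<open>k \<in> {1..n}\<close> by (cases k) auto
    have "(\<Sum>j\<in>{1..k}. A k (k - j) * y j) = (\<Sum>j\<in>{2..Suc l}. A k (k - j) * y j)"
      by (rule sum.mono_neutral_right) (auto simp: y_def l)
    also have "\<dots> = (\<Sum>j\<in>{1..<k}. A k (k - j - 1) * G j)"
      by (rule sum.reindex_bij_witness[of _ Suc "\<lambda>j. j - 1"]) (auto simp: y_def l)
    finally have 1: "(\<Sum>j\<in>{1..k}. A k (k - j) * y j) = (\<Sum>j\<in>{1..<k}. A k (k - j - 1) * G j)" .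
    have "(\<Sum>j\<in>{1..k}. A k (k - j) * z j) = (\<Sum>j\<in>{1..<k}. A k (k - j) * G j) + A k 0 * G k"
      by (simp add: z_def l atLeastLessThanSuc_atLeastAtMost)
    with 1 show ?thesis by (simp add: algebra_simps sum_subtractf)
  qed
  have "(\<Sum>k\<in>{1..n}. cweight A n k * (\<Sum>j\<in>{1..<k}. (A k (k - j - 1) - A k (k - j)) * G j))
      = (\<Sum>k\<in>{1..n}. cweight A n k * (\<Sum>j\<in>{1..k}. A k (k - j) * y j))
        - (\<Sum>k\<in>{1..n}. cweight A n k * (\<Sum>j\<in>{1..k}. A k (k - j) * z j))
        + (\<Sum>k\<in>{1..n}. cweight A n k * A k 0 * G k)"
  proof -
    have "cweight A n k * (\<Sum>j\<in>{1..<k}. (A k (k - j - 1) - A k (k - j)) * G j)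
        = cweight A n k * (\<Sum>j\<in>{1..k}. A k (k - j) * y j)
          - cweight A n k * (\<Sum>j\<in>{1..k}. A k (k - j) * z j) + cweight A n k * A k 0 * G k"
      if "k \<in> {1..n}" for k
      unfolding split[OF that] by (simp add: distrib_left right_diff_distrib)
    then have "(\<Sum>k\<in>{1..n}. cweight A n k * (\<Sum>j\<in>{1..<k}. (A k (k - j - 1) - A k (k - j)) * G j))
        = (\<Sum>k\<in>{1..n}. cweight A n k * (\<Sum>j\<in>{1..k}. A k (k - j) * y j)
          - cweight A n k * (\<Sum>j\<in>{1..k}. A k (k - j) * z j) + cweight A n k * A k 0 * G k)"
      by (rule sum.cong[OF refl])
    then show ?thesis by (simp only: sum.distrib sum_subtractf)
  qed
  also have "\<dots> = (\<Sum>k\<in>{1..n}. y k) - (\<Sum>k\<in>{1..n}. z k) + (\<Sum>k\<in>{1..n}. cweight A n k * A k 0 * G k)"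
    using cweight_invert[OF assms] by simp
  also have "(\<Sum>k\<in>{1..n}. y k) = (\<Sum>k\<in>{2..n}. y k)"
    by (rule sum.mono_neutral_right) (auto simp: y_def)
  also have "\<dots> = (\<Sum>k\<in>{1..<n}. G k)"
    by (rule sum.reindex_bij_witness[of _ Suc "\<lambda>j. j - 1"]) (auto simp: y_def)
  also have "(\<Sum>k\<in>{1..n}. z k) = (\<Sum>k\<in>{1..<n}. G k) + G n"
    using assms(2) by (cases n) (auto simp: z_def atLeastLessThanSuc_atLeastAtMost)
  also have "(\<Sum>k\<in>{1..n}. cweight A n k * A k 0 * G k)
      = (\<Sum>k\<in>{1..<n}. cweight A n k * A k 0 * G k) + cweight A n n * A n 0 * G n"
    using assms(2) by (cases n) (auto simp: atLeastLessThanSuc_atLeastAtMost)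
  also have "cweight A n n * A n 0 = 1"
    using cweight_identity[OF assms, of n] assms(2) by simp
  finally show ?thesis by simp
qed

section \<open>Coercivity of the discrete derivative\<close>

text \<open>This is where the admissible range of \<open>\<theta>\<close> comes from: the expression is the coefficient
  of \<open>d (n - 1)\<^sup>2\<close> that remains in \<open>discrete_caputo_energy\<close> after completing squares.\<close>

lemma theta_quadratic:
  fixes \<theta> a0 a1 :: real
  assumes "0 \<le> a1" "a1 \<le> a0" "0 < a0" "0 \<le> \<theta>" "\<theta> \<le> (a0 - a1) / (2 * a0 - a1)"
  shows "0 \<le> (1 - 2 * \<theta>) * (a0 - a1) - \<theta>\<^sup>2 * a1"
proof -
  have th: "\<theta> * (2 * a0 - a1) \<le> a0 - a1"
    using assms by (simp add: pos_le_divide_eq)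
  have "\<theta> \<le> 1/2"
  proof -
    have "(a0 - a1) / (2 * a0 - a1) \<le> 1/2" using assms by (simp add: field_simps)
    then show ?thesis using assms by linarith
  qed
  \<comment> \<open>replace \<open>a0 - a1\<close> by its lower bound in terms of \<open>\<theta>\<close>\<close>
  have "(1 - 2 * \<theta>) * (\<theta> * (2 * a0 - a1)) \<le> (1 - 2 * \<theta>) * (a0 - a1)"
    using th \<open>\<theta> \<le> 1/2\<close> by (intro mult_left_mono) auto
  moreover have "0 \<le> (1 - 2 * \<theta>) * (\<theta> * (2 * a0 - a1)) - \<theta>\<^sup>2 * a1"
  proof -
    have "\<theta>\<^sup>2 * a1 \<le> \<theta> * ((1 - 2 * \<theta>) * (2 * a0 - a1))"
    proof -
      have "\<theta> * a1 \<le> (1 - 2 * \<theta>) * (2 * a0 - a1)"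
      proof -
        have "\<theta> * (4 * a0 - 2 * a1 + a1) \<le> 2 * a0 - a1"
        proof -
          have "\<theta> * (4 * a0 - a1) = 2 * (\<theta> * (2 * a0 - a1)) + \<theta> * a1" by (simp add: algebra_simps)
          also have "\<dots> \<le> 2 * (a0 - a1) + 1 * a1"
            using th \<open>\<theta> \<le> 1/2\<close> assms(1) by (intro add_mono mult_right_mono) auto
          finally show ?thesis by (simp add: algebra_simps)
        qed
        then show ?thesis by (simp add: algebra_simps)
      qed
      then show ?thesis using assms(4) by (simp add: power2_eq_square mult_left_mono mult.assoc)
    qed
    then show ?thesis by (simp add: algebra_simps)
  qed
  ultimately show ?thesis by linarith
qed

lemma kernel_summation_by_parts:
  fixes a d :: "nat \<Rightarrow> real"
  assumes "n \<ge> 1"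
  shows "(\<Sum>k\<in>{1..n}. a (n - k) * (d (k - 1) - d k))
       = a (n - 1) * d 0 + (\<Sum>k\<in>{1..<n}. (a (n - k - 1) - a (n - k)) * d k) - a 0 * d n"
proof -
  have "(\<Sum>k\<in>{1..n}. a (n - k) * d (k - 1)) = (\<Sum>k\<in>{0..<n}. a (n - k - 1) * d k)"
    by (rule sum.reindex_bij_witness[of _ Suc "\<lambda>j. j - 1"]) (auto simp: Suc_diff_le)
  also have "\<dots> = a (n - 1) * d 0 + (\<Sum>k\<in>{1..<n}. a (n - k - 1) * d k)"
    using assms by (simp add: sum.atLeast_Suc_lessThan)
  finally have 1: "(\<Sum>k\<in>{1..n}. a (n - k) * d (k - 1)) = \<dots>" .
  have 2: "(\<Sum>k\<in>{1..n}. a (n - k) * d k) = (\<Sum>k\<in>{1..<n}. a (n - k) * d k) + a 0 * d n"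
    using assms by (cases n) (auto simp: atLeastLessThanSuc_atLeastAtMost)
  show ?thesis using 1 2 by (simp add: algebra_simps sum_subtractf)
qed

text \<open>With \<open>d k = v n - v k\<close>, summation by parts writes the difference of the two sides as
  \<open>\<Sum>k<n. c k * (d k)\<^sup>2 - 2 * \<theta> * d (n - 1) * (\<Sum>k<n. c k * d k)\<close>, where the \<open>c k\<close> are the kernel increments,
  nonnegative by (A1) and of sum \<open>A n 0\<close>. For \<open>k < n - 1\<close> completing the square costs
  \<open>c k * \<theta>\<^sup>2 * (d (n - 1))\<^sup>2\<close>, and \<open>theta_quadratic\<close> pays for these losses with the term \<open>k = n - 1\<close>.\<close>

lemma discrete_caputo_energy:
  assumes A1: "kernels_A1 N A" and n: "n \<in> {1..N}" and th: "0 \<le> \<theta>" "\<theta> = 0 \<or> \<theta> \<le> theta_bound A n"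
  shows "discrete_caputo A (\<lambda>k. (v k)\<^sup>2) n \<le> 2 * offset \<theta> v n * discrete_caputo A v n"
proof -
  define d where "d k = v n - v k" for k
  define c where "c k = (if k = 0 then A n (n - 1) else A n (n - k - 1) - A n (n - k))" for k
  have parts: "(\<Sum>k\<in>{1..n}. A n (n - k) * (e (k - 1) - e k)) = (\<Sum>k\<in>{0..<n}. c k * e k)"
    if "e n = 0" for e :: "nat \<Rightarrow> real"
  proof -
    have "(\<Sum>k\<in>{0..<n}. c k * e k) = c 0 * e 0 + (\<Sum>k\<in>{1..<n}. c k * e k)"
      using n by (simp add: sum.atLeast_Suc_lessThan)
    also have "(\<Sum>k\<in>{1..<n}. c k * e k) = (\<Sum>k\<in>{1..<n}. (A n (n - k - 1) - A n (n - k)) * e k)"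
      by (rule sum.cong) (auto simp: c_def)
    finally show ?thesis
      using kernel_summation_by_parts[of n "A n" e] n that by (simp add: c_def)
  qed
  have Dv: "discrete_caputo A v n = (\<Sum>k\<in>{0..<n}. c k * d k)"
    using parts[of d] by (simp add: discrete_caputo_def d_def)
  have "2 * v n * discrete_caputo A v n - discrete_caputo A (\<lambda>k. (v k)\<^sup>2) n
      = (\<Sum>k\<in>{1..n}. A n (n - k) * ((d (k - 1))\<^sup>2 - (d k)\<^sup>2))"
    unfolding discrete_caputo_def sum_distrib_left sum_subtractf[symmetric]
    by (rule sum.cong) (auto simp: d_def power2_eq_square algebra_simps)
  also have "\<dots> = (\<Sum>k\<in>{0..<n}. c k * (d k)\<^sup>2)" using parts[of "\<lambda>k. (d k)\<^sup>2"] by (simp add: d_def)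
  finally have D2: "2 * v n * discrete_caputo A v n - discrete_caputo A (\<lambda>k. (v k)\<^sup>2) n
      = (\<Sum>k\<in>{0..<n}. c k * (d k)\<^sup>2)" .
  have off: "offset \<theta> v n = v n - \<theta> * d (n - 1)" by (simp add: offset_def d_def algebra_simps)
  have c_nonneg: "0 \<le> c k" if "k < n" for k
  proof (cases "k = 0")
    case True
    then show ?thesis using kernels_A1_pos[OF A1 n, of "n - 1"] n by (simp add: c_def)
  next
    case False
    have "A n (n - k) \<le> A n (n - k - 1)"
      by (rule kernels_A1_antimono[OF A1 n]) (use that False in auto)
    then show ?thesis using False by (simp add: c_def)
  qed
  define a1 where "a1 = (if n = 1 then 0 else A n 1)"
  have a0: "0 < A n 0" using kernels_A1_pos[OF A1 n] n by auto
  have a1: "0 \<le> a1" "a1 \<le> A n 0"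
    using kernels_A1_pos[OF A1 n, of 1] kernels_A1_antimono[OF A1 n, of 0 1] n a0 by (auto simp: a1_def)
  have last: "c (n - 1) = A n 0 - a1"
    using n by (auto simp: c_def a1_def)
  have "(\<Sum>k\<in>{0..<n}. c k) = A n 0"
  proof -
    have "(\<Sum>k\<in>{0..<n}. c k) = c 0 + (\<Sum>k\<in>{1..<n}. c k)"
      using n by (simp add: sum.atLeast_Suc_lessThan)
    also have "(\<Sum>k\<in>{1..<n}. c k) = (\<Sum>k\<in>{1..<n}. A n (n - k - 1) - A n (n - k))"
      by (rule sum.cong) (auto simp: c_def)
    also have "(\<Sum>k\<in>{1..<n}. A n (n - k - 1) - A n (n - k)) = A n 0 - A n (n - 1)"
      using kernel_summation_by_parts[of n "A n" "\<lambda>k. 1"] n by (simp add: algebra_simps)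
    finally show ?thesis by (simp add: c_def)
  qed
  moreover have splitn: "(\<Sum>k\<in>{0..<n}. e k) = (\<Sum>k\<in>{0..<n - 1}. e k) + e (n - 1)" for e :: "nat \<Rightarrow> real"
    using n by (cases n) auto
  ultimately have csum: "(\<Sum>k\<in>{0..<n - 1}. c k) = a1" using last by simp
  have quad: "0 \<le> (\<Sum>k\<in>{0..<n}. c k * (d k)\<^sup>2) - 2 * \<theta> * d (n - 1) * (\<Sum>k\<in>{0..<n}. c k * d k)"
  proof (cases "\<theta> = 0")
    case True
    then show ?thesis by (auto intro!: sum_nonneg mult_nonneg_nonneg c_nonneg)
  next
    case False
    then have th': "\<theta> \<le> (A n 0 - a1) / (2 * A n 0 - a1)"
      using th by (simp add: theta_bound_def a1_def Let_def)
    let ?D = "d (n - 1)"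
    \<comment> \<open>complete the square in every term except the last\<close>
    have "a1 * (- \<theta>\<^sup>2 * ?D\<^sup>2) = (\<Sum>k\<in>{0..<n - 1}. c k * (- \<theta>\<^sup>2 * ?D\<^sup>2))"
      unfolding csum[symmetric] by (rule sum_distrib_right)
    also have "\<dots> \<le> (\<Sum>k\<in>{0..<n - 1}. c k * ((d k)\<^sup>2 - 2 * \<theta> * ?D * d k))"
    proof (rule sum_mono, rule mult_left_mono)
      fix k assume "k \<in> {0..<n - 1}"
      have "0 \<le> (d k - \<theta> * ?D)\<^sup>2" by simp
      then show "- \<theta>\<^sup>2 * ?D\<^sup>2 \<le> (d k)\<^sup>2 - 2 * \<theta> * ?D * d k"
        by (simp add: power2_eq_square algebra_simps)
    qed (use c_nonneg in auto)
    finally have le: "a1 * (- \<theta>\<^sup>2 * ?D\<^sup>2) \<le> (\<Sum>k\<in>{0..<n - 1}. c k * ((d k)\<^sup>2 - 2 * \<theta> * ?D * d k))" .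
    have "0 \<le> ?D\<^sup>2 * ((1 - 2 * \<theta>) * (A n 0 - a1) - \<theta>\<^sup>2 * a1)"
      using theta_quadratic[OF a1 a0 th(1) th'] by simp
    also have "\<dots> \<le> (\<Sum>k\<in>{0..<n - 1}. c k * ((d k)\<^sup>2 - 2 * \<theta> * ?D * d k))
        + c (n - 1) * (?D\<^sup>2 - 2 * \<theta> * ?D * ?D)"
      using le unfolding last by (simp add: power2_eq_square algebra_simps)
    also have "\<dots> = (\<Sum>k\<in>{0..<n}. c k * ((d k)\<^sup>2 - 2 * \<theta> * ?D * d k))"
      using splitn[of "\<lambda>k. c k * ((d k)\<^sup>2 - 2 * \<theta> * ?D * d k)"] by simp
    also have "\<dots> = (\<Sum>k\<in>{0..<n}. c k * (d k)\<^sup>2) - 2 * \<theta> * ?D * (\<Sum>k\<in>{0..<n}. c k * d k)"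
      by (simp add: sum_subtractf sum_distrib_left algebra_simps)
    finally show ?thesis .
  qed
  have "2 * offset \<theta> v n * discrete_caputo A v n - discrete_caputo A (\<lambda>k. (v k)\<^sup>2) n
     = (2 * v n * discrete_caputo A v n - discrete_caputo A (\<lambda>k. (v k)\<^sup>2) n)
       - 2 * \<theta> * d (n - 1) * discrete_caputo A v n"
    unfolding off by (simp add: algebra_simps)
  then show ?thesis using quad unfolding D2[symmetric] Dv[symmetric] by linarith
qed

section \<open>Power kernels and Chebyshev's integral inequality\<close>

lemma omega_nonneg: "0 < \<beta> \<Longrightarrow> 0 \<le> omega \<beta> s"
  by (simp add: omega_def Gamma_real_pos less_imp_le)

lemma omega_zero [simp]: "omega \<beta> 0 = 0"
  by (simp add: omega_def)

lemma Gamma_real_nonzero [simp]: "0 < (\<beta>::real) \<Longrightarrow> Gamma \<beta> \<noteq> 0"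
  using Gamma_real_pos[of \<beta>] by (metis less_irrefl)

lemma Gamma_1_plus: "0 < (\<beta>::real) \<Longrightarrow> Gamma (1 + \<beta>) = \<beta> * Gamma \<beta>"
  using Gamma_plus1[of \<beta>] by (force simp: add.commute elim!: nonpos_Ints_cases)

lemma omega_has_derivative:
  assumes "0 < \<beta>" "0 < s"
  shows "(omega (1 + \<beta>) has_real_derivative omega \<beta> s) (at s)"
proof -
  have "((\<lambda>s. s powr \<beta> / Gamma (1 + \<beta>)) has_real_derivative \<beta> * s powr (\<beta> - 1) / Gamma (1 + \<beta>)) (at s)"
    using assms by (auto intro!: derivative_eq_intros)
  moreover have "\<beta> * s powr (\<beta> - 1) / Gamma (1 + \<beta>) = omega \<beta> s"
    using assms by (simp add: Gamma_1_plus omega_def)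
  ultimately show ?thesis by (simp add: omega_def[abs_def])
qed

lemma continuous_on_omega:
  assumes "0 < \<beta>"
  shows "continuous_on {0..} (omega (1 + \<beta>))"
  unfolding omega_def[abs_def] using assms Gamma_real_pos[of "1 + \<beta>"]
  by (intro continuous_intros continuous_on_powr') auto

lemma omega_mono:
  assumes "1 \<le> \<beta>" "0 \<le> r" "r \<le> s"
  shows "omega \<beta> r \<le> omega \<beta> s"
proof (cases "r = 0")
  case True
  then show ?thesis using omega_nonneg[of \<beta> s] assms by simp
next
  case False
  then show ?thesis using assms Gamma_real_pos[of \<beta>]
    by (auto simp: omega_def intro!: divide_right_mono powr_mono2)
qed

lemma omega_antimono:
  assumes "0 < \<beta>" "\<beta> \<le> 1" "0 < r" "r \<le> s"
  shows "omega \<beta> s \<le> omega \<beta> r"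
  using assms Gamma_real_pos[of \<beta>]
  by (auto simp: omega_def intro!: divide_right_mono powr_mono2')

lemma reflected_omega_primitive:
  fixes \<alpha> T p q :: real
  assumes "\<alpha> < 1" "q \<le> T"
  shows "continuous_on {p..q} (\<lambda>s. - omega (2 - \<alpha>) (T - s))"
    and "s \<in> {p<..<q} \<Longrightarrow> ((\<lambda>s. - omega (2 - \<alpha>) (T - s)) has_real_derivative omega (1 - \<alpha>) (T - s)) (at s)"
proof -
  have "continuous_on {0..} (omega (2 - \<alpha>))"
    using continuous_on_omega[of "1 - \<alpha>"] assms by (simp add: algebra_simps)
  then have "continuous_on {p..q} (\<lambda>s. omega (2 - \<alpha>) (T - s))"
    by (rule continuous_on_compose2[of _ _ _ "\<lambda>s. T - s"]) (use assms in \<open>auto intro!: continuous_intros\<close>)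
  then show "continuous_on {p..q} (\<lambda>s. - omega (2 - \<alpha>) (T - s))" by (rule continuous_on_minus)
next
  assume s: "s \<in> {p<..<q}"
  have "(omega (1 + (1 - \<alpha>)) has_real_derivative omega (1 - \<alpha>) (T - s)) (at (T - s))"
    by (rule omega_has_derivative) (use s assms in auto)
  then have "(omega (2 - \<alpha>) has_real_derivative omega (1 - \<alpha>) (T - s)) (at (T - s))"
    by (simp add: algebra_simps)
  then show "((\<lambda>s. - omega (2 - \<alpha>) (T - s)) has_real_derivative omega (1 - \<alpha>) (T - s)) (at s)"
    by (auto intro!: derivative_eq_intros DERIV_chain2[of "omega (2 - \<alpha>)" _ "\<lambda>s. T - s" s])
qed

text \<open>Also valid for \<open>q = T\<close>, where the integrand is singular, because the primitive is continuous there.\<close>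

lemma has_integral_reflected_omega:
  fixes \<alpha> T p q :: real
  assumes "\<alpha> < 1" "p \<le> q" "q \<le> T"
  shows "((\<lambda>s. omega (1 - \<alpha>) (T - s)) has_integral omega (2 - \<alpha>) (T - p) - omega (2 - \<alpha>) (T - q)) {p..q}"
proof -
  have "((\<lambda>s. omega (1 - \<alpha>) (T - s)) has_integral - omega (2 - \<alpha>) (T - q) - - omega (2 - \<alpha>) (T - p)) {p..q}"
    by (rule fundamental_theorem_of_calculus_interior)
       (use assms reflected_omega_primitive[OF assms(1,3)] in
        \<open>auto simp: has_real_derivative_iff_has_vector_derivative\<close>)
  then show ?thesis by simp
qed

text \<open>The semigroup property of fractional integrals; after scaling to the unit interval it is Euler's Beta
  integral.\<close>

lemma omega_convolution:
  assumes "0 < \<gamma>" "0 < \<beta>" "0 < T"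
  shows "((\<lambda>s. omega \<gamma> (T - s) * omega \<beta> s) has_integral omega (\<gamma> + \<beta>) T) {0..T}"
proof -
  have "((\<lambda>x. x powr (\<beta> - 1) * (1 - x) powr (\<gamma> - 1)) has_integral Beta \<beta> \<gamma>) (cbox 0 1)"
    using has_integral_Beta_real[of \<beta> \<gamma>] assms by simp
  from has_integral_affinity'[OF this, of "1 / T" 0] assms
  have "((\<lambda>s. (s / T) powr (\<beta> - 1) * (1 - s / T) powr (\<gamma> - 1)) has_integral T * Beta \<beta> \<gamma>) {0..T}"
    by (simp add: mult.commute)
  then have int: "((\<lambda>s. T powr (\<gamma> + \<beta> - 2) / (Gamma \<gamma> * Gamma \<beta>) * ((s / T) powr (\<beta> - 1) * (1 - s / T) powr (\<gamma> - 1)))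
      has_integral T powr (\<gamma> + \<beta> - 2) / (Gamma \<gamma> * Gamma \<beta>) * (T * Beta \<beta> \<gamma>)) {0..T}"
    by (rule has_integral_mult_right)
  have "T powr (\<gamma> + \<beta> - 2) / (Gamma \<gamma> * Gamma \<beta>) * (T * Beta \<beta> \<gamma>) = T powr (\<gamma> + \<beta> - 2) * T / Gamma (\<gamma> + \<beta>)"
    using assms Gamma_real_pos[of \<gamma>] Gamma_real_pos[of \<beta>] by (simp add: Beta_def add.commute)
  also have "T powr (\<gamma> + \<beta> - 2) * T = T powr (\<gamma> + \<beta> - 1)"
    using assms by (simp add: powr_mult_base mult.commute)
  finally have const: "T powr (\<gamma> + \<beta> - 2) / (Gamma \<gamma> * Gamma \<beta>) * (T * Beta \<beta> \<gamma>) = omega (\<gamma> + \<beta>) T"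
    by (simp add: omega_def)
  have "omega \<gamma> (T - s) * omega \<beta> s
      = T powr (\<gamma> + \<beta> - 2) / (Gamma \<gamma> * Gamma \<beta>) * ((s / T) powr (\<beta> - 1) * (1 - s / T) powr (\<gamma> - 1))"
    if "s \<in> {0..T}" for s
  proof -
    have "1 - s / T = (T - s) / T" using assms by (simp add: field_simps)
    then have "(s / T) powr (\<beta> - 1) * (1 - s / T) powr (\<gamma> - 1)
        = s powr (\<beta> - 1) * (T - s) powr (\<gamma> - 1) / (T powr (\<beta> - 1) * T powr (\<gamma> - 1))"
      using that assms by (simp add: powr_divide)
    also have "T powr (\<beta> - 1) * T powr (\<gamma> - 1) = T powr (\<gamma> + \<beta> - 2)"
      by (simp add: powr_add[symmetric] algebra_simps)
    finally show ?thesis using assms by (simp add: omega_def)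
  qed
  note eq = this
  show ?thesis
    by (rule has_integral_eq[OF _ int[unfolded const]]) (simp only: eq)
qed

text \<open>For an increasing \<open>a\<close> and a decreasing \<open>b\<close> the mean of the product is at most the product of the
  means. The mean value theorem gives a point \<open>c\<close> where \<open>a\<close> equals its mean, and then
  \<open>(a s - a c) * (b s - b c) \<le> 0\<close> is integrated. Primitives replace the integrals of \<open>a\<close> and
  \<open>b\<close>, so that both may be singular at the endpoints.\<close>

lemma chebyshev_integral_inequality:
  fixes a b F V :: "real \<Rightarrow> real"
  assumes pq: "p < q"
    and F: "continuous_on {p..q} F" "\<And>s. s \<in> {p<..<q} \<Longrightarrow> (F has_real_derivative a s) (at s)"
    and V: "continuous_on {p..q} V" "\<And>s. s \<in> {p<..<q} \<Longrightarrow> (V has_real_derivative b s) (at s)"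
    and mono: "\<And>r s. p < r \<Longrightarrow> r \<le> s \<Longrightarrow> s < q \<Longrightarrow> a r \<le> a s"
    and antimono: "\<And>r s. p < r \<Longrightarrow> r \<le> s \<Longrightarrow> s < q \<Longrightarrow> b s \<le> b r"
    and ab: "((\<lambda>s. a s * b s) has_integral I) {p..q}"
  shows "I * (q - p) \<le> (F q - F p) * (V q - V p)"
proof -
  have "\<exists>l z. p < z \<and> z < q \<and> (F has_real_derivative l) (at z) \<and> F q - F p = (q - p) * l"
    by (rule MVT[OF pq F(1)]) (use F(2) real_differentiable_def in fastforce)
  then obtain c where c: "p < c" "c < q" and mean: "F q - F p = (q - p) * a c"
    using F(2) DERIV_unique by (metis greaterThanLessThan_iff)
  have intF: "(a has_integral F q - F p) {p..q}"
    by (rule fundamental_theorem_of_calculus_interior)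
       (use pq F in \<open>auto simp: has_real_derivative_iff_has_vector_derivative\<close>)
  have intV: "(b has_integral V q - V p) {p..q}"
    by (rule fundamental_theorem_of_calculus_interior)
       (use pq V in \<open>auto simp: has_real_derivative_iff_has_vector_derivative\<close>)
  have "((\<lambda>s. a s * b s - a c * b s - b c * a s + a c * b c) has_integral
      I - a c * (V q - V p) - b c * (F q - F p) + (q - p) *\<^sub>R (a c * b c)) {p..q}"
    using pq ab intF intV
      has_integral_const_real[of "a c * b c" p q]
    by (intro has_integral_add has_integral_diff has_integral_mult_right) auto
  then have "((\<lambda>s. (a s - a c) * (b s - b c)) has_integral I - a c * (V q - V p)) {p..q}"
    unfolding mean by (simp add: algebra_simps)
  then have "((\<lambda>s. (a s - a c) * (b s - b c)) has_integral I - a c * (V q - V p)) {p<..<q}"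
    by (simp add: has_integral_Icc_iff_Ioo)
  moreover have "((\<lambda>s. 0) has_integral 0) {p<..<q}" by simp
  ultimately have "I - a c * (V q - V p) \<le> 0"
  proof (rule has_integral_le)
    fix s assume s: "s \<in> {p<..<q}"
    show "(a s - a c) * (b s - b c) \<le> 0"
    proof (cases "s \<le> c")
      case True
      then show ?thesis using mono[of s c] antimono[of s c] s c by (intro mult_nonpos_nonneg) auto
    next
      case False
      then show ?thesis using mono[of c s] antimono[of c s] s c by (intro mult_nonneg_nonpos) auto
    qed
  qed
  then have "I * (q - p) \<le> a c * (V q - V p) * (q - p)" using pq by (intro mult_right_mono) auto
  then show ?thesis unfolding mean by (simp add: algebra_simps)
qed

lemma integral_mesh_sum:
  fixes g :: "real \<Rightarrow> real" and t :: "nat \<Rightarrow> real" and j k :: nat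
  assumes "\<And>k. k \<in> {1..j} \<Longrightarrow> t (k - 1) \<le> t k" "g integrable_on {t 0..t j}"
  shows "integral {t 0..t j} g = (\<Sum>k\<in>{1..j}. integral {t (k - 1)..t k} g)"
    and "k \<in> {1..j} \<Longrightarrow> g integrable_on {t (k - 1)..t k}"
proof -
  have mono: "t i \<le> t k" if "i \<le> k" "k \<le> j" for i k
    using that
  proof (induction k rule: dec_induct)
    case (step k)
    then show ?case using assms(1)[of "Suc k"] by auto
  qed simp
  show "g integrable_on {t (k - 1)..t k}" if "k \<in> {1..j}" for k
    by (rule integrable_subinterval_real[OF assms(2)]) (use that mono in auto)
  have "integral {t 0..t i} g = (\<Sum>k\<in>{1..i}. integral {t (k - 1)..t k} g)" if "i \<le> j" for i
    using that
  proof (induction i)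
    case (Suc i)
    have "integral {t 0..t i} g + integral {t i..t (Suc i)} g = integral {t 0..t (Suc i)} g"
    proof (rule Henstock_Kurzweil_Integration.integral_combine)
      show "g integrable_on {t 0..t (Suc i)}"
        by (rule integrable_subinterval_real[OF assms(2)]) (use Suc mono in auto)
    qed (use Suc mono in auto)
    then show ?case using Suc by simp
  qed simp
  then show "integral {t 0..t j} g = (\<Sum>k\<in>{1..j}. integral {t (k - 1)..t k} g)" by simp
qed

section \<open>Comparison of the weights with fractional integration\<close>

locale nonuniform_caputo =
  fixes \<alpha> \<pi>A \<rho> T :: real and N :: nat and t :: "nat \<Rightarrow> real" and A :: "nat \<Rightarrow> nat \<Rightarrow> real"
  assumes alpha: "0 < \<alpha>" "\<alpha> < 1"
    and piA: "0 < \<pi>A"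
    and mesh: "time_mesh T N t"
    and A1: "kernels_A1 N A"
    and A2: "kernels_A2 N t \<alpha> \<pi>A A"
    and rho: "0 < \<rho>" "mesh_A3 N t \<rho>"
begin

lemma t_0 [simp]: "t 0 = 0"
  using mesh by (simp add: time_mesh_def)

lemma step_pos: "k \<in> {1..N} \<Longrightarrow> 0 < step t k"
  using mesh by (auto simp: time_mesh_def step_def)

lemma t_mono: "i \<le> k \<Longrightarrow> k \<le> N \<Longrightarrow> t i \<le> t k"
proof (induction k rule: dec_induct)
  case (step k)
  then show ?case using step_pos[of "Suc k"] by (auto simp: step_def)
qed simp

lemma t_pos: "k \<in> {1..N} \<Longrightarrow> 0 < t k"
  using t_mono[of 0 "k - 1"] step_pos[of k] unfolding step_def by fastforce

lemma t_nonneg: "k \<le> N \<Longrightarrow> 0 \<le> t k"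
  using t_mono[of 0 k] by simp

lemma t_le_T: "k \<le> N \<Longrightarrow> t k \<le> T"
  using t_mono[of k N] mesh by (simp add: time_mesh_def)

text \<open>Assumption (A2) with its integral evaluated.\<close>

lemma kernel_lower_bound:
  assumes "j \<in> {1..N}" "k \<in> {1..j}"
  shows "omega (2 - \<alpha>) (t j - t (k - 1)) - omega (2 - \<alpha>) (t j - t k) \<le> \<pi>A * step t k * A j (j - k)"
proof -
  have k: "k \<in> {1..N}" using assms by auto
  have "((\<lambda>s. omega (1 - \<alpha>) (t j - s)) has_integral
      omega (2 - \<alpha>) (t j - t (k - 1)) - omega (2 - \<alpha>) (t j - t k)) {t (k - 1)..t k}"
    by (rule has_integral_reflected_omega) (use alpha t_mono assms in auto)
  then have "A j (j - k) \<ge> 1 / (\<pi>A * step t k) * (omega (2 - \<alpha>) (t j - t (k - 1)) - omega (2 - \<alpha>) (t j - t k))"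
    using A2 assms unfolding kernels_A2_def by (metis integral_unique)
  then show ?thesis using step_pos[OF k] piA by (simp add: field_simps)
qed

text \<open>The case \<open>k = j\<close> of \<open>kernel_lower_bound\<close>: the newest kernel is at least of the size
  \<open>step t k powr (- \<alpha>)\<close>, which bounds the weights in \<open>cweight_le\<close>.\<close>

lemma kernel_diag_lower_bound:
  assumes "k \<in> {1..N}"
  shows "1 \<le> \<pi>A * Gamma (2 - \<alpha>) * step t k powr \<alpha> * A k 0"
proof -
  have s: "0 < step t k" by (rule step_pos[OF assms])
  have "omega (2 - \<alpha>) (step t k) \<le> \<pi>A * step t k * A k 0"
    using kernel_lower_bound[of k k] assms by (simp add: step_def)
  then have "step t k powr (1 - \<alpha>) \<le> \<pi>A * Gamma (2 - \<alpha>) * step t k * A k 0"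
    using Gamma_real_pos[of "2 - \<alpha>"] alpha by (simp add: omega_def field_simps)
  then have "step t k powr (\<alpha> - 1) * step t k powr (1 - \<alpha>)
      \<le> step t k powr (\<alpha> - 1) * (\<pi>A * Gamma (2 - \<alpha>) * step t k * A k 0)"
    by (intro mult_left_mono) auto
  moreover have "step t k powr (\<alpha> - 1) * step t k powr (1 - \<alpha>) = 1"
    using s by (simp add: powr_add[symmetric])
  moreover have "step t k powr (\<alpha> - 1) * step t k = step t k powr \<alpha>"
    using s powr_mult_base[of "step t k" "\<alpha> - 1"] by (simp add: mult.commute)
  moreover have "step t k powr (\<alpha> - 1) * (\<pi>A * Gamma (2 - \<alpha>) * step t k * A k 0)
      = \<pi>A * Gamma (2 - \<alpha>) * (step t k powr (\<alpha> - 1) * step t k) * A k 0" by (simp add: mult_ac)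
  ultimately show ?thesis by simp
qed

text \<open>The left-hand side is the exact Caputo derivative of \<open>omega (1 + \<beta>)\<close>. Because its derivative
  \<open>omega \<beta>\<close> decreases while \<open>omega (1 - \<alpha>) (t j - s)\<close> increases in \<open>s\<close>, Chebyshev's inequality bounds each
  subinterval by the mean of the kernel times the increment.\<close>

lemma omega_le_discrete_caputo:
  assumes j: "j \<in> {1..N}" and beta: "0 < \<beta>" "\<beta> \<le> 1"
  shows "omega (1 - \<alpha> + \<beta>) (t j)
    \<le> \<pi>A * (\<Sum>k\<in>{1..j}. A j (j - k) * (omega (1 + \<beta>) (t k) - omega (1 + \<beta>) (t (k - 1))))"
proof -
  let ?g = "\<lambda>s. omega (1 - \<alpha>) (t j - s) * omega \<beta> s"
  let ?V = "omega (1 + \<beta>)"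
  have int: "(?g has_integral omega (1 - \<alpha> + \<beta>) (t j)) {t 0..t j}"
    using omega_convolution[of "1 - \<alpha>" \<beta> "t j"] alpha beta t_pos[OF j] by simp
  have mono: "t (k - 1) \<le> t k" if "k \<in> {1..j}" for k using t_mono that j by auto
  note split = integral_mesh_sum[of j t ?g, OF mono has_integral_integrable[OF int]]
  have "omega (1 - \<alpha> + \<beta>) (t j) = (\<Sum>k\<in>{1..j}. integral {t (k - 1)..t k} ?g)"
    using split(1) integral_unique[OF int] by simp
  also have "\<dots> \<le> (\<Sum>k\<in>{1..j}. \<pi>A * (A j (j - k) * (?V (t k) - ?V (t (k - 1)))))"
  proof (rule sum_mono)
    fix k assume k: "k \<in> {1..j}"
    then have kN: "k \<in> {1..N}" using j by auto
    have step: "0 < step t k" by (rule step_pos[OF kN])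
    have tk: "0 \<le> t (k - 1)" "t k \<le> t j" using t_nonneg[of "k - 1"] t_mono[of k j] k j by auto
    let ?F = "\<lambda>s. - omega (2 - \<alpha>) (t j - s)"
    have "integral {t (k - 1)..t k} ?g * (t k - t (k - 1)) \<le> (?F (t k) - ?F (t (k - 1))) * (?V (t k) - ?V (t (k - 1)))"
    proof (rule chebyshev_integral_inequality)
      show "continuous_on {t (k - 1)..t k} ?V"
        by (rule continuous_on_subset[OF continuous_on_omega[OF beta(1)]]) (use tk in auto)
      show "(?V has_real_derivative omega \<beta> s) (at s)" if "s \<in> {t (k - 1)<..<t k}" for s
        by (rule omega_has_derivative) (use beta tk that in auto)
      show "omega (1 - \<alpha>) (t j - r) \<le> omega (1 - \<alpha>) (t j - s)" if "r \<le> s" "s < t k" for r s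
        by (rule omega_antimono) (use alpha tk that in auto)
      show "omega \<beta> s \<le> omega \<beta> r" if "t (k - 1) < r" "r \<le> s" for r s
        by (rule omega_antimono) (use beta tk that in auto)
      show "(?g has_integral integral {t (k - 1)..t k} ?g) {t (k - 1)..t k}"
        using split(2)[OF _ k] by (simp add: integrable_integral)
    qed (use step tk alpha reflected_omega_primitive[of \<alpha> "t k" "t j"] in \<open>auto simp: step_def\<close>)
    also have "\<dots> \<le> (\<pi>A * step t k * A j (j - k)) * (?V (t k) - ?V (t (k - 1)))"
    proof (rule mult_right_mono)
      show "?F (t k) - ?F (t (k - 1)) \<le> \<pi>A * step t k * A j (j - k)"
        using kernel_lower_bound[OF j k] by simp
      show "0 \<le> ?V (t k) - ?V (t (k - 1))"
        using omega_mono[of "1 + \<beta>" "t (k - 1)" "t k"] beta tk step by (auto simp: step_def)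
    qed
    finally have "integral {t (k - 1)..t k} ?g * step t k
        \<le> (\<pi>A * (A j (j - k) * (?V (t k) - ?V (t (k - 1))))) * step t k"
      by (simp add: step_def mult_ac)
    then show "integral {t (k - 1)..t k} ?g \<le> \<pi>A * (A j (j - k) * (?V (t k) - ?V (t (k - 1))))"
      using step by simp
  qed
  finally show ?thesis by (simp add: sum_distrib_left)
qed

text \<open>For \<open>\<beta> \<ge> 1\<close> both factors of the convolution increase and Chebyshev's inequality points the wrong
  way; instead \<open>omega \<beta>\<close> is bounded by its value at the right end of each subinterval.\<close>

lemma omega_le_discrete_caputo_increasing:
  assumes j: "j \<in> {1..N}" and beta: "1 \<le> \<beta>"
  shows "omega (1 - \<alpha> + \<beta>) (t j) \<le> \<pi>A * (\<Sum>k\<in>{1..j}. A j (j - k) * (step t k * omega \<beta> (t k)))"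
proof -
  let ?g = "\<lambda>s. omega (1 - \<alpha>) (t j - s) * omega \<beta> s"
  have int: "(?g has_integral omega (1 - \<alpha> + \<beta>) (t j)) {t 0..t j}"
    using omega_convolution[of "1 - \<alpha>" \<beta> "t j"] alpha beta t_pos[OF j] by simp
  have mono: "t (k - 1) \<le> t k" if "k \<in> {1..j}" for k using t_mono that j by auto
  note split = integral_mesh_sum[of j t ?g, OF mono has_integral_integrable[OF int]]
  have "omega (1 - \<alpha> + \<beta>) (t j) = (\<Sum>k\<in>{1..j}. integral {t (k - 1)..t k} ?g)"
    using split(1) integral_unique[OF int] by simp
  also have "\<dots> \<le> (\<Sum>k\<in>{1..j}. \<pi>A * (A j (j - k) * (step t k * omega \<beta> (t k))))"
  proof (rule sum_mono)
    fix k assume k: "k \<in> {1..j}"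
    then have kN: "k \<in> {1..N}" using j by auto
    have tk: "0 \<le> t (k - 1)" "t k \<le> t j" using t_nonneg[of "k - 1"] t_mono[of k j] k j by auto
    have "integral {t (k - 1)..t k} ?g
        \<le> (omega (2 - \<alpha>) (t j - t (k - 1)) - omega (2 - \<alpha>) (t j - t k)) * omega \<beta> (t k)"
    proof (rule has_integral_le)
      show "(?g has_integral integral {t (k - 1)..t k} ?g) {t (k - 1)..t k}"
        using split(2)[OF _ k] by (simp add: integrable_integral)
      show "((\<lambda>s. omega (1 - \<alpha>) (t j - s) * omega \<beta> (t k)) has_integral
          (omega (2 - \<alpha>) (t j - t (k - 1)) - omega (2 - \<alpha>) (t j - t k)) * omega \<beta> (t k)) {t (k - 1)..t k}"
        by (intro has_integral_mult_left has_integral_reflected_omega) (use alpha mono[OF k] tk in auto)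
      show "?g s \<le> omega (1 - \<alpha>) (t j - s) * omega \<beta> (t k)" if "s \<in> {t (k - 1)..t k}" for s
        using that tk alpha beta by (intro mult_left_mono omega_mono omega_nonneg) auto
    qed
    also have "\<dots> \<le> (\<pi>A * step t k * A j (j - k)) * omega \<beta> (t k)"
      by (rule mult_right_mono[OF kernel_lower_bound[OF j k] omega_nonneg]) (use beta in auto)
    finally show "integral {t (k - 1)..t k} ?g \<le> \<pi>A * (A j (j - k) * (step t k * omega \<beta> (t k)))"
      by (simp add: mult_ac)
  qed
  finally show ?thesis by (simp add: sum_distrib_left)
qed

lemma cweight_omega_sum:
  assumes n: "n \<in> {1..N}" and beta: "0 < \<beta>" "\<beta> \<le> 1"
  shows "(\<Sum>j\<in>{1..n}. cweight A n j * omega (1 - \<alpha> + \<beta>) (t j)) \<le> \<pi>A * omega (1 + \<beta>) (t n)"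
proof -
  let ?x = "\<lambda>k. omega (1 + \<beta>) (t k) - omega (1 + \<beta>) (t (k - 1))"
  have "(\<Sum>j\<in>{1..n}. cweight A n j * omega (1 - \<alpha> + \<beta>) (t j))
      \<le> (\<Sum>j\<in>{1..n}. cweight A n j * (\<pi>A * (\<Sum>k\<in>{1..j}. A j (j - k) * ?x k)))"
    using n by (intro sum_mono mult_left_mono omega_le_discrete_caputo cweight_nonneg[OF A1 n] beta) auto
  also have "\<dots> = \<pi>A * (\<Sum>j\<in>{1..n}. cweight A n j * (\<Sum>k\<in>{1..j}. A j (j - k) * ?x k))"
    by (simp add: sum_distrib_left mult_ac)
  also have "\<dots> = \<pi>A * (\<Sum>k\<in>{1..n}. ?x k)" using cweight_invert[OF A1 n] by simp
  also have "(\<Sum>k\<in>{1..n}. ?x k) = omega (1 + \<beta>) (t n)"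
    using sum_telescope''[of 0 n "\<lambda>k. omega (1 + \<beta>) (t k)"] by simp
  finally show ?thesis .
qed

text \<open>The upper Riemann sum of \<open>omega \<beta>\<close> in \<open>omega_le_discrete_caputo_increasing\<close> is turned into a lower one by
  \<open>step t k \<le> \<rho> * step t (k + 1)\<close>. This uses one more step, which is why the level \<open>n\<close> is left out on
  the left.\<close>

lemma cweight_omega_sum_increasing:
  assumes n: "n \<in> {1..N}" and beta: "1 \<le> \<beta>"
  shows "(\<Sum>j\<in>{1..n - 1}. cweight A n j * omega (1 - \<alpha> + \<beta>) (t j)) \<le> \<pi>A * \<rho> * omega (1 + \<beta>) (t n)"
proof -
  let ?x = "\<lambda>k. step t k * omega \<beta> (t k)"
  have "(\<Sum>j\<in>{1..n - 1}. cweight A n j * omega (1 - \<alpha> + \<beta>) (t j))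
      \<le> (\<Sum>j\<in>{1..n - 1}. cweight A n j * (\<pi>A * (\<Sum>k\<in>{1..j}. A j (j - k) * ?x k)))"
    using n by (intro sum_mono mult_left_mono omega_le_discrete_caputo_increasing cweight_nonneg[OF A1 n] beta) auto
  also have "\<dots> = \<pi>A * (\<Sum>j\<in>{1..n - 1}. cweight A n j * (\<Sum>k\<in>{1..j}. A j (j - k) * ?x k))"
    by (simp add: sum_distrib_left mult_ac)
  also have "\<dots> \<le> \<pi>A * (\<Sum>k\<in>{1..n - 1}. ?x k)"
  proof (intro mult_left_mono cweight_invert_partial[OF A1 n])
    show "0 \<le> ?x k" if "k \<in> {1..n}" for k
      using step_pos[of k] omega_nonneg[of \<beta> "t k"] that n beta by auto
  qed (use piA in auto)
  also have "(\<Sum>k\<in>{1..n - 1}. ?x k) \<le> (\<Sum>k\<in>{1..n - 1}. \<rho> * (omega (1 + \<beta>) (t (Suc k)) - omega (1 + \<beta>) (t k)))"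
  proof (rule sum_mono)
    fix k assume k: "k \<in> {1..n - 1}"
    have "step t k / step t (Suc k) \<le> \<rho>" using rho(2) k n by (auto simp: mesh_A3_def)
    then have ratio: "step t k \<le> \<rho> * step t (Suc k)"
      using step_pos[of "Suc k"] k n by (auto simp: divide_le_eq)
    have lt: "t k < t (Suc k)" using step_pos[of "Suc k"] k n by (auto simp: step_def)
    have tk: "0 < t k" using t_pos k n by auto
    obtain z where z: "t k < z" "z < t (Suc k)"
      and eq: "omega (1 + \<beta>) (t (Suc k)) - omega (1 + \<beta>) (t k) = (t (Suc k) - t k) * omega \<beta> z"
      using MVT2[OF lt, of "omega (1 + \<beta>)" "omega \<beta>"] omega_has_derivative[of \<beta>] beta tk by auto
    have "?x k \<le> \<rho> * step t (Suc k) * omega \<beta> (t k)"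
      using ratio omega_nonneg beta by (intro mult_right_mono) auto
    also have "\<dots> \<le> \<rho> * step t (Suc k) * omega \<beta> z"
      using omega_mono[of \<beta> "t k" z] beta z tk rho lt by (intro mult_left_mono) (auto simp: step_def)
    finally show "?x k \<le> \<rho> * (omega (1 + \<beta>) (t (Suc k)) - omega (1 + \<beta>) (t k))"
      unfolding eq by (simp add: step_def mult.assoc)
  qed
  also have "\<dots> = \<rho> * (omega (1 + \<beta>) (t n) - omega (1 + \<beta>) (t 1))"
    using n sum_Suc_diff[of 1 "n - 1" "\<lambda>k. omega (1 + \<beta>) (t k)"] by (simp add: sum_distrib_left[symmetric])
  also have "\<dots> \<le> \<rho> * omega (1 + \<beta>) (t n)"
    using rho omega_nonneg[of "1 + \<beta>"] beta by simp
  finally show ?thesis using piA by (simp add: mult_ac)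
qed

lemma cweight_omega_partial_sum:
  assumes n: "n \<in> {1..N}" and beta: "0 < \<beta>"
  shows "(\<Sum>j\<in>{1..n - 1}. cweight A n j * omega (1 - \<alpha> + \<beta>) (t j)) \<le> \<pi>A * max 1 \<rho> * omega (1 + \<beta>) (t n)"
proof (cases "\<beta> \<le> 1")
  case True
  have "(\<Sum>j\<in>{1..n - 1}. cweight A n j * omega (1 - \<alpha> + \<beta>) (t j))
      \<le> (\<Sum>j\<in>{1..n}. cweight A n j * omega (1 - \<alpha> + \<beta>) (t j))"
    using cweight_nonneg[OF A1 n] omega_nonneg[of "1 - \<alpha> + \<beta>"] alpha beta by (intro sum_mono2) auto
  also have "\<dots> \<le> \<pi>A * 1 * omega (1 + \<beta>) (t n)" using cweight_omega_sum[OF n beta True] by simp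
  also have "\<dots> \<le> \<pi>A * max 1 \<rho> * omega (1 + \<beta>) (t n)"
    using piA omega_nonneg[of "1 + \<beta>"] beta by (intro mult_right_mono mult_left_mono) auto
  finally show ?thesis .
next
  case False
  then have "(\<Sum>j\<in>{1..n - 1}. cweight A n j * omega (1 - \<alpha> + \<beta>) (t j)) \<le> \<pi>A * \<rho> * omega (1 + \<beta>) (t n)"
    by (intro cweight_omega_sum_increasing[OF n]) auto
  also have "\<dots> \<le> \<pi>A * max 1 \<rho> * omega (1 + \<beta>) (t n)"
    using piA omega_nonneg[of "1 + \<beta>"] beta by (intro mult_right_mono mult_left_mono) auto
  finally show ?thesis .
qed

end

section \<open>The discrete Gronwall inequality\<close>

text \<open>Log-convexity of the Gamma function at \<open>x + 1\<close>, between \<open>x + \<alpha>\<close> and \<open>x + \<alpha> + 1\<close>, together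
  with \<open>x + \<alpha> \<le> 2 * x\<close>. It drives the ratio test for the Mittag-Leffler series.\<close>

lemma Gamma_ratio_lower_bound:
  fixes \<alpha> x :: real
  assumes "0 < \<alpha>" "\<alpha> < 1" "1 \<le> x"
  shows "x powr \<alpha> * Gamma x \<le> 2 * Gamma (x + \<alpha>)"
proof -
  have "(ln \<circ> Gamma) ((1 - (1 - \<alpha>)) *\<^sub>R (x + \<alpha>) + (1 - \<alpha>) *\<^sub>R (x + \<alpha> + 1))
      \<le> (1 - (1 - \<alpha>)) * (ln \<circ> Gamma) (x + \<alpha>) + (1 - \<alpha>) * (ln \<circ> Gamma) (x + \<alpha> + 1)"
    by (rule convex_onD[OF log_convex_Gamma_real]) (use assms in auto)
  moreover have "(1 - (1 - \<alpha>)) *\<^sub>R (x + \<alpha>) + (1 - \<alpha>) *\<^sub>R (x + \<alpha> + 1) = 1 + x"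
    by (simp add: algebra_simps)
  moreover have "x + \<alpha> + 1 = 1 + (x + \<alpha>)" by simp
  ultimately have "ln (Gamma (1 + x)) \<le> \<alpha> * ln (Gamma (x + \<alpha>)) + (1 - \<alpha>) * ln (Gamma (1 + (x + \<alpha>)))"
    by (simp only: o_def) simp
  moreover have "ln (Gamma (1 + x)) = ln x + ln (Gamma x)"
    using assms Gamma_real_pos[of x] by (simp add: Gamma_1_plus ln_mult)
  moreover have "ln (Gamma (1 + (x + \<alpha>))) = ln (x + \<alpha>) + ln (Gamma (x + \<alpha>))"
    using assms Gamma_real_pos[of "x + \<alpha>"] Gamma_1_plus[of "x + \<alpha>"] by (simp add: ln_mult)
  ultimately have 1: "ln x + ln (Gamma x) \<le> ln (Gamma (x + \<alpha>)) + (1 - \<alpha>) * ln (x + \<alpha>)"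
    by (simp add: algebra_simps)
  have "ln (x + \<alpha>) \<le> ln (2 * x)" using assms by (subst ln_le_cancel_iff) auto
  then have "ln (x + \<alpha>) \<le> ln 2 + ln x" using assms by (simp add: ln_mult)
  then have "(1 - \<alpha>) * ln (x + \<alpha>) \<le> (1 - \<alpha>) * (ln 2 + ln x)" using assms by (intro mult_left_mono) auto
  also have "\<dots> \<le> ln 2 + (1 - \<alpha>) * ln x" using assms by (simp add: algebra_simps)
  finally have "\<alpha> * ln x + ln (Gamma x) \<le> ln 2 + ln (Gamma (x + \<alpha>))"
    using 1 by (simp add: algebra_simps)
  then have "exp (\<alpha> * ln x + ln (Gamma x)) \<le> exp (ln 2 + ln (Gamma (x + \<alpha>)))" by simp
  then show ?thesis
    using assms Gamma_real_pos[of x] Gamma_real_pos[of "x + \<alpha>"] by (simp add: exp_add powr_def)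
qed

lemma summable_mittag_leffler:
  fixes \<alpha> z :: real
  assumes "0 < \<alpha>" "\<alpha> < 1"
  shows "summable (\<lambda>j. z ^ j / Gamma (real j * \<alpha> + 1))"
proof -
  obtain J :: nat where J: "(4 * \<bar>z\<bar>) powr (1 / \<alpha>) \<le> real J * \<alpha>"
    using ex_less_of_nat_mult[OF assms(1)] by (meson less_imp_le)
  show ?thesis
  proof (rule summable_ratio_test[of "1/2" J])
    fix j assume j: "J \<le> j"
    define x where "x = real j * \<alpha> + 1"
    have x: "1 \<le> x" using assms by (simp add: x_def)
    have Gpos: "0 < Gamma x" "0 < Gamma (x + \<alpha>)" using x assms by (auto intro: Gamma_real_pos)
    have "real J * \<alpha> \<le> real j * \<alpha>" using j assms by (intro mult_right_mono) auto
    then have "(4 * \<bar>z\<bar>) powr (1 / \<alpha>) \<le> x" using J by (simp add: x_def)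
    then have "((4 * \<bar>z\<bar>) powr (1 / \<alpha>)) powr \<alpha> \<le> x powr \<alpha>" using assms by (intro powr_mono2) auto
    then have "4 * \<bar>z\<bar> \<le> x powr \<alpha>" using assms by (simp add: powr_powr)
    then have "4 * \<bar>z\<bar> * Gamma x \<le> x powr \<alpha> * Gamma x" using Gpos by (intro mult_right_mono) auto
    also have "\<dots> \<le> 2 * Gamma (x + \<alpha>)" by (rule Gamma_ratio_lower_bound[OF assms x])
    finally have *: "\<bar>z\<bar> / Gamma (x + \<alpha>) \<le> 1 / 2 / Gamma x" using Gpos by (simp add: field_simps)
    have "real (Suc j) * \<alpha> + 1 = x + \<alpha>" by (simp add: x_def algebra_simps)
    then have "norm (z ^ Suc j / Gamma (real (Suc j) * \<alpha> + 1)) = \<bar>z\<bar> ^ j * (\<bar>z\<bar> / Gamma (x + \<alpha>))"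
      using Gpos by (simp add: abs_mult power_abs)
    also have "\<dots> \<le> \<bar>z\<bar> ^ j * (1 / 2 / Gamma x)" using * by (intro mult_left_mono) auto
    also have "\<dots> = 1 / 2 * norm (z ^ j / Gamma (real j * \<alpha> + 1))"
      using Gpos by (simp add: x_def[symmetric] power_abs)
    finally show "norm (z ^ Suc j / Gamma (real (Suc j) * \<alpha> + 1)) \<le> 1 / 2 * norm (z ^ j / Gamma (real j * \<alpha> + 1))" .
  qed simp
qed

lemma mittag_leffler_mono:
  assumes "0 < \<alpha>" "\<alpha> < 1" "0 \<le> y" "y \<le> z"
  shows "mittag_leffler \<alpha> y \<le> mittag_leffler \<alpha> z"
  unfolding mittag_leffler_def
proof (rule suminf_le)
  fix j
  have "0 < Gamma (real j * \<alpha> + 1)" using assms by (intro Gamma_real_pos) (simp add: add_nonneg_pos)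
  then show "y ^ j / Gamma (real j * \<alpha> + 1) \<le> z ^ j / Gamma (real j * \<alpha> + 1)"
    using assms by (intro divide_right_mono power_mono) auto
qed (use assms summable_mittag_leffler in auto)

lemma mittag_leffler_0: "mittag_leffler \<alpha> 0 = 1"
proof -
  have "(\<lambda>j. 0 ^ j / Gamma (real j * \<alpha> + 1)) sums (0 ^ 0 / Gamma (real 0 * \<alpha> + 1))"
    by (rule sums_single[of 0 "\<lambda>j. 0 ^ j / Gamma (real j * \<alpha> + 1)", THEN iffD1[OF sums_cong, rotated]]) auto
  then show ?thesis by (simp add: mittag_leffler_def sums_iff)
qed

lemma mittag_leffler_ge_1:
  assumes "0 < \<alpha>" "\<alpha> < 1" "0 \<le> z"
  shows "1 \<le> mittag_leffler \<alpha> z"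
  using mittag_leffler_mono[of \<alpha> 0 z] assms by (simp add: mittag_leffler_0)

context nonuniform_caputo
begin

lemma mittag_leffler_omega_series:
  assumes "0 < s"
  shows "(\<lambda>m. \<mu> ^ m * omega (1 + real m * \<alpha>) s) sums mittag_leffler \<alpha> (\<mu> * s powr \<alpha>)"
proof -
  have "(\<mu> * s powr \<alpha>) ^ m / Gamma (real m * \<alpha> + 1) = \<mu> ^ m * omega (1 + real m * \<alpha>) s" for m
    using assms by (simp add: omega_def power_mult_distrib powr_realpow[symmetric] powr_powr mult.commute add.commute)
  then show ?thesis
    using summable_sums[OF summable_mittag_leffler[OF alpha, of "\<mu> * s powr \<alpha>"]]
    by (simp add: mittag_leffler_def)
qed

text \<open>The function \<open>v s = mittag_leffler \<alpha> (\<mu> * s powr \<alpha>)\<close> has Caputo derivative \<open>\<mu> * v\<close>; discretely an inequality survives. Termwise, the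
  weights raise \<open>omega (1 + m * \<alpha>)\<close> to \<open>omega (1 + (m + 1) * \<alpha>)\<close>, which shifts the series by one
  place.\<close>

lemma cweight_mittag_leffler_sum:
  assumes n: "n \<in> {1..N}" and mu: "0 \<le> \<mu>"
  shows "\<mu> * (\<Sum>j\<in>{1..n - 1}. cweight A n j * mittag_leffler \<alpha> (\<mu> * t j powr \<alpha>))
    \<le> \<pi>A * max 1 \<rho> * (mittag_leffler \<alpha> (\<mu> * t n powr \<alpha>) - 1)"
proof -
  let ?E = "\<lambda>j. mittag_leffler \<alpha> (\<mu> * t j powr \<alpha>)"
  let ?b = "\<lambda>m j. \<mu> ^ m * omega (1 + real m * \<alpha>) (t j)"
  have "(\<lambda>m. \<mu> * (\<Sum>j\<in>{1..n - 1}. cweight A n j * ?b m j)) sums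
      (\<mu> * (\<Sum>j\<in>{1..n - 1}. cweight A n j * ?E j))"
    using n by (intro sums_mult sums_sum mittag_leffler_omega_series t_pos) auto
  moreover have "(\<lambda>m. \<pi>A * max 1 \<rho> * ?b (Suc m) n) sums (\<pi>A * max 1 \<rho> * (?E n - 1))"
  proof (rule sums_mult)
    have "?b 0 n = 1" using t_pos[OF n] by (simp add: omega_def)
    then show "(\<lambda>m. ?b (Suc m) n) sums (?E n - 1)"
      using mittag_leffler_omega_series[OF t_pos[OF n], of \<mu>] by (subst sums_Suc_iff) simp
  qed
  ultimately show ?thesis
  proof (rule sums_le[rotated])
    fix m
    have eq: "1 - \<alpha> + real (Suc m) * \<alpha> = 1 + real m * \<alpha>" by (simp add: algebra_simps)
    have "\<mu> * (\<Sum>j\<in>{1..n - 1}. cweight A n j * ?b m j)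
        = \<mu> ^ Suc m * (\<Sum>j\<in>{1..n - 1}. cweight A n j * omega (1 - \<alpha> + real (Suc m) * \<alpha>) (t j))"
      unfolding eq by (simp add: sum_distrib_left mult_ac)
    also have "\<dots> \<le> \<mu> ^ Suc m * (\<pi>A * max 1 \<rho> * omega (1 + real (Suc m) * \<alpha>) (t n))"
      using mu alpha by (intro mult_left_mono cweight_omega_partial_sum[OF n]) auto
    finally show "\<mu> * (\<Sum>j\<in>{1..n - 1}. cweight A n j * ?b m j) \<le> \<pi>A * max 1 \<rho> * ?b (Suc m) n"
      by (simp only: mult_ac)
  qed
qed

lemma cweight_le:
  assumes n: "n \<in> {1..N}" and k: "k \<in> {1..n}"
  shows "cweight A n k \<le> \<pi>A * Gamma (2 - \<alpha>) * step t k powr \<alpha>"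
proof -
  have c: "0 \<le> \<pi>A * Gamma (2 - \<alpha>) * step t k powr \<alpha>"
    using piA Gamma_real_pos[of "2 - \<alpha>"] alpha by simp
  have "cweight A n k * 1 \<le> cweight A n k * (\<pi>A * Gamma (2 - \<alpha>) * step t k powr \<alpha> * A k 0)"
    using n k by (intro mult_left_mono kernel_diag_lower_bound cweight_nonneg[OF A1 n]) auto
  also have "\<dots> = \<pi>A * Gamma (2 - \<alpha>) * step t k powr \<alpha> * (cweight A n k * A k 0)" by simp
  also have "\<dots> \<le> \<pi>A * Gamma (2 - \<alpha>) * step t k powr \<alpha> * 1"
    by (intro mult_left_mono cweight_diag[OF A1 n k] c)
  finally show ?thesis by simp
qed

text \<open>Induction over the time level. If some earlier value dominates \<open>v n\<close>, monotonicity of the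
  Mittag-Leffler factor suffices. Otherwise \<open>v n\<close> dominates all earlier values and hence all \<open>w j\<close>,
  so the summed energy inequality can be divided by \<open>v n\<close> and becomes linear. The step restriction lets
  half of \<open>v n\<close> absorb the term with \<open>w n\<close>, and \<open>cweight_mittag_leffler_sum\<close> sums the induction
  hypotheses.\<close>

lemma discrete_gronwall:
  fixes v w g :: "nat \<Rightarrow> real"
  assumes v: "\<And>k. 0 \<le> v k" and g: "\<And>k. 0 \<le> g k" and w: "\<And>k. 0 \<le> w k"
    and wv: "\<And>k. k \<in> {1..N} \<Longrightarrow> w k \<le> max (v (k - 1)) (v k)"
    and \<kappa>: "0 \<le> \<kappa>"
    and energy: "\<And>k. k \<in> {1..N} \<Longrightarrow>
      discrete_caputo A (\<lambda>k. (v k)\<^sup>2) k \<le> 2 * \<kappa> * (w k)\<^sup>2 + 2 * w k * g k"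
    and small: "\<And>k. k \<in> {1..N} \<Longrightarrow> 4 * max 1 \<rho> * \<pi>A * Gamma (2 - \<alpha>) * \<kappa> * step t k powr \<alpha> \<le> 1"
    and H: "0 \<le> H" "\<And>k. k \<in> {1..m} \<Longrightarrow> (\<Sum>j\<in>{1..k}. cweight A k j * g j) \<le> H"
    and m: "m \<le> N"
  shows "v m \<le> 2 * mittag_leffler \<alpha> (4 * max 1 \<rho> * \<pi>A * \<kappa> * t m powr \<alpha>) * (v 0 + 2 * H)"
proof -
  define \<mu> where "\<mu> = 4 * max 1 \<rho> * \<pi>A * \<kappa>"
  define E where "E j = mittag_leffler \<alpha> (\<mu> * t j powr \<alpha>)" for j
  define B where "B = v 0 + 2 * H"
  have mu: "0 \<le> \<mu>" using piA \<kappa> by (simp add: \<mu>_def)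
  have B: "0 \<le> B" using v[of 0] H by (simp add: B_def)
  have E1: "1 \<le> E j" for j unfolding E_def using mu by (intro mittag_leffler_ge_1 alpha) simp
  have E_mono: "E i \<le> E j" if "i \<le> j" "j \<le> N" for i j
    unfolding E_def
  proof (intro mittag_leffler_mono alpha mult_left_mono powr_mono2)
    show "0 \<le> t i" using t_nonneg that by simp
    show "t i \<le> t j" using t_mono that by simp
  qed (use mu alpha in auto)
  have "v n \<le> 2 * E n * B" if "n \<le> m" for n
    using that
  proof (induction n rule: less_induct)
    case (less n)
    consider "n = 0" | k where "k < n" "v n \<le> v k" | "0 < n" "\<And>k. k < n \<Longrightarrow> v k < v n"
      by (metis not_le gr0I)
    then show ?case
    proof cases
      case 1
      have "v 0 \<le> 2 * 1 * B" using v[of 0] H by (simp add: B_def)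
      also have "\<dots> \<le> 2 * E 0 * B" by (intro mult_right_mono mult_left_mono E1 B) auto
      finally show ?thesis using 1 by simp
    next
      case 2
      have "v n \<le> v k" by fact
      also have "\<dots> \<le> 2 * E k * B" by (rule less.IH) (use 2 less.prems in auto)
      also have "\<dots> \<le> 2 * E n * B"
        using 2 less.prems m B by (intro mult_right_mono mult_left_mono E_mono) auto
      finally show ?thesis .
    next
      case 3
      have n: "n \<in> {1..N}" using 3 less.prems m by auto
      note P = cweight_nonneg[OF A1 n]
      have vn: "0 < v n" using 3(2)[of 0] 3(1) v[of 0] by linarith
      have v_le: "v k \<le> v n" if "k \<le> n" for k using 3(2)[of k] that by (cases "k = n") auto
      have w_le: "w j \<le> v n" if "j \<in> {1..n}" for j
      proof -
        have "v j \<le> v n" "v (j - 1) \<le> v n" using that by (auto intro!: v_le)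
        then show ?thesis using wv[of j] that n by auto
      qed
      have "(v n)\<^sup>2 - (v 0)\<^sup>2 = (\<Sum>k\<in>{1..n}. (v k)\<^sup>2 - (v (k - 1))\<^sup>2)"
        using sum_telescope''[of 0 n "\<lambda>k. (v k)\<^sup>2"] by simp
      also have "\<dots> = (\<Sum>j\<in>{1..n}. cweight A n j * discrete_caputo A (\<lambda>k. (v k)\<^sup>2) j)"
        unfolding discrete_caputo_def by (rule cweight_invert[OF A1 n, symmetric])
      also have "\<dots> \<le> (\<Sum>j\<in>{1..n}. cweight A n j * (v n * (2 * \<kappa> * w j + 2 * g j)))"
      proof (intro sum_mono mult_left_mono P)
        fix j assume j: "j \<in> {1..n}"
        have "discrete_caputo A (\<lambda>k. (v k)\<^sup>2) j \<le> w j * (2 * \<kappa> * w j + 2 * g j)"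
          using energy[of j] j n by (simp add: power2_eq_square algebra_simps)
        also have "\<dots> \<le> v n * (2 * \<kappa> * w j + 2 * g j)"
          using w_le[OF j] \<kappa> w g by (intro mult_right_mono) auto
        finally show "discrete_caputo A (\<lambda>k. (v k)\<^sup>2) j \<le> \<dots>" .
      qed
      also have "\<dots> = v n * (2 * \<kappa> * (\<Sum>j\<in>{1..n}. cweight A n j * w j) + 2 * (\<Sum>j\<in>{1..n}. cweight A n j * g j))"
        by (simp add: sum_distrib_left sum.distrib algebra_simps)
      finally have "(v n)\<^sup>2 \<le> (v 0)\<^sup>2 + v n * (2 * \<kappa> * (\<Sum>j\<in>{1..n}. cweight A n j * w j) + 2 * (\<Sum>j\<in>{1..n}. cweight A n j * g j))"
        by simp
      also have "(v 0)\<^sup>2 \<le> v n * v 0"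
        using v_le[of 0] v[of 0] by (simp add: power2_eq_square mult_right_mono)
      also have "v n * (2 * \<kappa> * (\<Sum>j\<in>{1..n}. cweight A n j * w j) + 2 * (\<Sum>j\<in>{1..n}. cweight A n j * g j))
          \<le> v n * (2 * \<kappa> * (\<Sum>j\<in>{1..n}. cweight A n j * w j) + 2 * H)"
        using H(2)[of n] 3(1) less.prems vn by (intro mult_left_mono) auto
      finally have "v n * v n \<le> v n * (B + 2 * \<kappa> * (\<Sum>j\<in>{1..n}. cweight A n j * w j))"
        by (simp add: B_def power2_eq_square algebra_simps)
      then have main: "v n \<le> B + 2 * \<kappa> * (\<Sum>j\<in>{1..n}. cweight A n j * w j)"
        using vn by simp
      have "(\<Sum>j\<in>{1..n}. cweight A n j * w j) = (\<Sum>j\<in>{1..n - 1}. cweight A n j * w j) + cweight A n n * w n"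
        using 3(1) by (cases n) auto
      moreover have "2 * \<kappa> * (cweight A n n * w n) \<le> v n / 2"
      proof -
        have G: "0 < Gamma (2 - \<alpha>)" using alpha by (intro Gamma_real_pos) auto
        have "4 * \<kappa> * cweight A n n \<le> 4 * \<kappa> * (\<pi>A * Gamma (2 - \<alpha>) * step t n powr \<alpha>)"
          using cweight_le[OF n, of n] n \<kappa> by (intro mult_left_mono) auto
        also have "\<dots> = 1 * (4 * \<pi>A * Gamma (2 - \<alpha>) * \<kappa> * step t n powr \<alpha>)" by simp
        also have "\<dots> \<le> max 1 \<rho> * (4 * \<pi>A * Gamma (2 - \<alpha>) * \<kappa> * step t n powr \<alpha>)"
          using piA G \<kappa> by (intro mult_right_mono) auto
        also have "\<dots> \<le> 1" using small[OF n] by (simp add: mult_ac)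
        finally have "4 * \<kappa> * cweight A n n \<le> 1" .
        moreover have "4 * \<kappa> * (cweight A n n * w n) \<le> (4 * \<kappa> * cweight A n n) * v n"
          using w_le[of n] n \<kappa> P[of n] by (simp add: mult_left_mono mult.assoc)
        moreover have "(4 * \<kappa> * cweight A n n) * v n \<le> 1 * v n"
          using \<open>4 * \<kappa> * cweight A n n \<le> 1\<close> vn by (intro mult_right_mono) auto
        ultimately show ?thesis by linarith
      qed
      moreover have "2 * \<kappa> * (\<Sum>j\<in>{1..n - 1}. cweight A n j * w j) \<le> (E n - 1) * B"
      proof -
        have "(\<Sum>j\<in>{1..n - 1}. cweight A n j * w j) \<le> (\<Sum>j\<in>{1..n - 1}. cweight A n j * (2 * E j * B))"
        proof (intro sum_mono mult_left_mono P)
          fix j assume j: "j \<in> {1..n - 1}"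
          have "v (j - 1) \<le> 2 * E (j - 1) * B" by (rule less.IH) (use j less.prems in auto)
          also have "\<dots> \<le> 2 * E j * B"
            using j n B by (intro mult_right_mono mult_left_mono E_mono) auto
          finally have "v (j - 1) \<le> 2 * E j * B" .
          moreover have "v j \<le> 2 * E j * B" by (rule less.IH) (use j less.prems in auto)
          moreover have "j \<in> {1..N}" using j n by auto
          ultimately show "w j \<le> 2 * E j * B" using wv[of j] by simp
        qed auto
        then have "2 * \<kappa> * (\<Sum>j\<in>{1..n - 1}. cweight A n j * w j) \<le> 2 * \<kappa> * (\<Sum>j\<in>{1..n - 1}. cweight A n j * (2 * E j * B))"
          using \<kappa> by (intro mult_left_mono) auto
        also have "\<dots> = (4 * \<kappa> * (\<Sum>j\<in>{1..n - 1}. cweight A n j * E j)) * B"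
          by (simp add: sum_distrib_left sum_distrib_right mult_ac)
        also have "\<dots> \<le> (E n - 1) * B"
        proof (rule mult_right_mono[OF _ B])
          have "(\<pi>A * max 1 \<rho>) * (4 * \<kappa> * (\<Sum>j\<in>{1..n - 1}. cweight A n j * E j)) \<le> (\<pi>A * max 1 \<rho>) * (E n - 1)"
            using cweight_mittag_leffler_sum[OF n mu] unfolding E_def by (simp add: \<mu>_def mult_ac)
          moreover have "0 < \<pi>A * max 1 \<rho>" using piA by simp
          ultimately show "4 * \<kappa> * (\<Sum>j\<in>{1..n - 1}. cweight A n j * E j) \<le> E n - 1"
            by (metis mult_le_cancel_left_pos)
        qed
        finally show ?thesis .
      qed
      ultimately have "v n \<le> B + v n / 2 + (E n - 1) * B" using main by (simp add: distrib_left)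
      then show ?thesis by (simp add: algebra_simps)
    qed
  qed
  then show ?thesis by (simp add: E_def B_def \<mu>_def mult_ac)
qed

section \<open>Weighted sums of the consistency error\<close>

text \<open>The case \<open>\<beta> = \<alpha>\<close> of \<open>cweight_omega_sum\<close>, where \<open>omega 1\<close> is constant.\<close>

lemma cweight_total:
  assumes n: "n \<in> {1..N}"
  shows "(\<Sum>j\<in>{1..n}. cweight A n j) \<le> \<pi>A * t n powr \<alpha> / Gamma (1 + \<alpha>)"
proof -
  have "(\<Sum>j\<in>{1..n}. cweight A n j) = (\<Sum>j\<in>{1..n}. cweight A n j * omega (1 - \<alpha> + \<alpha>) (t j))"
  proof (rule sum.cong[OF refl])
    fix j assume "j \<in> {1..n}"
    then have "0 < t j" using t_pos[of j] n by auto
    then show "cweight A n j = cweight A n j * omega (1 - \<alpha> + \<alpha>) (t j)" by (simp add: omega_def)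
  qed
  also have "\<dots> \<le> \<pi>A * omega (1 + \<alpha>) (t n)" by (rule cweight_omega_sum[OF n]) (use alpha in auto)
  finally show ?thesis by (simp add: omega_def)
qed

text \<open>Up to the factor \<open>\<pi>A\<close>, the discrete derivative of the identity dominates the exact one: the case
  \<open>\<beta> = 1\<close> of \<open>omega_le_discrete_caputo\<close>.\<close>

lemma kernel_step_sum:
  assumes k: "k \<in> {1..N}"
  shows "t k powr (1 - \<alpha>) \<le> \<pi>A * Gamma (2 - \<alpha>) * (\<Sum>i\<in>{1..k}. A k (k - i) * step t i)"
proof -
  have "omega 2 (t i) = t i" if "i \<le> N" for i
    using t_nonneg[OF that] Gamma_fact[of 1, where ?'a = real] by (simp add: omega_def)
  then have "(\<Sum>i\<in>{1..k}. A k (k - i) * (omega 2 (t i) - omega 2 (t (i - 1)))) = (\<Sum>i\<in>{1..k}. A k (k - i) * step t i)"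
    using k by (intro sum.cong) (auto simp: step_def)
  then have "omega (2 - \<alpha>) (t k) \<le> \<pi>A * (\<Sum>i\<in>{1..k}. A k (k - i) * step t i)"
    using omega_le_discrete_caputo[OF k, of 1] by simp
  then show ?thesis
    using Gamma_real_pos[of "2 - \<alpha>"] alpha by (simp add: omega_def field_simps)
qed

text \<open>Let \<open>m\<close> be the decreasing maximum from \<open>Xi\<close>. Then \<open>G k \<le> t k powr (1 - \<alpha>) * m k\<close> for
  \<open>k \<ge> 2\<close>, and \<open>kernel_step_sum\<close> with the monotonicity of \<open>m\<close> bounds this by the discrete derivative of the grid
  function with increments \<open>step t i * m i\<close>, which the weights invert. The value \<open>m 1 = m 2\<close> is a choice:
  it keeps \<open>G 1\<close> out of the maximum, and the resulting term \<open>step t 1 * m 2\<close> is at most \<open>\<rho>\<close> times the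
  next one. The first level is estimated by the size of its weight.\<close>

lemma cweight_sum_le_Xi:
  assumes n: "n \<in> {1..N}" and G: "\<And>k. k \<in> {1..n} \<Longrightarrow> 0 \<le> G k"
  shows "(\<Sum>k\<in>{1..n}. cweight A n k * G k) \<le> (\<rho> + 1) * Xi t \<alpha> \<pi>A G n"
proof -
  note P = cweight_nonneg[OF A1 n]
  define c where "c = Gamma (2 - \<alpha>) * \<pi>A"
  have c: "0 < c" using Gamma_real_pos[of "2 - \<alpha>"] alpha piA by (simp add: c_def)
  define m where "m j = max_over {max j 2..n} (\<lambda>k. t k powr (\<alpha> - 1) * G k)" for j
  have m_def': "m j = Max ((\<lambda>k. t k powr (\<alpha> - 1) * G k) ` {max j 2..n})" if "2 \<le> n" "j \<le> n" for j
    using that by (auto simp: m_def max_over_def)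
  have m_ge: "t k powr (\<alpha> - 1) * G k \<le> m k" if "k \<in> {2..n}" for k
    using that by (subst m_def') (auto intro!: Max_ge)
  have m_antimono: "m k \<le> m i" if "2 \<le> n" "i \<le> k" "k \<le> n" for i k
    using that by (subst (1 2) m_def') (auto intro!: Max_mono)
  have m_nonneg: "0 \<le> m j" if "j \<le> n" for j
  proof (cases "2 \<le> n")
    case True
    have "0 \<le> t n powr (\<alpha> - 1) * G n" using G n by auto
    also have "\<dots> \<le> m n" using m_ge True by auto
    also have "\<dots> \<le> m j" using m_antimono True that by auto
    finally show ?thesis .
  qed (auto simp: m_def max_over_def)
  have head: "cweight A n 1 * G 1 \<le> c * (step t 1 powr \<alpha> * G 1)"
    using mult_right_mono[OF cweight_le[OF n, of 1] G[of 1]] n by (simp add: c_def mult_ac)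
  have tail: "(\<Sum>k\<in>{2..n}. cweight A n k * G k) \<le> (\<rho> + 1) * (c * (\<Sum>j\<in>{2..n}. step t j * m j))"
  proof (cases "2 \<le> n")
    case True
    have "(\<Sum>k\<in>{2..n}. cweight A n k * G k)
        \<le> (\<Sum>k\<in>{2..n}. cweight A n k * (c * (\<Sum>i\<in>{1..k}. A k (k - i) * (step t i * m i))))"
    proof (intro sum_mono mult_left_mono P)
      fix k assume k: "k \<in> {2..n}"
      then have kN: "k \<in> {1..N}" using n by auto
      have "G k = t k powr (1 - \<alpha>) * (t k powr (\<alpha> - 1) * G k)"
        using t_pos[OF kN] by (simp add: mult.assoc[symmetric] powr_add[symmetric])
      also have "\<dots> \<le> t k powr (1 - \<alpha>) * m k" using m_ge[OF k] by (intro mult_left_mono) auto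
      also have "\<dots> \<le> (c * (\<Sum>i\<in>{1..k}. A k (k - i) * step t i)) * m k"
        using kernel_step_sum[OF kN] m_nonneg[of k] k by (intro mult_right_mono) (auto simp: c_def mult_ac)
      also have "\<dots> = c * (\<Sum>i\<in>{1..k}. A k (k - i) * (step t i * m k))"
        by (simp add: sum_distrib_left sum_distrib_right mult_ac)
      also have "\<dots> \<le> c * (\<Sum>i\<in>{1..k}. A k (k - i) * (step t i * m i))"
      proof (intro mult_left_mono sum_mono)
        fix i assume i: "i \<in> {1..k}"
        show "m k \<le> m i" using m_antimono True i k by auto
        show "0 \<le> step t i" using step_pos[of i] i kN by auto
        show "0 \<le> A k (k - i)" using kernels_A1_pos[OF A1 kN, of "k - i"] i by auto
      qed (use c in auto)
      finally show "G k \<le> \<dots>" .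
    qed auto
    also have "\<dots> \<le> (\<Sum>k\<in>{1..n}. cweight A n k * (c * (\<Sum>i\<in>{1..k}. A k (k - i) * (step t i * m i))))"
    proof (rule sum_mono2)
      fix k assume "k \<in> {1..n} - {2..n}"
      then have k: "k = 1" "k \<in> {1..n}" by auto
      have "0 \<le> A 1 0 * (step t 1 * m 1)"
        using kernels_A1_pos[OF A1, of 1 0] step_pos[of 1] m_nonneg[of 1] n by (simp add: less_imp_le)
      then show "0 \<le> cweight A n k * (c * (\<Sum>i\<in>{1..k}. A k (k - i) * (step t i * m i)))"
        using P[OF k(2)] c k(1) by simp
    qed auto
    also have "\<dots> = c * (\<Sum>k\<in>{1..n}. cweight A n k * (\<Sum>i\<in>{1..k}. A k (k - i) * (step t i * m i)))"
      by (simp add: sum_distrib_left mult_ac)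
    also have "\<dots> = c * (\<Sum>i\<in>{1..n}. step t i * m i)" using cweight_invert[OF A1 n] by simp
    also have "(\<Sum>i\<in>{1..n}. step t i * m i) = step t 1 * m 2 + (\<Sum>i\<in>{2..n}. step t i * m i)"
      using True by (simp add: sum.atLeast_Suc_atMost m_def numeral_2_eq_2)
    also have "step t 1 * m 2 \<le> \<rho> * (\<Sum>i\<in>{2..n}. step t i * m i)"
    proof -
      have "step t 1 / step t 2 \<le> \<rho>" using rho(2) True n by (force simp: mesh_A3_def numeral_2_eq_2)
      then have "step t 1 \<le> \<rho> * step t 2" using step_pos[of 2] True n by (simp add: divide_le_eq)
      then have "step t 1 * m 2 \<le> \<rho> * (step t 2 * m 2)"
        using m_nonneg[of 2] True mult_right_mono[of "step t 1" "\<rho> * step t 2" "m 2"] by (simp add: mult.assoc)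
      also have "step t 2 * m 2 \<le> (\<Sum>i\<in>{2..n}. step t i * m i)"
      proof (rule member_le_sum)
        show "0 \<le> step t i * m i" if "i \<in> {2..n} - {2}" for i
          using step_pos[of i] m_nonneg[of i] that n by auto
      qed (use True in auto)
      finally show ?thesis using rho by simp
    qed
    finally show ?thesis using c by (simp add: algebra_simps)
  qed (use c in auto)
  have "(\<Sum>k\<in>{1..n}. cweight A n k * G k) = cweight A n 1 * G 1 + (\<Sum>k\<in>{2..n}. cweight A n k * G k)"
    using n by (simp add: sum.atLeast_Suc_atMost numeral_2_eq_2)
  also have "\<dots> \<le> (\<rho> + 1) * (c * (step t 1 powr \<alpha> * G 1)) + (\<rho> + 1) * (c * (\<Sum>j\<in>{2..n}. step t j * m j))"
  proof (rule add_mono[OF order_trans[OF head] tail])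
    have "0 \<le> c * (step t 1 powr \<alpha> * G 1)" using c G[of 1] n by auto
    then show "c * (step t 1 powr \<alpha> * G 1) \<le> (\<rho> + 1) * (c * (step t 1 powr \<alpha> * G 1))"
      using rho by (simp add: algebra_simps)
  qed
  also have "(\<Sum>j\<in>{2..n}. step t j * m j) = (\<Sum>j\<in>{2..n}. step t j * max_over {j..n} (\<lambda>k. t k powr (\<alpha> - 1) * G k))"
    by (rule sum.cong) (auto simp: m_def max_def)
  finally show ?thesis by (simp add: Xi_def c_def algebra_simps)
qed

lemma cweight_consistency_sum:
  assumes n: "n \<in> {1..N}"
    and G: "\<And>k. k \<in> {1..n} \<Longrightarrow> 0 \<le> Gloc k" "\<And>k. k \<in> {1..n} \<Longrightarrow> 0 \<le> Ghis k"
    and r: "\<And>k. k \<in> {1..n} \<Longrightarrow> r k \<le> A k 0 * Gloc k + (\<Sum>j\<in>{1..<k}. (A k (k - j - 1) - A k (k - j)) * Ghis j)"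
  shows "(\<Sum>k\<in>{1..n}. cweight A n k * r k) \<le> (\<rho> + 1) * Xi t \<alpha> \<pi>A (cal_G A Gloc Ghis) n"
proof -
  note P = cweight_nonneg[OF A1 n]
  have A0: "0 < A k 0" if "k \<in> {1..n}" for k using kernels_A1_pos[OF A1, of k 0] that n by auto
  have "(\<Sum>k\<in>{1..n}. cweight A n k * r k)
      \<le> (\<Sum>k\<in>{1..n}. cweight A n k * (A k 0 * Gloc k + (\<Sum>j\<in>{1..<k}. (A k (k - j - 1) - A k (k - j)) * Ghis j)))"
    by (intro sum_mono mult_left_mono P r)
  also have "\<dots> = (\<Sum>k\<in>{1..n}. cweight A n k * A k 0 * Gloc k) + (\<Sum>j\<in>{1..<n}. cweight A n j * A j 0 * Ghis j)"
    unfolding cweight_history[OF A1 n, symmetric] by (simp only: distrib_left sum.distrib mult.assoc)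
  also have "(\<Sum>j\<in>{1..<n}. cweight A n j * A j 0 * Ghis j) \<le> (\<Sum>j\<in>{1..n}. cweight A n j * A j 0 * Ghis j)"
    using P A0 G by (intro sum_mono2) (auto simp: less_imp_le)
  also have "(\<Sum>k\<in>{1..n}. cweight A n k * A k 0 * Gloc k) + \<dots> = (\<Sum>k\<in>{1..n}. cweight A n k * cal_G A Gloc Ghis k)"
    by (simp add: cal_G_def sum.distrib[symmetric] algebra_simps)
  also have "\<dots> \<le> (\<rho> + 1) * Xi t \<alpha> \<pi>A (cal_G A Gloc Ghis) n"
    using A0 G by (intro cweight_sum_le_Xi[OF n]) (auto simp: cal_G_def less_imp_le)
  finally show ?thesis by simp
qed

end

section \<open>The discrete energy inequality\<close>

lemma grid_norm_eq_L2: "0 \<le> h \<Longrightarrow> grid_norm h M v = sqrt h * L2_set v {1..<M}"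
  by (simp add: grid_norm_def grid_inner_def L2_set_def real_sqrt_mult power2_eq_square)

lemma grid_norm_nonneg: "0 \<le> h \<Longrightarrow> 0 \<le> grid_norm h M v"
  by (simp add: grid_norm_eq_L2 L2_set_nonneg)

lemma grid_norm_power2: "0 \<le> h \<Longrightarrow> (grid_norm h M v)\<^sup>2 = h * (\<Sum>i\<in>{1..<M}. (v i)\<^sup>2)"
  by (simp add: grid_norm_def grid_inner_def power2_eq_square sum_nonneg)

lemma grid_norm_triangle:
  "0 \<le> h \<Longrightarrow> grid_norm h M (\<lambda>i. v i + w i) \<le> grid_norm h M v + grid_norm h M w"
  by (simp add: grid_norm_eq_L2 distrib_left[symmetric] mult_left_mono L2_set_triangle_ineq)

lemma grid_norm_cmult:
  assumes "0 \<le> h"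
  shows "grid_norm h M (\<lambda>i. c * v i) = \<bar>c\<bar> * grid_norm h M v"
proof -
  have "grid_inner h M (\<lambda>i. c * v i) (\<lambda>i. c * v i) = c\<^sup>2 * grid_inner h M v v"
    by (simp add: grid_inner_def sum_distrib_left power2_eq_square mult_ac)
  then show ?thesis by (simp add: grid_norm_def real_sqrt_mult)
qed

lemma grid_Cauchy_Schwarz:
  assumes "0 \<le> h"
  shows "grid_inner h M v w \<le> grid_norm h M v * grid_norm h M w"
proof -
  have "(\<Sum>i\<in>{1..<M}. v i * w i) \<le> (\<Sum>i\<in>{1..<M}. \<bar>v i\<bar> * \<bar>w i\<bar>)"
    by (intro sum_mono) (metis abs_ge_self abs_mult)
  also have "\<dots> \<le> L2_set v {1..<M} * L2_set w {1..<M}" by (rule L2_set_mult_ineq)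
  finally have "h * (\<Sum>i\<in>{1..<M}. v i * w i) \<le> h * (L2_set v {1..<M} * L2_set w {1..<M})"
    using assms by (rule mult_left_mono)
  also have "\<dots> = grid_norm h M v * grid_norm h M w"
    using assms real_sqrt_mult_self[of h] by (simp add: grid_norm_eq_L2 mult_ac)
  finally show ?thesis by (simp add: grid_inner_def)
qed

lemma grid_norm_le:
  assumes "0 \<le> h" "0 \<le> B" "\<And>i. i \<in> {1..<M} \<Longrightarrow> \<bar>v i\<bar> \<le> B"
  shows "grid_norm h M v \<le> sqrt (h * real M) * B"
proof -
  have "(\<Sum>i\<in>{1..<M}. v i * v i) \<le> (\<Sum>i\<in>{1..<M}. B\<^sup>2)"
    using assms(2,3) by (intro sum_mono) (metis abs_le_square_iff abs_of_nonneg power2_eq_square)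
  also have "\<dots> \<le> real M * B\<^sup>2" by (simp add: mult_right_mono)
  finally have "h * (\<Sum>i\<in>{1..<M}. v i * v i) \<le> h * real M * B\<^sup>2"
    using assms(1) by (simp add: mult_left_mono mult.assoc)
  then have "grid_norm h M v \<le> sqrt (h * real M * B\<^sup>2)" by (simp add: grid_norm_def grid_inner_def)
  also have "\<dots> = sqrt (h * real M) * B" using assms(2) by (simp add: real_sqrt_mult)
  finally show ?thesis .
qed

lemma grid_norm_offset_le:
  assumes "0 \<le> h" "0 \<le> \<theta>" "\<theta> \<le> 1"
  shows "grid_norm h M (\<lambda>i. offset \<theta> (\<lambda>k. e k i) n) \<le> max (grid_norm h M (e (n - 1))) (grid_norm h M (e n))"
    (is "_ \<le> max ?a ?b")
proof -
  have "grid_norm h M (\<lambda>i. offset \<theta> (\<lambda>k. e k i) n) \<le> \<theta> * ?a + (1 - \<theta>) * ?b"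
    using grid_norm_triangle[OF assms(1), of M "\<lambda>i. \<theta> * e (n - 1) i" "\<lambda>i. (1 - \<theta>) * e n i"] assms
    by (simp add: offset_def grid_norm_cmult)
  also have "\<dots> \<le> \<theta> * max ?a ?b + (1 - \<theta>) * max ?a ?b"
    using assms by (intro add_mono mult_left_mono) auto
  finally show ?thesis by (simp add: algebra_simps)
qed

text \<open>Summation by parts in a form suited to induction: up to a boundary term, each summand is minus the
  average of two neighbouring squared differences.\<close>

lemma second_difference_sum_le:
  fixes w :: "nat \<Rightarrow> real"
  assumes "1 \<le> M"
  shows "(\<Sum>i\<in>{1..<M}. (w (i + 1) - 2 * w i + w (i - 1)) * w i)
    \<le> ((w M)\<^sup>2 - (w (M - 1))\<^sup>2 - (w 1)\<^sup>2 + (w 0)\<^sup>2) / 2"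
  using assms
proof (induction M rule: dec_induct)
  case (step M)
  have "0 \<le> (w (M + 1) - w M)\<^sup>2 + (w M - w (M - 1))\<^sup>2" by simp
  then have "(w (M + 1) - 2 * w M + w (M - 1)) * w M
      \<le> ((w (M + 1))\<^sup>2 - (w M)\<^sup>2 - ((w M)\<^sup>2 - (w (M - 1))\<^sup>2)) / 2"
    by (simp add: power2_eq_square algebra_simps)
  with step show ?case by simp
qed simp

lemma discrete_laplacian_dissipative:
  assumes "0 \<le> h" "1 \<le> M" "w 0 = 0" "w M = 0"
  shows "grid_inner h M w (discrete_laplacian h w) \<le> 0"
proof -
  have "(\<Sum>i\<in>{1..<M}. w i * discrete_laplacian h w i)
      = (\<Sum>i\<in>{1..<M}. (w (i + 1) - 2 * w i + w (i - 1)) * w i) / h\<^sup>2"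
    by (simp add: discrete_laplacian_def sum_divide_distrib mult.commute)
  moreover have "(\<Sum>i\<in>{1..<M}. (w (i + 1) - 2 * w i + w (i - 1)) * w i) \<le> 0"
  proof -
    have "(\<Sum>i\<in>{1..<M}. (w (i + 1) - 2 * w i + w (i - 1)) * w i) \<le> (- (w (M - 1))\<^sup>2 - (w 1)\<^sup>2) / 2"
      using second_difference_sum_le[OF assms(2), of w] assms(3,4) by simp
    also have "\<dots> \<le> 0" by simp
    finally show ?thesis .
  qed
  ultimately have "(\<Sum>i\<in>{1..<M}. w i * discrete_laplacian h w i) \<le> 0"
    by (simp add: divide_nonpos_nonneg)
  then show ?thesis using assms(1) by (simp add: grid_inner_def mult_nonneg_nonpos)
qed

text \<open>Coercivity in time is applied at every grid point and summed; the diffusion term drops out by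
  dissipativity, and only the positive part of \<open>\<kappa>\<close> matters.\<close>

lemma scheme_energy:
  assumes A1: "kernels_A1 N A" and n: "n \<in> {1..N}"
    and th: "0 \<le> \<theta>" "\<theta> \<le> 1" "\<theta> = 0 \<or> \<theta> \<le> theta_bound A n"
    and hM: "0 \<le> h" "1 \<le> M"
    and bdry: "\<And>k. k \<le> N \<Longrightarrow> e k 0 = 0 \<and> e k M = 0"
    and scheme: "\<And>i. i \<in> {1..<M} \<Longrightarrow> discrete_caputo A (\<lambda>k. e k i) n
      = discrete_laplacian h (\<lambda>i. offset \<theta> (\<lambda>k. e k i) n) i + \<kappa> * offset \<theta> (\<lambda>k. e k i) n + R i"
  defines "w \<equiv> (\<lambda>i. offset \<theta> (\<lambda>k. e k i) n)"
  shows "discrete_caputo A (\<lambda>k. (grid_norm h M (e k))\<^sup>2) n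
    \<le> 2 * max \<kappa> 0 * (grid_norm h M w)\<^sup>2 + 2 * grid_norm h M w * grid_norm h M R"
proof -
  have "discrete_caputo A (\<lambda>k. (grid_norm h M (e k))\<^sup>2) n
      = h * (\<Sum>i\<in>{1..<M}. discrete_caputo A (\<lambda>k. (e k i)\<^sup>2) n)"
    unfolding discrete_caputo_def grid_norm_power2[OF hM(1)]
    by (subst sum.swap) (simp add: sum_distrib_left sum_subtractf[symmetric] algebra_simps)
  also have "\<dots> \<le> h * (\<Sum>i\<in>{1..<M}. 2 * w i * discrete_caputo A (\<lambda>k. e k i) n)"
    unfolding w_def using discrete_caputo_energy[OF A1 n th(1,3)] hM(1) by (intro mult_left_mono sum_mono) auto
  also have "\<dots> = h * (\<Sum>i\<in>{1..<M}. 2 * w i * (discrete_laplacian h w i + \<kappa> * w i + R i))"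
    using scheme by (simp add: w_def)
  also have "\<dots> = 2 * grid_inner h M w (discrete_laplacian h w) + 2 * \<kappa> * (grid_norm h M w)\<^sup>2 + 2 * grid_inner h M w R"
    unfolding grid_norm_power2[OF hM(1)]
    by (simp add: grid_inner_def sum_distrib_left sum.distrib algebra_simps power2_eq_square)
  also have "\<dots> \<le> 2 * 0 + 2 * max \<kappa> 0 * (grid_norm h M w)\<^sup>2 + 2 * (grid_norm h M w * grid_norm h M R)"
  proof (intro add_mono mult_left_mono mult_right_mono grid_Cauchy_Schwarz[OF hM(1)])
    show "grid_inner h M w (discrete_laplacian h w) \<le> 0"
      using bdry n by (intro discrete_laplacian_dissipative hM) (auto simp: w_def offset_def)
  qed auto
  finally show ?thesis by simp
qed

section \<open>Truncation errors in space and time\<close>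

lemma second_difference_error_interior:
  assumes w: "space_regular xl xr C w" and d: "0 < \<delta>" "xl < x - \<delta>" "x + \<delta> < xr"
  shows "\<bar>w (x + \<delta>) - 2 * w x + w (x - \<delta>) - \<delta>\<^sup>2 * (deriv ^^ 2) w x\<bar> \<le> C * \<delta> ^ 4 / 12"
proof -
  have der: "\<forall>m s. m < 4 \<and> x - \<delta> \<le> s \<and> s \<le> x + \<delta> \<longrightarrow>
      ((deriv ^^ m) w has_real_derivative (deriv ^^ Suc m) w s) (at s)"
    using w d by (auto simp: space_regular_def DERIV_deriv_iff_real_differentiable)
  have bound: "\<bar>(deriv ^^ 4) w s\<bar> \<le> C" if "x - \<delta> \<le> s" "s \<le> x + \<delta>" for s
    using w d that by (auto simp: space_regular_def)
  obtain s where s: "x < s" "s < x + \<delta>" and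
    up: "w (x + \<delta>) = (\<Sum>m<4. (deriv ^^ m) w x / fact m * \<delta> ^ m) + (deriv ^^ 4) w s / fact 4 * \<delta> ^ 4"
    using Taylor[of 4 "\<lambda>m. (deriv ^^ m) w" w "x - \<delta>" "x + \<delta>" x "x + \<delta>", OF _ _ der] d by auto
  obtain r where r: "x - \<delta> < r" "r < x" and
    down: "w (x - \<delta>) = (\<Sum>m<4. (deriv ^^ m) w x / fact m * (- \<delta>) ^ m) + (deriv ^^ 4) w r / fact 4 * (- \<delta>) ^ 4"
    using Taylor[of 4 "\<lambda>m. (deriv ^^ m) w" w "x - \<delta>" "x + \<delta>" x "x - \<delta>", OF _ _ der] d by auto
  have "w (x + \<delta>) - 2 * w x + w (x - \<delta>) - \<delta>\<^sup>2 * (deriv ^^ 2) w x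
      = ((deriv ^^ 4) w s + (deriv ^^ 4) w r) * \<delta> ^ 4 / 24"
    unfolding up down by (simp add: eval_nat_numeral fact_numeral field_simps)
  also have "\<bar>\<dots>\<bar> = \<bar>(deriv ^^ 4) w s + (deriv ^^ 4) w r\<bar> * \<delta> ^ 4 / 24"
    by (simp add: abs_mult)
  also have "\<dots> \<le> (C + C) * \<delta> ^ 4 / 24"
    using bound[of s] bound[of r] s r d
    by (intro divide_right_mono mult_right_mono order_trans[OF abs_triangle_ineq] add_mono) auto
  finally show ?thesis by simp
qed

text \<open>The outer points may lie on the boundary, where no derivatives are available. The interior estimate
  passes to the limit because \<open>w\<close> is continuous up to the boundary.\<close>

lemma second_difference_error:
  assumes w: "space_regular xl xr C w" "continuous_on {xl..xr} w" and d: "0 < \<delta>" "xl \<le> x - \<delta>" "x + \<delta> \<le> xr"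
  shows "\<bar>w (x + \<delta>) - 2 * w x + w (x - \<delta>) - \<delta>\<^sup>2 * (deriv ^^ 2) w x\<bar> \<le> C * \<delta> ^ 4 / 12"
proof -
  let ?f = "\<lambda>r. C * r ^ 4 / 12 - \<bar>w (x + r) - 2 * w x + w (x - r) - r\<^sup>2 * (deriv ^^ 2) w x\<bar>"
  have cl: "closure {0<..<\<delta>} = {0..\<delta>}" using d by simp
  have "0 \<le> ?f \<delta>"
  proof (rule continuous_ge_on_closure[of "{0<..<\<delta>}" ?f])
    have contp: "continuous_on {0..\<delta>} (\<lambda>r. w (x + r))"
      by (rule continuous_on_compose2[OF w(2)]) (use d in \<open>auto intro!: continuous_intros\<close>)
    have contm: "continuous_on {0..\<delta>} (\<lambda>r. w (x - r))"
      by (rule continuous_on_compose2[OF w(2)]) (use d in \<open>auto intro!: continuous_intros\<close>)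
    show "continuous_on (closure {0<..<\<delta>}) ?f"
      unfolding cl by (intro continuous_intros contp contm) auto
    show "\<delta> \<in> closure {0<..<\<delta>}" unfolding cl using d by simp
    show "0 \<le> ?f r" if "r \<in> {0<..<\<delta>}" for r
      using second_difference_error_interior[OF w(1), of r x] that d by simp
  qed
  then show ?thesis by simp
qed

lemma time_regularD:
  assumes "time_regular T \<sigma> C v" "0 < s" "s < T"
  shows "(v has_real_derivative dt T v s) (at s)"
    and "(dt T v has_real_derivative dt T (dt T v) s) (at s)"
    and "\<bar>dt T v s\<bar> \<le> C * (1 + s powr (\<sigma> - 1))"
    and "\<bar>dt T (dt T v) s\<bar> \<le> C * (1 + s powr (\<sigma> - 2))"
proof -
  have s: "s \<in> {0<..T}" using assms by auto
  have at: "at s within {0<..T} = at s"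
    by (rule at_within_interior) (use assms in \<open>auto intro!: interiorI[of "{0<..<T}"]\<close>)
  have der: "(w has_real_derivative dt T w s) (at s)" if "w differentiable (at s within {0<..T})" for w
    using that unfolding dt_def vector_derivative_works at has_real_derivative_iff_has_vector_derivative .
  have "(dt T ^^ 0) v differentiable (at s within {0<..T})" "(dt T ^^ 1) v differentiable (at s within {0<..T})"
    using assms(1) s unfolding time_regular_def by (metis zero_less_numeral, metis one_less_numeral_iff semiring_norm(76))
  then show "(v has_real_derivative dt T v s) (at s)"
    and "(dt T v has_real_derivative dt T (dt T v) s) (at s)"
    using der by simp_all
  have "\<bar>(dt T ^^ 1) v s\<bar> \<le> C * (1 + s powr (\<sigma> - real 1))" "\<bar>(dt T ^^ 2) v s\<bar> \<le> C * (1 + s powr (\<sigma> - real 2))"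
    using assms(1) s unfolding time_regular_def by blast+
  then show "\<bar>dt T v s\<bar> \<le> C * (1 + s powr (\<sigma> - 1))"
    and "\<bar>dt T (dt T v) s\<bar> \<le> C * (1 + s powr (\<sigma> - 2))"
    by (simp_all add: numeral_2_eq_2)
qed

lemma abs_increment_le:
  fixes w \<phi> :: "real \<Rightarrow> real"
  assumes ab: "a < b"
    and cont: "continuous_on {a..b} w" "continuous_on {a..b} \<phi>"
    and der: "\<And>s. a < s \<Longrightarrow> s < b \<Longrightarrow> (w has_real_derivative w' s) (at s)"
      "\<And>s. a < s \<Longrightarrow> s < b \<Longrightarrow> (\<phi> has_real_derivative \<phi>' s) (at s)"
    and le: "\<And>s. a < s \<Longrightarrow> s < b \<Longrightarrow> \<bar>w' s\<bar> \<le> \<phi>' s"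
  shows "\<bar>w b - w a\<bar> \<le> \<phi> b - \<phi> a"
proof -
  have "\<phi> a - w a \<le> \<phi> b - w b"
  proof (rule DERIV_nonneg_imp_increasing_open[of a b "\<lambda>s. \<phi> s - w s"])
    show "\<exists>y. ((\<lambda>s. \<phi> s - w s) has_real_derivative y) (at s) \<and> 0 \<le> y" if "a < s" "s < b" for s
      using der[OF that] le[OF that] by (intro exI[of _ "\<phi>' s - w' s"]) (auto intro!: derivative_intros)
  qed (use ab cont in \<open>auto intro!: continuous_intros\<close>)
  moreover have "\<phi> a + w a \<le> \<phi> b + w b"
  proof (rule DERIV_nonneg_imp_increasing_open[of a b "\<lambda>s. \<phi> s + w s"])
    show "\<exists>y. ((\<lambda>s. \<phi> s + w s) has_real_derivative y) (at s) \<and> 0 \<le> y" if "a < s" "s < b" for s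
      using der[OF that] le[OF that] by (intro exI[of _ "\<phi>' s + w' s"]) (auto intro!: derivative_intros)
  qed (use ab cont in \<open>auto intro!: continuous_intros\<close>)
  ultimately show ?thesis by linarith
qed

text \<open>Two mean value theorems, to the left and right of the interpolation point. Stopping at first derivatives
  allows \<open>a = 0\<close>, where the derivatives may be unbounded.\<close>

lemma interpolation_error_mvt:
  fixes v v' :: "real \<Rightarrow> real"
  assumes ab: "a < b" and th: "0 < \<theta>" "\<theta> < 1" and cont: "continuous_on {a..b} v"
    and der: "\<And>s. a < s \<Longrightarrow> s < b \<Longrightarrow> (v has_real_derivative v' s) (at s)"
  obtains r s where "a < r" "r < s" "s < b"
    "v (\<theta> * a + (1 - \<theta>) * b) - (\<theta> * v a + (1 - \<theta>) * v b) = \<theta> * (1 - \<theta>) * (b - a) * (v' r - v' s)"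
proof -
  define m where "m = \<theta> * a + (1 - \<theta>) * b"
  have m: "m - a = (1 - \<theta>) * (b - a)" "b - m = \<theta> * (b - a)" by (simp_all add: m_def algebra_simps)
  then have "0 < m - a" "0 < b - m" using ab th by simp_all
  then have am: "a < m" "m < b" by simp_all
  have mean: "\<exists>z. p < z \<and> z < q \<and> v q - v p = (q - p) * v' z" if "a \<le> p" "p < q" "q \<le> b" for p q
  proof -
    have "\<exists>l z. p < z \<and> z < q \<and> (v has_real_derivative l) (at z) \<and> v q - v p = (q - p) * l"
    proof (rule MVT[OF \<open>p < q\<close>])
      show "continuous_on {p..q} v" by (rule continuous_on_subset[OF cont]) (use that in auto)
      show "v differentiable (at z)" if "p < z" "z < q" for z
        using der[of z] that \<open>a \<le> p\<close> \<open>q \<le> b\<close> by (auto simp: real_differentiable_def)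
    qed
    then obtain l z where z: "p < z" "z < q" "(v has_real_derivative l) (at z)" "v q - v p = (q - p) * l"
      by blast
    have "l = v' z" by (rule DERIV_unique[OF z(3) der]) (use z that in auto)
    with z show ?thesis by blast
  qed
  obtain r where r: "a < r" "r < m" "v m - v a = (m - a) * v' r" using mean[of a m] am by auto
  obtain s where s: "m < s" "s < b" "v b - v m = (b - m) * v' s" using mean[of m b] am by auto
  have "v m - (\<theta> * v a + (1 - \<theta>) * v b) = \<theta> * (v m - v a) - (1 - \<theta>) * (v b - v m)"
    by (simp add: algebra_simps)
  also have "\<dots> = \<theta> * (1 - \<theta>) * (b - a) * (v' r - v' s)"
    unfolding r(3) s(3) m by (simp add: algebra_simps)
  finally show ?thesis using that[of r s] r s am by (simp add: m_def)
qed

lemma theta_product_le_1: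
  fixes \<theta> :: real
  assumes "0 < \<theta>" "\<theta> < 1"
  shows "\<theta> * (1 - \<theta>) \<le> 1" "0 \<le> \<theta> * (1 - \<theta>)"
  using assms mult_le_one[of \<theta> "1 - \<theta>"] by auto

lemma interpolation_error_later_step:
  assumes v: "time_regular T \<sigma> C v" "continuous_on {0..T} v"
    and ab: "0 < a" "a < b" "b \<le> T" and th: "0 < \<theta>" "\<theta> < 1" and "\<sigma> < 2" "0 < C"
  shows "\<bar>v (\<theta> * a + (1 - \<theta>) * b) - (\<theta> * v a + (1 - \<theta>) * v b)\<bar>
    \<le> C * (1 + T powr (2 - \<sigma>)) * (a powr (\<sigma> - 2) * (b - a)\<^sup>2)"
proof -
  have "continuous_on {a..b} v" by (rule continuous_on_subset[OF v(2)]) (use ab in auto)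
  then obtain r s where rs: "a < r" "r < s" "s < b" and
    eq: "v (\<theta> * a + (1 - \<theta>) * b) - (\<theta> * v a + (1 - \<theta>) * v b) = \<theta> * (1 - \<theta>) * (b - a) * (dt T v r - dt T v s)"
    by (rule interpolation_error_mvt[OF ab(2) th, of v "dt T v"])
       (use time_regularD(1)[OF v(1)] ab in auto)
  have "\<exists>z. r < z \<and> z < s \<and> dt T v s - dt T v r = (s - r) * dt T (dt T v) z"
    by (rule MVT2[OF rs(2)]) (use time_regularD(2)[OF v(1)] ab rs in auto)
  then obtain z where z: "r < z" "z < s" and zz: "dt T v s - dt T v r = (s - r) * dt T (dt T v) z"
    by blast
  have az: "a powr (2 - \<sigma>) \<le> T powr (2 - \<sigma>)" using ab assms(8) by (intro powr_mono2) auto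
  have one: "a powr (2 - \<sigma>) * a powr (\<sigma> - 2) = 1" using ab by (simp add: powr_add[symmetric])
  have "\<bar>dt T v r - dt T v s\<bar> = (s - r) * \<bar>dt T (dt T v) z\<bar>"
    using rs zz by (simp add: abs_minus_commute[of "dt T v r"] abs_mult)
  also have "\<dots> \<le> (b - a) * (C * (1 + z powr (\<sigma> - 2)))"
    using rs z ab time_regularD(4)[OF v(1), of z] by (intro mult_mono) auto
  also have "\<dots> \<le> (b - a) * (C * (T powr (2 - \<sigma>) * a powr (\<sigma> - 2) + a powr (\<sigma> - 2)))"
  proof (intro mult_left_mono add_mono)
    show "1 \<le> T powr (2 - \<sigma>) * a powr (\<sigma> - 2)"
      using mult_right_mono[OF az, of "a powr (\<sigma> - 2)"] one by simp
    show "z powr (\<sigma> - 2) \<le> a powr (\<sigma> - 2)" using assms(8) ab rs z by (intro powr_mono2') auto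
  qed (use ab assms(9) in auto)
  finally have d: "\<bar>dt T v r - dt T v s\<bar> \<le> (b - a) * (C * (1 + T powr (2 - \<sigma>)) * a powr (\<sigma> - 2))"
    by (simp add: algebra_simps)
  have "\<bar>\<theta> * (1 - \<theta>) * (b - a) * (dt T v r - dt T v s)\<bar> = \<theta> * (1 - \<theta>) * ((b - a) * \<bar>dt T v r - dt T v s\<bar>)"
    using th ab by (simp add: abs_mult)
  also have "\<dots> \<le> 1 * ((b - a) * ((b - a) * (C * (1 + T powr (2 - \<sigma>)) * a powr (\<sigma> - 2))))"
    using theta_product_le_1[OF th] ab d assms(9) by (intro mult_mono) auto
  finally show ?thesis unfolding eq by (simp add: power2_eq_square mult_ac)
qed

text \<open>For \<open>\<sigma> < 1\<close> the first derivative may be unbounded, but its bound is integrable: \<open>\<phi>\<close> is a primitive of that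
  bound and controls the increments of \<open>v\<close> on both sides of the interpolation point.\<close>

lemma interpolation_error_first_step_weak:
  assumes v: "time_regular T \<sigma> C v" "continuous_on {0..T} v"
    and b: "0 < b" "b \<le> T" and th: "0 < \<theta>" "\<theta> < 1" and \<sigma>: "0 < \<sigma>" "\<sigma> < 1" and C: "0 < C"
  shows "\<bar>v ((1 - \<theta>) * b) - (\<theta> * v 0 + (1 - \<theta>) * v b)\<bar> \<le> C * (1 + T powr (1 - \<sigma>)) * (b powr \<sigma> / \<sigma>)"
proof -
  define \<phi> where "\<phi> s = C * (s + s powr \<sigma> / \<sigma>)" for s
  let ?m = "(1 - \<theta>) * b"
  have m: "0 < ?m" "?m < b" using b th by auto
  have cont: "continuous_on {0..} \<phi>"
    unfolding \<phi>_def[abs_def] using \<sigma> by (intro continuous_intros continuous_on_powr') auto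
  have der: "(\<phi> has_real_derivative C * (1 + s powr (\<sigma> - 1))) (at s)" if "0 < s" for s
    unfolding \<phi>_def[abs_def] using that \<sigma> by (auto intro!: derivative_eq_intros)
  have incr: "\<bar>v q - v p\<bar> \<le> \<phi> q - \<phi> p" if "0 \<le> p" "p < q" "q \<le> T" for p q
    by (rule abs_increment_le[OF that(2), where w' = "dt T v" and \<phi>' = "\<lambda>s. C * (1 + s powr (\<sigma> - 1))"])
       (use that time_regularD[OF v(1)] der in
         \<open>auto intro: continuous_on_subset[OF v(2)] continuous_on_subset[OF cont]\<close>)
  have "\<bar>v ?m - (\<theta> * v 0 + (1 - \<theta>) * v b)\<bar> = \<bar>\<theta> * (v ?m - v 0) + (1 - \<theta>) * (v ?m - v b)\<bar>"
    by (simp add: algebra_simps)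
  also have "\<dots> \<le> \<theta> * \<bar>v ?m - v 0\<bar> + (1 - \<theta>) * \<bar>v b - v ?m\<bar>"
    using th by (intro order_trans[OF abs_triangle_ineq]) (simp add: abs_mult abs_minus_commute)
  also have "\<dots> \<le> 1 * (\<phi> ?m - \<phi> 0) + 1 * (\<phi> b - \<phi> ?m)"
  proof (intro add_mono mult_mono)
    show "\<bar>v ?m - v 0\<bar> \<le> \<phi> ?m - \<phi> 0" "\<bar>v b - v ?m\<bar> \<le> \<phi> b - \<phi> ?m"
      by (intro incr; use m b in linarith)+
  qed (use th in auto)
  also have "\<dots> = C * (b + b powr \<sigma> / \<sigma>)" using \<sigma> by (simp add: \<phi>_def)
  also have "\<dots> \<le> C * (T powr (1 - \<sigma>) * (b powr \<sigma> / \<sigma>) + b powr \<sigma> / \<sigma>)"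
  proof -
    have "b = b powr (1 - \<sigma>) * b powr \<sigma>" using b by (simp add: powr_add[symmetric])
    also have "\<dots> \<le> T powr (1 - \<sigma>) * (b powr \<sigma> / \<sigma>)"
    proof (intro mult_mono)
      show "b powr (1 - \<sigma>) \<le> T powr (1 - \<sigma>)" using b \<sigma> by (intro powr_mono2) auto
      show "b powr \<sigma> \<le> b powr \<sigma> / \<sigma>" using \<sigma> by (simp add: le_divide_eq mult_left_le)
    qed auto
    finally show ?thesis using C by (intro mult_left_mono add_right_mono) auto
  qed
  finally show ?thesis by (simp add: algebra_simps)
qed

text \<open>For \<open>\<sigma> > 1\<close> the first derivative is bounded, but using only this would lose the power \<open>\<sigma>\<close>. The
  bound on the second derivative is integrable, and \<open>\<phi>\<close>, a primitive of it, controls the variation of the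
  first.\<close>

lemma interpolation_error_first_step_strong:
  assumes v: "time_regular T \<sigma> C v" "continuous_on {0..T} v"
    and b: "0 < b" "b \<le> T" and th: "0 < \<theta>" "\<theta> < 1" and \<sigma>: "1 < \<sigma>" "\<sigma> < 2" and C: "0 < C"
  shows "\<bar>v ((1 - \<theta>) * b) - (\<theta> * v 0 + (1 - \<theta>) * v b)\<bar>
    \<le> \<sigma> * C * (T powr (2 - \<sigma>) + 1 / (\<sigma> - 1)) * (b powr \<sigma> / \<sigma>)"
proof -
  define \<phi> where "\<phi> s = C * (s + s powr (\<sigma> - 1) / (\<sigma> - 1))" for s
  have der: "(\<phi> has_real_derivative C * (1 + s powr (\<sigma> - 2))) (at s)" if "0 < s" for s
    unfolding \<phi>_def[abs_def] using that \<sigma> by (auto intro!: derivative_eq_intros)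
  have "continuous_on {0..b} v" by (rule continuous_on_subset[OF v(2)]) (use b in auto)
  then obtain r s where rs: "0 < r" "r < s" "s < b" and
    eq: "v (\<theta> * 0 + (1 - \<theta>) * b) - (\<theta> * v 0 + (1 - \<theta>) * v b) = \<theta> * (1 - \<theta>) * (b - 0) * (dt T v r - dt T v s)"
    by (rule interpolation_error_mvt[OF b(1) th, of v "dt T v"])
       (use time_regularD(1)[OF v(1)] b in auto)
  have "\<bar>dt T v s - dt T v r\<bar> \<le> \<phi> s - \<phi> r"
  proof (rule abs_increment_le[OF rs(2), where w' = "dt T (dt T v)" and \<phi>' = "\<lambda>s. C * (1 + s powr (\<sigma> - 2))"])
    show "continuous_on {r..s} (dt T v)"
      by (rule DERIV_continuous_on[where D = "dt T (dt T v)"])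
         (use rs b time_regularD(2)[OF v(1)] in \<open>auto intro: has_field_derivative_at_within\<close>)
    show "continuous_on {r..s} \<phi>"
      by (rule DERIV_continuous_on[OF has_field_derivative_at_within[OF der]]) (use rs in auto)
  qed (use rs b time_regularD[OF v(1)] der in auto)
  also have "\<dots> \<le> \<phi> s" using rs \<sigma> C by (simp add: \<phi>_def)
  also have "\<dots> \<le> \<phi> b"
    unfolding \<phi>_def using rs \<sigma> C by (intro mult_left_mono add_mono divide_right_mono powr_mono2) auto
  finally have "b * \<bar>dt T v r - dt T v s\<bar> \<le> b * \<phi> b" using b by (simp add: abs_minus_commute)
  then have "\<theta> * (1 - \<theta>) * (b * \<bar>dt T v r - dt T v s\<bar>) \<le> 1 * (b * \<phi> b)"
    using theta_product_le_1[OF th] b by (intro mult_mono) auto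
  then have "\<bar>v ((1 - \<theta>) * b) - (\<theta> * v 0 + (1 - \<theta>) * v b)\<bar> \<le> b * \<phi> b"
    using eq th b by (simp add: abs_mult mult_ac)
  also have "\<dots> = C * (b powr (2 - \<sigma>) * b powr \<sigma> + b powr \<sigma> / (\<sigma> - 1))"
  proof -
    have "b * b = b powr (2 - \<sigma>) * b powr \<sigma>" using b by (simp add: powr_add[symmetric] power2_eq_square)
    moreover have "b * b powr (\<sigma> - 1) = b powr \<sigma>" using b by (simp add: powr_mult_base)
    ultimately show ?thesis by (simp add: \<phi>_def algebra_simps)
  qed
  also have "\<dots> \<le> C * (T powr (2 - \<sigma>) * b powr \<sigma> + b powr \<sigma> / (\<sigma> - 1))"
    using b \<sigma> C by (intro mult_left_mono add_mono mult_right_mono powr_mono2) auto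
  also have "\<dots> = \<sigma> * C * (T powr (2 - \<sigma>) + 1 / (\<sigma> - 1)) * (b powr \<sigma> / \<sigma>)"
    using \<sigma> by (simp add: field_simps)
  finally show ?thesis .
qed

text \<open>A bound for the interpolation error on the first step that is uniform in the function, the step and
  the offset. The division by \<open>\<sigma>\<close> is the form in which this error enters the final estimate.\<close>

definition first_step_constant :: "real \<Rightarrow> real \<Rightarrow> real \<Rightarrow> real \<Rightarrow> bool" where
  "first_step_constant T \<sigma> C K \<longleftrightarrow> 0 < K \<and>
     (\<forall>v b \<theta>. time_regular T \<sigma> C v \<and> continuous_on {0..T} v \<and> 0 < b \<and> b \<le> T \<and> 0 < \<theta> \<and> \<theta> < 1 \<longrightarrow>
        \<bar>v ((1 - \<theta>) * b) - (\<theta> * v 0 + (1 - \<theta>) * v b)\<bar> \<le> K * (b powr \<sigma> / \<sigma>))"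

lemma first_step_constant_exists:
  assumes "\<sigma> \<in> {0<..<1} \<union> {1<..<2}" "0 < C" "0 < T"
  shows "\<exists>K. first_step_constant T \<sigma> C K"
proof (cases "\<sigma> < 1")
  case True
  have "0 < C * (1 + T powr (1 - \<sigma>))" using assms by (simp add: add_pos_nonneg)
  then have "first_step_constant T \<sigma> C (C * (1 + T powr (1 - \<sigma>)))"
    unfolding first_step_constant_def
    using interpolation_error_first_step_weak[of T \<sigma> C] assms True by simp
  then show ?thesis by blast
next
  case False
  have "0 < \<sigma> * C * (T powr (2 - \<sigma>) + 1 / (\<sigma> - 1))"
    using assms False by (auto intro!: mult_pos_pos add_pos_pos)
  then have "first_step_constant T \<sigma> C (\<sigma> * C * (T powr (2 - \<sigma>) + 1 / (\<sigma> - 1)))"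
    unfolding first_step_constant_def
    using interpolation_error_first_step_strong[of T \<sigma> C] assms False by simp
  then show ?thesis by blast
qed

section \<open>The error of the fully discrete scheme\<close>

lemma max_over_ge: "finite I \<Longrightarrow> i \<in> I \<Longrightarrow> f i \<le> max_over I f"
  by (auto simp: max_over_def)

lemma max_over_nonneg: "finite I \<Longrightarrow> (\<And>i. i \<in> I \<Longrightarrow> 0 \<le> f i) \<Longrightarrow> 0 \<le> max_over I f"
  by (metis all_not_in_conv max_over_def max_over_ge order_refl order_trans)

lemma max_over_le: "finite I \<Longrightarrow> 0 \<le> B \<Longrightarrow> (\<And>i. i \<in> I \<Longrightarrow> f i \<le> B) \<Longrightarrow> max_over I f \<le> B"
  by (auto simp: max_over_def)

text \<open>One choice of all data, before the constant is made uniform in them. The step restriction appears in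
  the form in which \<open>discrete_gronwall\<close> uses it, and \<open>theta_bound\<close> covers both cases of the
  main estimate.\<close>

locale subdiffusion_scheme = nonuniform_caputo \<alpha> \<pi>A \<rho> T N t A
  for \<alpha> \<pi>A \<rho> T :: real and N :: nat and t :: "nat \<Rightarrow> real" and A :: "nat \<Rightarrow> nat \<Rightarrow> real" +
  fixes xl xr \<kappa> \<theta> \<sigma> C :: real and f u :: "real \<Rightarrow> real \<Rightarrow> real" and u0 :: "real \<Rightarrow> real"
    and M :: nat and U :: "nat \<Rightarrow> nat \<Rightarrow> real" and Gloc Ghis :: "nat \<Rightarrow> real"
  assumes interval: "xl < xr" and M: "1 \<le> M" and C: "0 < C"
    and sigma: "\<sigma> < 2"
    and theta: "0 \<le> \<theta>" "\<theta> < 1"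
    and theta_bound: "n \<in> {1..N} \<Longrightarrow> \<theta> = 0 \<or> \<theta> \<le> theta_bound A n"
    and solution: "subdiffusion_solution xl xr T \<alpha> \<kappa> f u0 u"
    and scheme: "discrete_solution xl xr M N t \<theta> A \<kappa> f u0 U"
    and space_reg: "s \<in> {0<..T} \<Longrightarrow> space_regular xl xr C (\<lambda>y. u y s)"
    and time_reg: "0 < \<theta> \<Longrightarrow> i \<in> {1..<M} \<Longrightarrow> time_regular T \<sigma> C
      (\<lambda>s. discrete_laplacian (mesh_width xl xr M) (\<lambda>j. u (grid_point xl xr M j) s) i
        + \<kappa> * u (grid_point xl xr M i) s)"
    and consistency: "error_convolution_structure xl xr M N t \<alpha> \<theta> A u Gloc Ghis"
    and small_steps: "k \<in> {1..N} \<Longrightarrow>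
      4 * max 1 \<rho> * \<pi>A * Gamma (2 - \<alpha>) * max \<kappa> 0 * step t k powr \<alpha> \<le> 1"
begin

abbreviation h :: real where "h \<equiv> mesh_width xl xr M"

abbreviation x :: "nat \<Rightarrow> real" where "x \<equiv> grid_point xl xr M"

definition err :: "nat \<Rightarrow> nat \<Rightarrow> real" where
  "err n i = u (x i) (t n) - U n i"

text \<open>The discrete spatial operator applied to the exact solution, as a function of time. The scheme averages
  it between two time levels, which is the source of \<open>averaging_error\<close>.\<close>

definition elliptic_part :: "nat \<Rightarrow> real \<Rightarrow> real" where
  "elliptic_part i s = discrete_laplacian h (\<lambda>j. u (x j) s) i + \<kappa> * u (x i) s"

definition space_error :: "nat \<Rightarrow> nat \<Rightarrow> real" where
  "space_error n i = (deriv ^^ 2) (\<lambda>y. u y (offset \<theta> t n)) (x i)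
     - discrete_laplacian h (\<lambda>j. u (x j) (offset \<theta> t n)) i"

definition averaging_error :: "nat \<Rightarrow> nat \<Rightarrow> real" where
  "averaging_error n i = elliptic_part i (offset \<theta> t n) - offset \<theta> (\<lambda>k. elliptic_part i (t k)) n"

text \<open>The quantity through which a residual enters the Gronwall inequality.\<close>

definition weighted_size :: "nat \<Rightarrow> (nat \<Rightarrow> nat \<Rightarrow> real) \<Rightarrow> real" where
  "weighted_size n R = (\<Sum>k\<in>{1..n}. cweight A n k * grid_norm h M (R k))"

lemma h_pos: "0 < h"
  using interval M by (simp add: mesh_width_def)

lemma h_M: "h * real M = xr - xl"
  using M by (simp add: mesh_width_def)

lemma x_ends: "x 0 = xl" "x M = xr"
  using h_M by (simp_all add: grid_point_def mult.commute)

lemma x_neighbours: "x (i + 1) = x i + h" "1 \<le> i \<Longrightarrow> x (i - 1) = x i - h"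
  by (simp_all add: grid_point_def algebra_simps of_nat_diff)

lemma x_closed:
  assumes "i \<le> M"
  shows "x i \<in> {xl..xr}"
proof -
  have "real i * h \<le> real M * h" using assms h_pos by (intro mult_right_mono) auto
  also have "\<dots> = xr - xl" using h_M by (simp add: mult.commute)
  finally show ?thesis using h_pos by (simp add: grid_point_def)
qed

lemma x_open:
  assumes "i \<in> {1..<M}"
  shows "x i \<in> {xl<..<xr}"
proof -
  have "real i * h < real M * h" using assms h_pos by (intro mult_strict_right_mono) auto
  also have "\<dots> = xr - xl" using h_M by (simp add: mult.commute)
  finally show ?thesis using assms h_pos by (simp add: grid_point_def)
qed

lemma T_pos: "N \<ge> 1 \<Longrightarrow> 0 < T"
  using t_pos[of N] mesh by (simp add: time_mesh_def)

lemma offset_time: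
  assumes "n \<in> {1..N}"
  shows "offset \<theta> t n \<in> {0<..T}"
proof -
  have n: "n - 1 \<le> N" "n \<le> N" using assms by auto
  have "0 < offset \<theta> t n"
    using theta t_nonneg[OF n(1)] t_pos[OF assms] by (simp add: offset_def add_nonneg_pos)
  moreover have "offset \<theta> t n \<le> \<theta> * T + (1 - \<theta>) * T"
    unfolding offset_def using theta t_le_T n by (intro add_mono mult_left_mono) auto
  ultimately show ?thesis by (simp add: algebra_simps)
qed

lemma continuous_in_time:
  assumes "y \<in> {xl..xr}"
  shows "continuous_on {0..T} (u y)"
proof -
  have "continuous_on ({xl..xr} \<times> {0..T}) (\<lambda>(x, t). u x t)"
    using solution by (simp add: subdiffusion_solution_def)
  then have "continuous_on {0..T} (\<lambda>s. (\<lambda>(x, t). u x t) (y, s))"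
    by (rule continuous_on_compose2) (use assms in \<open>auto intro!: continuous_intros\<close>)
  then show ?thesis by simp
qed

lemma continuous_in_space:
  assumes "s \<in> {0..T}"
  shows "continuous_on {xl..xr} (\<lambda>y. u y s)"
proof -
  have "continuous_on ({xl..xr} \<times> {0..T}) (\<lambda>(x, t). u x t)"
    using solution by (simp add: subdiffusion_solution_def)
  then have "continuous_on {xl..xr} (\<lambda>y. (\<lambda>(x, t). u x t) (y, s))"
    by (rule continuous_on_compose2) (use assms in \<open>auto intro!: continuous_intros\<close>)
  then show ?thesis by simp
qed

text \<open>The boundary condition is imposed for \<open>0 < t < T\<close> and extends to both end times by continuity.\<close>

lemma boundary_values:
  assumes "N \<ge> 1" "s \<in> {0..T}"
  shows "u xl s = 0" "u xr s = 0"
proof -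
  have cl: "closure {0<..<T} = {0..T}" using T_pos[OF assms(1)] by simp
  have zero: "u xl r = 0 \<and> u xr r = 0" if "r \<in> {0<..<T}" for r
    using solution that by (simp add: subdiffusion_solution_def)
  show "u xl s = 0"
    by (rule continuous_constant_on_closure[of "{0<..<T}"])
       (use cl zero assms(2) interval in \<open>auto intro!: continuous_in_time\<close>)
  show "u xr s = 0"
    by (rule continuous_constant_on_closure[of "{0<..<T}"])
       (use cl zero assms(2) interval in \<open>auto intro!: continuous_in_time\<close>)
qed

lemma err_boundary:
  assumes "N \<ge> 1" "k \<le> N"
  shows "err k 0 = 0 \<and> err k M = 0"
proof -
  have "t k \<in> {0..T}" using t_nonneg t_le_T assms by auto
  then show ?thesis
    using boundary_values[OF assms(1)] scheme assms(2) by (simp add: err_def x_ends discrete_solution_def)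
qed

text \<open>Subtract the scheme from the differential equation at the offset time; the source terms cancel.\<close>

lemma error_equation:
  assumes n: "n \<in> {1..N}" and i: "i \<in> {1..<M}"
  shows "discrete_caputo A (\<lambda>k. err k i) n
    = discrete_laplacian h (\<lambda>i. offset \<theta> (\<lambda>k. err k i) n) i + \<kappa> * offset \<theta> (\<lambda>k. err k i) n
      + (space_error n i + averaging_error n i - consistency_error xl xr M t \<alpha> \<theta> A u n i)"
proof -
  let ?s = "offset \<theta> t n"
  let ?L = "discrete_laplacian h"
  have PDE: "caputo \<alpha> (u (x i)) ?s - (deriv ^^ 2) (\<lambda>y. u y ?s) (x i) = \<kappa> * u (x i) ?s + f (x i) ?s"
    using solution x_open[OF i] offset_time[OF n] unfolding subdiffusion_solution_def by blast
  have FD: "discrete_caputo A (\<lambda>k. U k i) n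
      = ?L (\<lambda>i. offset \<theta> (\<lambda>k. U k i) n) i + \<kappa> * offset \<theta> (\<lambda>k. U k i) n + f (x i) ?s"
    using scheme n i unfolding discrete_solution_def by blast
  have D: "discrete_caputo A (\<lambda>k. err k i) n
      = discrete_caputo A (\<lambda>j. u (x i) (t j)) n - discrete_caputo A (\<lambda>k. U k i) n"
    by (simp add: discrete_caputo_def err_def sum_subtractf[symmetric] algebra_simps)
  have L: "?L (\<lambda>i. offset \<theta> (\<lambda>k. err k i) n) i
      = offset \<theta> (\<lambda>k. ?L (\<lambda>j. u (x j) (t k)) i) n - ?L (\<lambda>i. offset \<theta> (\<lambda>k. U k i) n) i"
    by (simp add: discrete_laplacian_def err_def offset_def diff_divide_distrib add_divide_distrib algebra_simps)
  have O: "offset \<theta> (\<lambda>k. err k i) n = offset \<theta> (\<lambda>k. u (x i) (t k)) n - offset \<theta> (\<lambda>k. U k i) n"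
    by (simp add: err_def offset_def algebra_simps)
  have E: "offset \<theta> (\<lambda>k. elliptic_part i (t k)) n
      = offset \<theta> (\<lambda>k. ?L (\<lambda>j. u (x j) (t k)) i) n + \<kappa> * offset \<theta> (\<lambda>k. u (x i) (t k)) n"
    by (simp add: elliptic_part_def offset_def algebra_simps)
  have CE: "consistency_error xl xr M t \<alpha> \<theta> A u n i
      = caputo \<alpha> (u (x i)) ?s - discrete_caputo A (\<lambda>j. u (x i) (t j)) n"
    by (simp add: consistency_error_def Let_def)
  show ?thesis
    unfolding D L O space_error_def averaging_error_def E CE FD
    using PDE by (simp add: elliptic_part_def algebra_simps)
qed

lemma space_error_norm:
  assumes n: "n \<in> {1..N}"
  shows "grid_norm h M (space_error n) \<le> sqrt (xr - xl) * (C / 12 * h\<^sup>2)"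
proof -
  let ?s = "offset \<theta> t n"
  have "\<bar>space_error n i\<bar> \<le> C / 12 * h\<^sup>2" if i: "i \<in> {1..<M}" for i
  proof -
    have s: "?s \<in> {0<..T}" "?s \<in> {0..T}" using offset_time[OF n] by auto
    have nb: "x (i + 1) = x i + h" "x (i - 1) = x i - h" using x_neighbours i by auto
    have "\<bar>u (x i + h) ?s - 2 * u (x i) ?s + u (x i - h) ?s - h\<^sup>2 * (deriv ^^ 2) (\<lambda>y. u y ?s) (x i)\<bar> \<le> C * h ^ 4 / 12"
    proof (rule second_difference_error[OF space_reg[OF s(1)] continuous_in_space[OF s(2)] h_pos])
      show "xl \<le> x i - h" using x_closed[of "i - 1"] nb(2) i by auto
      show "x i + h \<le> xr" using x_closed[of "i + 1"] nb(1) i by auto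
    qed
    moreover have "u (x i + h) ?s - 2 * u (x i) ?s + u (x i - h) ?s - h\<^sup>2 * (deriv ^^ 2) (\<lambda>y. u y ?s) (x i)
        = - (h\<^sup>2 * space_error n i)"
      using h_pos by (simp add: space_error_def discrete_laplacian_def nb[simplified] field_simps)
    ultimately have "h\<^sup>2 * \<bar>space_error n i\<bar> \<le> C * h ^ 4 / 12" by (simp add: abs_mult)
    also have "\<dots> = h\<^sup>2 * (C / 12 * h\<^sup>2)" by (simp add: eval_nat_numeral)
    finally show ?thesis using h_pos by simp
  qed
  then show ?thesis using grid_norm_le[of h "C / 12 * h\<^sup>2" M "space_error n"] h_pos C by (simp add: h_M)
qed

lemma elliptic_part_continuous:
  assumes "i \<in> {1..<M}"
  shows "continuous_on {0..T} (elliptic_part i)"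
  unfolding elliptic_part_def[abs_def] discrete_laplacian_def
  using assms h_pos by (intro continuous_intros continuous_in_time x_closed) auto

lemma averaging_error_0:
  assumes "\<theta> = 0"
  shows "averaging_error n = (\<lambda>i. 0)"
  unfolding averaging_error_def offset_def fun_eq_iff using assms by simp

lemma averaging_error_norm_later:
  assumes n: "n \<in> {2..N}" and th: "0 < \<theta>"
  shows "grid_norm h M (averaging_error n)
    \<le> sqrt (xr - xl) * (C * (1 + T powr (2 - \<sigma>)) * (t (n - 1) powr (\<sigma> - 2) * (step t n)\<^sup>2))"
proof -
  have n': "n - 1 \<in> {1..N}" "n \<in> {1..N}" using n by auto
  have lt: "t (n - 1) < t n" using step_pos[OF n'(2)] by (simp add: step_def)
  have "\<bar>averaging_error n i\<bar> \<le> C * (1 + T powr (2 - \<sigma>)) * (t (n - 1) powr (\<sigma> - 2) * (step t n)\<^sup>2)"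
    if i: "i \<in> {1..<M}" for i
    using interpolation_error_later_step[OF _ elliptic_part_continuous[OF i] t_pos[OF n'(1)] lt _ th theta(2) sigma C]
      time_reg[OF th i] t_le_T[of n] n
    by (simp add: averaging_error_def offset_def step_def elliptic_part_def[abs_def])
  then show ?thesis
    using grid_norm_le[of h "C * (1 + T powr (2 - \<sigma>)) * (t (n - 1) powr (\<sigma> - 2) * (step t n)\<^sup>2)" M "averaging_error n"]
      h_pos C by (simp add: h_M)
qed

lemma averaging_error_norm_first:
  assumes N: "1 \<le> N" and th: "0 < \<theta>" and K: "first_step_constant T \<sigma> C K"
    and sp: "0 < \<sigma>"
  shows "grid_norm h M (averaging_error 1) \<le> sqrt (xr - xl) * (K * (step t 1 powr \<sigma> / \<sigma>))"
proof -
  have 1: "1 \<in> {1..N}" using N by auto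
  have "\<bar>averaging_error 1 i\<bar> \<le> K * (step t 1 powr \<sigma> / \<sigma>)" if i: "i \<in> {1..<M}" for i
  proof -
    have "time_regular T \<sigma> C (elliptic_part i)"
      using time_reg[OF th i] by (simp add: elliptic_part_def[abs_def])
    then have "\<bar>elliptic_part i ((1 - \<theta>) * t 1) - (\<theta> * elliptic_part i 0 + (1 - \<theta>) * elliptic_part i (t 1))\<bar>
        \<le> K * (t 1 powr \<sigma> / \<sigma>)"
      using K elliptic_part_continuous[OF i] t_pos[OF 1] t_le_T[OF N] th theta(2)
      unfolding first_step_constant_def by blast
    then show ?thesis by (simp add: averaging_error_def offset_def step_def)
  qed
  then show ?thesis
    using grid_norm_le[of h "K * (step t 1 powr \<sigma> / \<sigma>)" M "averaging_error 1"] h_pos K sp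
    by (simp add: h_M first_step_constant_def)
qed

lemma weighted_size_nonneg: "n \<in> {1..N} \<Longrightarrow> 0 \<le> weighted_size n R"
  unfolding weighted_size_def using cweight_nonneg[OF A1] h_pos
  by (intro sum_nonneg mult_nonneg_nonneg grid_norm_nonneg) auto

lemma weighted_size_mono:
  assumes "n \<in> {1..N}" "\<And>k. k \<in> {1..n} \<Longrightarrow> grid_norm h M (R k) \<le> r k"
  shows "weighted_size n R \<le> (\<Sum>k\<in>{1..n}. cweight A n k * r k)"
  unfolding weighted_size_def using assms cweight_nonneg[OF A1] by (intro sum_mono mult_left_mono) auto

lemma weighted_consistency_error:
  assumes n: "n \<in> {1..N}"
  shows "weighted_size n (consistency_error xl xr M t \<alpha> \<theta> A u) \<le> (\<rho> + 1) * Xi t \<alpha> \<pi>A (cal_G A Gloc Ghis) n"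
  unfolding weighted_size_def
  by (rule cweight_consistency_sum[OF n]) (use consistency n in \<open>auto simp: error_convolution_structure_def\<close>)

lemma Xi_nonneg:
  assumes n: "n \<in> {1..N}"
  shows "0 \<le> (\<rho> + 1) * Xi t \<alpha> \<pi>A (cal_G A Gloc Ghis) n"
  using weighted_size_nonneg[OF n] weighted_consistency_error[OF n] by (rule order_trans)

lemma weighted_space_error:
  assumes n: "n \<in> {1..N}"
  shows "weighted_size n space_error \<le> sqrt (xr - xl) * C * \<pi>A / Gamma (1 + \<alpha>) * (t n powr \<alpha> * h\<^sup>2)"
proof -
  have G: "0 < Gamma (1 + \<alpha>)" using alpha by (intro Gamma_real_pos) auto
  have q: "0 \<le> sqrt (xr - xl) * (C / 12 * h\<^sup>2)" using interval C by simp
  have "weighted_size n space_error \<le> (\<Sum>k\<in>{1..n}. cweight A n k * (sqrt (xr - xl) * (C / 12 * h\<^sup>2)))"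
    using n by (intro weighted_size_mono space_error_norm) auto
  also have "\<dots> = (\<Sum>k\<in>{1..n}. cweight A n k) * (sqrt (xr - xl) * (C / 12 * h\<^sup>2))"
    by (simp only: sum_distrib_right)
  also have "\<dots> \<le> \<pi>A * t n powr \<alpha> / Gamma (1 + \<alpha>) * (sqrt (xr - xl) * (C / 12 * h\<^sup>2))"
    by (rule mult_right_mono[OF cweight_total[OF n] q])
  also have "\<dots> \<le> \<pi>A * t n powr \<alpha> / Gamma (1 + \<alpha>) * (sqrt (xr - xl) * (C * h\<^sup>2))"
    using G piA interval C by (intro mult_left_mono) auto
  finally show ?thesis by (simp add: mult_ac)
qed

text \<open>The first step is estimated with the size of its own weight, which is where the additional power
  \<open>\<alpha>\<close> of \<open>step t 1\<close> comes from; the later steps share the bound on the total weight.\<close>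

lemma weighted_averaging_error:
  assumes n: "n \<in> {1..N}" and th: "0 < \<theta>" and K: "first_step_constant T \<sigma> C K"
    and sp: "0 < \<sigma>"
  shows "weighted_size n averaging_error
    \<le> sqrt (xr - xl) * C * (1 + T powr (2 - \<sigma>)) * \<pi>A / Gamma (1 + \<alpha>)
         * (t n powr \<alpha> * max_over {2..n} (\<lambda>k. t (k - 1) powr (\<sigma> - 2) * (step t k)\<^sup>2))
      + sqrt (xr - xl) * \<pi>A * Gamma (2 - \<alpha>) * K * (step t 1 powr (\<sigma> + \<alpha>) / \<sigma>)"
proof -
  let ?m = "max_over {2..n} (\<lambda>k. t (k - 1) powr (\<sigma> - 2) * (step t k)\<^sup>2)"
  let ?q = "sqrt (xr - xl) * (C * (1 + T powr (2 - \<sigma>)) * ?m)"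
  note P = cweight_nonneg[OF A1 n]
  have m: "0 \<le> ?m" by (rule max_over_nonneg) auto
  have q: "0 \<le> ?q" using m C interval by simp
  have L: "0 \<le> sqrt (xr - xl)" using interval by simp
  have "(\<Sum>k\<in>{2..n}. cweight A n k * grid_norm h M (averaging_error k)) \<le> (\<Sum>k\<in>{2..n}. cweight A n k * ?q)"
  proof (intro sum_mono mult_left_mono P)
    fix k assume k: "k \<in> {2..n}"
    have "grid_norm h M (averaging_error k)
        \<le> sqrt (xr - xl) * (C * (1 + T powr (2 - \<sigma>)) * (t (k - 1) powr (\<sigma> - 2) * (step t k)\<^sup>2))"
      by (rule averaging_error_norm_later) (use k n th in auto)
    also have "\<dots> \<le> ?q"
      using C L max_over_ge[of "{2..n}" k "\<lambda>k. t (k - 1) powr (\<sigma> - 2) * (step t k)\<^sup>2"] k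
      by (intro mult_left_mono) auto
    finally show "grid_norm h M (averaging_error k) \<le> ?q" .
  qed auto
  also have "\<dots> = (\<Sum>k\<in>{2..n}. cweight A n k) * ?q" by (simp only: sum_distrib_right)
  also have "\<dots> \<le> (\<pi>A * t n powr \<alpha> / Gamma (1 + \<alpha>)) * ?q"
  proof (rule mult_right_mono[OF order_trans q])
    show "(\<Sum>k\<in>{2..n}. cweight A n k) \<le> (\<Sum>k\<in>{1..n}. cweight A n k)" using P by (intro sum_mono2) auto
  qed (rule cweight_total[OF n])
  finally have later: "(\<Sum>k\<in>{2..n}. cweight A n k * grid_norm h M (averaging_error k))
      \<le> (\<pi>A * t n powr \<alpha> / Gamma (1 + \<alpha>)) * ?q" .
  have "cweight A n 1 * grid_norm h M (averaging_error 1)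
      \<le> (\<pi>A * Gamma (2 - \<alpha>) * step t 1 powr \<alpha>) * (sqrt (xr - xl) * (K * (step t 1 powr \<sigma> / \<sigma>)))"
  proof (rule mult_mono)
    show "cweight A n 1 \<le> \<pi>A * Gamma (2 - \<alpha>) * step t 1 powr \<alpha>" using cweight_le[OF n, of 1] n by auto
    show "grid_norm h M (averaging_error 1) \<le> sqrt (xr - xl) * (K * (step t 1 powr \<sigma> / \<sigma>))"
      by (rule averaging_error_norm_first[OF _ th K sp]) (use n in auto)
  qed (use piA Gamma_real_pos[of "2 - \<alpha>"] alpha h_pos in \<open>auto intro: grid_norm_nonneg\<close>)
  also have "\<dots> = sqrt (xr - xl) * \<pi>A * Gamma (2 - \<alpha>) * K * (step t 1 powr (\<sigma> + \<alpha>) / \<sigma>)"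
    by (simp add: powr_add)
  finally have first: "cweight A n 1 * grid_norm h M (averaging_error 1) \<le> \<dots>" .
  have "weighted_size n averaging_error = cweight A n 1 * grid_norm h M (averaging_error 1)
      + (\<Sum>k\<in>{2..n}. cweight A n k * grid_norm h M (averaging_error k))"
    unfolding weighted_size_def using n by (simp add: sum.atLeast_Suc_atMost numeral_2_eq_2)
  also note add_mono[OF first later]
  finally show ?thesis by (simp add: mult_ac)
qed

lemma error_le_weighted_sizes:
  assumes n: "n \<in> {1..N}" and H: "\<And>k. k \<in> {1..n} \<Longrightarrow>
    weighted_size k (consistency_error xl xr M t \<alpha> \<theta> A u) + weighted_size k space_error
      + weighted_size k averaging_error \<le> H"
  shows "grid_norm h M (err n)
    \<le> 2 * mittag_leffler \<alpha> (4 * max 1 \<rho> * \<pi>A * max \<kappa> 0 * t n powr \<alpha>) * (grid_norm h M (err 0) + 2 * H)"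
proof -
  have h0: "0 \<le> h" using h_pos by simp
  note nonneg = grid_norm_nonneg[OF h0]
  define R where "R k i = space_error k i + averaging_error k i - consistency_error xl xr M t \<alpha> \<theta> A u k i" for k i
  define g where "g k = grid_norm h M (consistency_error xl xr M t \<alpha> \<theta> A u k) + grid_norm h M (space_error k)
    + grid_norm h M (averaging_error k)" for k
  have R_le: "grid_norm h M (R k) \<le> g k" for k
  proof -
    have "grid_norm h M (R k) = grid_norm h M (\<lambda>i. (space_error k i + averaging_error k i)
        + (-1) * consistency_error xl xr M t \<alpha> \<theta> A u k i)"
      by (simp add: R_def[abs_def])
    also have "\<dots> \<le> grid_norm h M (\<lambda>i. space_error k i + averaging_error k i)
        + grid_norm h M (\<lambda>i. (-1) * consistency_error xl xr M t \<alpha> \<theta> A u k i)"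
      by (rule grid_norm_triangle[OF h0])
    also have "\<dots> \<le> (grid_norm h M (space_error k) + grid_norm h M (averaging_error k))
        + grid_norm h M (consistency_error xl xr M t \<alpha> \<theta> A u k)"
      using grid_norm_triangle[OF h0] grid_norm_cmult[OF h0, of M "-1"] by (intro add_mono) auto
    finally show ?thesis by (simp add: g_def)
  qed
  have sum_g: "(\<Sum>j\<in>{1..k}. cweight A k j * g j) \<le> H" if "k \<in> {1..n}" for k
    using H[OF that] by (simp add: weighted_size_def g_def distrib_left sum.distrib)
  have "0 \<le> weighted_size n (consistency_error xl xr M t \<alpha> \<theta> A u) + weighted_size n space_error
      + weighted_size n averaging_error" using weighted_size_nonneg[OF n] by simp
  also have "\<dots> \<le> H" using H[of n] n by auto
  finally have H0: "0 \<le> H" .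
  show ?thesis
  proof (rule discrete_gronwall[where v = "\<lambda>k. grid_norm h M (err k)" and g = g and m = n and H = H
        and w = "\<lambda>k. grid_norm h M (\<lambda>i. offset \<theta> (\<lambda>k. err k i) k)"])
    fix k assume k: "k \<in> {1..N}"
    show "grid_norm h M (\<lambda>i. offset \<theta> (\<lambda>k. err k i) k) \<le> max (grid_norm h M (err (k - 1))) (grid_norm h M (err k))"
      using grid_norm_offset_le[OF h0] theta by simp
    have "discrete_caputo A (\<lambda>k. (grid_norm h M (err k))\<^sup>2) k
        \<le> 2 * max \<kappa> 0 * (grid_norm h M (\<lambda>i. offset \<theta> (\<lambda>k. err k i) k))\<^sup>2
          + 2 * grid_norm h M (\<lambda>i. offset \<theta> (\<lambda>k. err k i) k) * grid_norm h M (R k)"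
    proof (rule scheme_energy[OF A1 k _ _ theta_bound[OF k] h0 M])
      show "err j 0 = 0 \<and> err j M = 0" if "j \<le> N" for j using err_boundary that n by auto
      show "discrete_caputo A (\<lambda>k. err k i) k = discrete_laplacian h (\<lambda>i. offset \<theta> (\<lambda>k. err k i) k) i
          + \<kappa> * offset \<theta> (\<lambda>k. err k i) k + R k i" if "i \<in> {1..<M}" for i
        using error_equation[OF k that] by (simp add: R_def)
    qed (use theta in auto)
    also have "\<dots> \<le> 2 * max \<kappa> 0 * (grid_norm h M (\<lambda>i. offset \<theta> (\<lambda>k. err k i) k))\<^sup>2
          + 2 * grid_norm h M (\<lambda>i. offset \<theta> (\<lambda>k. err k i) k) * g k"
      using R_le nonneg by (intro add_left_mono mult_left_mono) auto
    finally show "discrete_caputo A (\<lambda>k. (grid_norm h M (err k))\<^sup>2) k \<le> \<dots>" .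
    show "4 * max 1 \<rho> * \<pi>A * Gamma (2 - \<alpha>) * max \<kappa> 0 * step t k powr \<alpha> \<le> 1" by (rule small_steps[OF k])
  qed (use n H0 sum_g nonneg in \<open>auto simp: g_def\<close>)
qed

text \<open>All levels up to \<open>n\<close> are bounded by quantities at level \<open>n\<close>. The lower bound \<open>\<gamma>0\<close> for the Gamma
  function makes the constants independent of \<open>\<alpha>\<close>.\<close>

lemma error_bound:
  assumes n: "n \<in> {1..N}"
    and \<gamma>: "0 < \<gamma>0" "\<gamma>0 \<le> Gamma (1 + \<alpha>)"
    and avg: "\<And>k. k \<in> {1..n} \<Longrightarrow> weighted_size k averaging_error \<le> a"
  shows "grid_norm h M (err n)
    \<le> 2 * mittag_leffler \<alpha> (4 * max 1 \<rho> * \<pi>A * max \<kappa> 0 * t n powr \<alpha>)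
      * (grid_norm h M (err 0) + 2 * ((\<rho> + 1) * max_over {1..n} (Xi t \<alpha> \<pi>A (cal_G A Gloc Ghis))
        + sqrt (xr - xl) * C * \<pi>A / \<gamma>0 * (t n powr \<alpha> * h\<^sup>2) + a))"
proof (rule error_le_weighted_sizes[OF n])
  fix k assume k: "k \<in> {1..n}"
  then have kN: "k \<in> {1..N}" using n by auto
  have "weighted_size k (consistency_error xl xr M t \<alpha> \<theta> A u)
      \<le> (\<rho> + 1) * Xi t \<alpha> \<pi>A (cal_G A Gloc Ghis) k" by (rule weighted_consistency_error[OF kN])
  also have "\<dots> \<le> (\<rho> + 1) * max_over {1..n} (Xi t \<alpha> \<pi>A (cal_G A Gloc Ghis))"
    using k rho by (intro mult_left_mono max_over_ge) auto
  finally have 1: "weighted_size k (consistency_error xl xr M t \<alpha> \<theta> A u) \<le> \<dots>" .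
  have "weighted_size k space_error \<le> sqrt (xr - xl) * C * \<pi>A / Gamma (1 + \<alpha>) * (t k powr \<alpha> * h\<^sup>2)"
    by (rule weighted_space_error[OF kN])
  also have "\<dots> \<le> sqrt (xr - xl) * C * \<pi>A / \<gamma>0 * (t n powr \<alpha> * h\<^sup>2)"
    using \<gamma> interval C piA alpha t_nonneg[of k] t_mono[of k n] k n
    by (intro mult_mono divide_left_mono powr_mono2 mult_right_mono) auto
  finally show "weighted_size k (consistency_error xl xr M t \<alpha> \<theta> A u) + weighted_size k space_error
      + weighted_size k averaging_error
    \<le> (\<rho> + 1) * max_over {1..n} (Xi t \<alpha> \<pi>A (cal_G A Gloc Ghis))
      + sqrt (xr - xl) * C * \<pi>A / \<gamma>0 * (t n powr \<alpha> * h\<^sup>2) + a"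
    using 1 avg[OF k] by linarith
qed

lemma max_Xi_nonneg:
  assumes n: "n \<in> {1..N}"
  shows "0 \<le> (\<rho> + 1) * max_over {1..n} (Xi t \<alpha> \<pi>A (cal_G A Gloc Ghis))"
proof -
  have "(\<rho> + 1) * Xi t \<alpha> \<pi>A (cal_G A Gloc Ghis) n \<le> (\<rho> + 1) * max_over {1..n} (Xi t \<alpha> \<pi>A (cal_G A Gloc Ghis))"
    using rho n by (intro mult_left_mono max_over_ge) auto
  with Xi_nonneg[OF n] show ?thesis by simp
qed

lemma mittag_leffler_factor_nonneg:
  "0 \<le> mittag_leffler \<alpha> (4 * max 1 \<rho> * \<pi>A * max \<kappa> 0 * t n powr \<alpha>)"
proof -
  have "1 \<le> mittag_leffler \<alpha> (4 * max 1 \<rho> * \<pi>A * max \<kappa> 0 * t n powr \<alpha>)"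
    using alpha piA by (intro mittag_leffler_ge_1) auto
  then show ?thesis by linarith
qed

lemma averaging_bound:
  assumes n: "n \<in> {1..N}" and k: "k \<in> {1..n}" and th: "0 < \<theta>" and K: "first_step_constant T \<sigma> C K"
    and sp: "0 < \<sigma>"
    and \<gamma>: "0 < \<gamma>0" "\<gamma>0 \<le> Gamma (1 + \<alpha>)" "Gamma (2 - \<alpha>) \<le> \<gamma>1"
  shows "weighted_size k averaging_error
    \<le> sqrt (xr - xl) * C * (1 + T powr (2 - \<sigma>)) * \<pi>A / \<gamma>0
         * (t n powr \<alpha> * max_over {2..n} (\<lambda>k. t (k - 1) powr (\<sigma> - 2) * (step t k)\<^sup>2))
      + sqrt (xr - xl) * \<pi>A * \<gamma>1 * K * (step t 1 powr (\<sigma> + \<alpha>) / \<sigma>)"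
proof -
  let ?m = "\<lambda>n. max_over {2..n} (\<lambda>k. t (k - 1) powr (\<sigma> - 2) * (step t k)\<^sup>2)"
  have kN: "k \<in> {1..N}" using n k by auto
  have m: "0 \<le> ?m j" for j by (rule max_over_nonneg) auto
  have mm: "?m k \<le> ?m n"
  proof (rule max_over_le[OF _ m])
    fix i assume "i \<in> {2..k}"
    then show "t (i - 1) powr (\<sigma> - 2) * (step t i)\<^sup>2 \<le> ?m n"
      using k max_over_ge[of "{2..n}" i "\<lambda>k. t (k - 1) powr (\<sigma> - 2) * (step t k)\<^sup>2"] by auto
  qed simp
  have "weighted_size k averaging_error
    \<le> sqrt (xr - xl) * C * (1 + T powr (2 - \<sigma>)) * \<pi>A / Gamma (1 + \<alpha>) * (t k powr \<alpha> * ?m k)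
      + sqrt (xr - xl) * \<pi>A * Gamma (2 - \<alpha>) * K * (step t 1 powr (\<sigma> + \<alpha>) / \<sigma>)"
    by (rule weighted_averaging_error[OF kN th K sp])
  also have "\<dots> \<le> sqrt (xr - xl) * C * (1 + T powr (2 - \<sigma>)) * \<pi>A / \<gamma>0 * (t n powr \<alpha> * ?m n)
      + sqrt (xr - xl) * \<pi>A * \<gamma>1 * K * (step t 1 powr (\<sigma> + \<alpha>) / \<sigma>)"
  proof (rule add_mono)
    have c: "0 \<le> sqrt (xr - xl) * C * (1 + T powr (2 - \<sigma>)) * \<pi>A" using interval C piA by simp
    have G: "0 < Gamma (1 + \<alpha>)" using \<gamma> by linarith
    show "sqrt (xr - xl) * C * (1 + T powr (2 - \<sigma>)) * \<pi>A / Gamma (1 + \<alpha>) * (t k powr \<alpha> * ?m k)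
        \<le> sqrt (xr - xl) * C * (1 + T powr (2 - \<sigma>)) * \<pi>A / \<gamma>0 * (t n powr \<alpha> * ?m n)"
    proof (rule mult_mono)
      show "sqrt (xr - xl) * C * (1 + T powr (2 - \<sigma>)) * \<pi>A / Gamma (1 + \<alpha>)
          \<le> sqrt (xr - xl) * C * (1 + T powr (2 - \<sigma>)) * \<pi>A / \<gamma>0"
        by (rule divide_left_mono[OF \<gamma>(2) c]) (rule mult_pos_pos[OF G \<gamma>(1)])
      show "t k powr \<alpha> * ?m k \<le> t n powr \<alpha> * ?m n"
        using alpha t_nonneg[of k] t_mono[of k n] k n m mm by (intro mult_mono powr_mono2) auto
      show "0 \<le> sqrt (xr - xl) * C * (1 + T powr (2 - \<sigma>)) * \<pi>A / \<gamma>0"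
        using c \<gamma>(1) by (rule divide_nonneg_pos)
      show "0 \<le> t k powr \<alpha> * ?m k" using m by simp
    qed
    have "sqrt (xr - xl) * \<pi>A * Gamma (2 - \<alpha>) \<le> sqrt (xr - xl) * \<pi>A * \<gamma>1"
      using \<gamma>(3) interval piA by (intro mult_left_mono) auto
    then show "sqrt (xr - xl) * \<pi>A * Gamma (2 - \<alpha>) * K * (step t 1 powr (\<sigma> + \<alpha>) / \<sigma>)
        \<le> sqrt (xr - xl) * \<pi>A * \<gamma>1 * K * (step t 1 powr (\<sigma> + \<alpha>) / \<sigma>)"
      using K sp by (intro mult_right_mono) (auto simp: first_step_constant_def)
  qed
  finally show ?thesis .
qed

end

text \<open>Both \<open>1 + \<alpha>\<close> and \<open>2 - \<alpha>\<close> lie in this compact interval, so no constant degenerates as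
  \<open>\<alpha>\<close> tends to 0 or 1.\<close>

lemma Gamma_bounds_1_2:
  obtains \<gamma>0 \<gamma>1 :: real where "0 < \<gamma>0" "\<And>s. s \<in> {1..2} \<Longrightarrow> \<gamma>0 \<le> Gamma s" "\<And>s. s \<in> {1..2} \<Longrightarrow> Gamma s \<le> \<gamma>1"
proof -
  have cont: "continuous_on {1..2} (Gamma :: real \<Rightarrow> real)"
    by (intro continuous_on_Gamma continuous_on_id) (auto elim!: nonpos_Ints_cases)
  obtain a where a: "a \<in> {1..2::real}" "\<And>s. s \<in> {1..2} \<Longrightarrow> Gamma a \<le> Gamma s"
    using continuous_attains_inf[OF _ _ cont] by auto
  obtain b where b: "b \<in> {1..2::real}" "\<And>s. s \<in> {1..2} \<Longrightarrow> Gamma s \<le> Gamma b"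
    using continuous_attains_sup[OF _ _ cont] by auto
  show ?thesis by (rule that[of "Gamma a" "Gamma b"]) (use a b in \<open>auto intro: Gamma_real_pos\<close>)
qed

text \<open>The two factors 2 on the left come from \<open>discrete_gronwall\<close>; the right-hand side has the shape of the
  final estimate.\<close>

lemma absorb_constants:
  fixes c1 c2 c3 e X s m g :: real
  assumes "0 \<le> c1" "0 \<le> c2" "0 \<le> c3" "0 \<le> e" "0 \<le> X" "0 \<le> s" "0 \<le> m" "0 \<le> g"
  shows "2 * (e + 2 * (X + c1 * s + (c2 * m + c3 * g))) \<le> 4 * (1 + c1 + c2 + c3) * (e + g + s + m + X)"
proof -
  define S where "S = e + g + s + m + X"
  have S: "0 \<le> S" "e \<le> S" "X \<le> S" "s \<le> S" "m \<le> S" "g \<le> S" "e + X \<le> S"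
    using assms by (simp_all add: S_def)
  have "2 * (e + 2 * (X + c1 * s + (c2 * m + c3 * g))) \<le> 2 * (e + 2 * (X + c1 * S + (c2 * S + c3 * S)))"
    using assms S by (intro mult_left_mono add_mono order_refl) auto
  also have "\<dots> = (2 * e + 4 * X) + 4 * (c1 * S + c2 * S + c3 * S)" by (simp add: algebra_simps)
  also have "\<dots> \<le> 4 * S + 4 * (c1 * S + c2 * S + c3 * S)" using assms(4) S(7) by (intro add_right_mono) linarith
  also have "\<dots> = 4 * (1 + c1 + c2 + c3) * S" by (simp add: algebra_simps)
  finally show ?thesis by (simp add: S_def)
qed

lemma step_restriction_powr:
  assumes "0 < \<alpha>" "0 < b" "0 \<le> \<tau>" "\<tau> \<le> 1 / b powr (1 / \<alpha>)"
  shows "b * \<tau> powr \<alpha> \<le> (1 :: real)"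
proof -
  have "\<tau> powr \<alpha> \<le> (1 / b powr (1 / \<alpha>)) powr \<alpha>" using assms by (intro powr_mono2) auto
  also have "\<dots> = 1 / b" using assms by (simp add: powr_divide powr_powr)
  finally show ?thesis using assms by (simp add: field_simps)
qed

lemma subdiffusion_schemeI:
  assumes "xl < xr" "0 < \<pi>A" "\<sigma> < 2" "0 < C" "\<forall>n\<in>{1..N}. \<theta> = 0 \<or> \<theta> \<le> theta_bound A n"
    and "0 < \<alpha>" "\<alpha> < 1" "0 \<le> \<theta>" "\<theta> < 1" "M \<ge> 1" "time_mesh T N t"
    and "subdiffusion_solution xl xr T \<alpha> \<kappa> f u0 u" "discrete_solution xl xr M N t \<theta> A \<kappa> f u0 U"
    and "kernels_A1 N A" "kernels_A2 N t \<alpha> \<pi>A A" "\<rho> > 0" "mesh_A3 N t \<rho>"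
    and "\<forall>s\<in>{0<..T}. space_regular xl xr C (\<lambda>y. u y s)"
    and "\<theta> > 0 \<longrightarrow> (\<forall>i\<in>{1..<M}. time_regular T \<sigma> C
      (\<lambda>s. discrete_laplacian (mesh_width xl xr M) (\<lambda>j. u (grid_point xl xr M j) s) i
        + \<kappa> * u (grid_point xl xr M i) s))"
    and "error_convolution_structure xl xr M N t \<alpha> \<theta> A u Gloc Ghis"
    and restriction: "max \<kappa> 0 > 0 \<longrightarrow> Max (step t ` {1..N})
      \<le> 1 / (4 * max 1 \<rho> * \<pi>A * Gamma (2 - \<alpha>) * max \<kappa> 0) powr (1 / \<alpha>)"
  shows "subdiffusion_scheme \<alpha> \<pi>A \<rho> T N t A xl xr \<kappa> \<theta> \<sigma> C f u u0 M U Gloc Ghis"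
proof -
  interpret nonuniform_caputo \<alpha> \<pi>A \<rho> T N t A
    using assms by unfold_locales
  have "4 * max 1 \<rho> * \<pi>A * Gamma (2 - \<alpha>) * max \<kappa> 0 * step t k powr \<alpha> \<le> 1" if k: "k \<in> {1..N}" for k
  proof (cases "max \<kappa> 0 > 0")
    case True
    have "step t k \<le> Max (step t ` {1..N})" using k by (intro Max_ge) auto
    also have "\<dots> \<le> 1 / (4 * max 1 \<rho> * \<pi>A * Gamma (2 - \<alpha>) * max \<kappa> 0) powr (1 / \<alpha>)"
      using restriction True by blast
    finally show ?thesis
      using True step_pos[OF k] assms(2,6,7) Gamma_real_pos[of "2 - \<alpha>"]
      by (intro step_restriction_powr) auto
  next
    case False
    then have "max \<kappa> 0 = 0" by simp
    then show ?thesis by (simp only: mult_zero_left mult_zero_right)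
  qed
  then show ?thesis using assms by unfold_locales blast+
qed

theorem theorem2p2:
  fixes xl xr T \<kappa> \<pi>A \<sigma> Creg :: real
  assumes "xl < xr" and "T > 0" and "\<pi>A > 0"
    and "\<sigma> \<in> {0<..<1} \<union> {1<..<2}" and "Creg > 0"
  shows "\<exists>Cu>0.
    \<forall>(\<alpha>::real) (\<theta>::real) (\<rho>::real)
      (f :: real \<Rightarrow> real \<Rightarrow> real) (u0 :: real \<Rightarrow> real) (u :: real \<Rightarrow> real \<Rightarrow> real)
      (M::nat) (N::nat) (t :: nat \<Rightarrow> real) (A :: nat \<Rightarrow> nat \<Rightarrow> real) (U :: nat \<Rightarrow> nat \<Rightarrow> real)
      (Gloc :: nat \<Rightarrow> real) (Ghis :: nat \<Rightarrow> real).
      let h = mesh_width xl xr M;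
          x = grid_point xl xr M;
          \<kappa>p = max \<kappa> 0;
          err = (\<lambda>n i. u (x i) (t n) - U n i);
          \<Xi> = Xi t \<alpha> \<pi>A (cal_G A Gloc Ghis);
          C = (\<lambda>n. Cu * mittag_leffler \<alpha> (4 * max 1 \<rho> * \<pi>A * \<kappa>p * t n powr \<alpha>))
      in
        0 < \<alpha> \<and> \<alpha> < 1 \<and> 0 \<le> \<theta> \<and> \<theta> < 1 \<and> M \<ge> 1 \<and> N \<ge> 1 \<and> time_mesh T N t \<and>
        subdiffusion_solution xl xr T \<alpha> \<kappa> f u0 u \<and>
        discrete_solution xl xr M N t \<theta> A \<kappa> f u0 U \<and>
        kernels_A1 N A \<and>
        kernels_A2 N t \<alpha> \<pi>A A \<and>
        \<rho> > 0 \<and> mesh_A3 N t \<rho> \<and>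
        (\<forall>y\<in>{xl<..<xr}. time_regular T \<sigma> Creg (u y)) \<and>
        (\<forall>s\<in>{0<..T}. space_regular xl xr Creg (\<lambda>y. u y s)) \<and>
        (\<theta> > 0 \<longrightarrow> (\<forall>i\<in>{1..<M}.
           time_regular T \<sigma> Creg
             (\<lambda>s. discrete_laplacian h (\<lambda>j. u (x j) s) i + \<kappa> * u (x i) s))) \<and>
        error_convolution_structure xl xr M N t \<alpha> \<theta> A u Gloc Ghis \<and>
        (\<kappa>p > 0 \<longrightarrow>
           Max (step t ` {1..N})
             \<le> 1 / (4 * max 1 \<rho> * \<pi>A * Gamma (2 - \<alpha>) * \<kappa>p) powr (1 / \<alpha>))
        \<longrightarrow>
        ((\<forall>n\<in>{1..N}. 0 < \<theta> \<and> \<theta> < theta_bound A n) \<longrightarrow>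
           (\<forall>n\<in>{1..N}.
              grid_norm h M (err n) \<le> C n *
                (grid_norm h M (err 0) + step t 1 powr (\<sigma> + \<alpha>) / \<sigma> + t n powr \<alpha> * h ^ 2
                 + t n powr \<alpha> * max_over {2..n} (\<lambda>k. t (k - 1) powr (\<sigma> - 2) * step t k ^ 2)
                 + (\<rho> + 1) * max_over {1..n} \<Xi>))) \<and>
        (\<theta> = 0 \<longrightarrow>
           (\<forall>n\<in>{1..N}.
              grid_norm h M (err n) \<le> C n *
                (grid_norm h M (err 0) + t n powr \<alpha> * h ^ 2
                 + (\<rho> + 1) * max_over {1..n} \<Xi>)))"
proof -
  have sigma: "0 < \<sigma>" "\<sigma> < 2" using assms(4) by auto
  obtain \<gamma>0 \<gamma>1 :: real where gamma: "0 < \<gamma>0" "\<And>s. s \<in> {1..2} \<Longrightarrow> \<gamma>0 \<le> Gamma s"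
      "\<And>s. s \<in> {1..2} \<Longrightarrow> Gamma s \<le> \<gamma>1"
    using Gamma_bounds_1_2 by blast
  have gamma1: "0 \<le> \<gamma>1" using gamma(1) gamma(2,3)[of 1] by simp
  obtain K where K: "first_step_constant T \<sigma> Creg K"
    using first_step_constant_exists[OF assms(4,5,2)] by blast
  define c1 where "c1 = sqrt (xr - xl) * Creg * \<pi>A / \<gamma>0"
  define c2 where "c2 = sqrt (xr - xl) * Creg * (1 + T powr (2 - \<sigma>)) * \<pi>A / \<gamma>0"
  define c3 where "c3 = sqrt (xr - xl) * \<pi>A * \<gamma>1 * K"
  define Cu where "Cu = 4 * (1 + c1 + c2 + c3)"
  have c: "0 \<le> c1" "0 \<le> c2" "0 \<le> c3"
    using assms gamma(1) gamma1 K by (simp_all add: c1_def c2_def c3_def first_step_constant_def)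
  show ?thesis
    unfolding Let_def
  proof (intro exI[of _ Cu] conjI allI impI ballI, goal_cases)
    case 1
    show ?case using c by (simp add: Cu_def)
  next
    case (2 \<alpha> \<theta> \<rho> f u0 u M N t A U Gloc Ghis n)
    note n = \<open>n \<in> {1..N}\<close>
    have th: "0 < \<theta>" using 2(2) n by blast
    have alpha: "0 < \<alpha>" "\<alpha> < 1" using 2(1) by blast+
    have adm: "\<forall>n\<in>{1..N}. \<theta> = 0 \<or> \<theta> \<le> theta_bound A n" using 2(2) by (auto intro: less_imp_le)
    interpret S: subdiffusion_scheme \<alpha> \<pi>A \<rho> T N t A xl xr \<kappa> \<theta> \<sigma> Creg f u u0 M U Gloc Ghis
      by (rule subdiffusion_schemeI[OF assms(1,3) sigma(2) assms(5) adm]) (use 2(1) in blast)+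
    have g: "\<gamma>0 \<le> Gamma (1 + \<alpha>)" "Gamma (2 - \<alpha>) \<le> \<gamma>1" using gamma(2)[of "1 + \<alpha>"] gamma(3)[of "2 - \<alpha>"] alpha by auto
    have "grid_norm S.h M (S.err n)
      \<le> 2 * mittag_leffler \<alpha> (4 * max 1 \<rho> * \<pi>A * max \<kappa> 0 * t n powr \<alpha>)
        * (grid_norm S.h M (S.err 0) + 2 * ((\<rho> + 1) * max_over {1..n} (Xi t \<alpha> \<pi>A (cal_G A Gloc Ghis))
          + c1 * (t n powr \<alpha> * S.h\<^sup>2)
          + (c2 * (t n powr \<alpha> * max_over {2..n} (\<lambda>k. t (k - 1) powr (\<sigma> - 2) * (step t k)\<^sup>2))
            + c3 * (step t 1 powr (\<sigma> + \<alpha>) / \<sigma>))))"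
      unfolding c1_def c2_def c3_def
      by (rule S.error_bound[OF n gamma(1) g(1) S.averaging_bound[OF n _ th K sigma(1) gamma(1) g]])
    also have "\<dots> = mittag_leffler \<alpha> (4 * max 1 \<rho> * \<pi>A * max \<kappa> 0 * t n powr \<alpha>)
        * (2 * (grid_norm S.h M (S.err 0) + 2 * ((\<rho> + 1) * max_over {1..n} (Xi t \<alpha> \<pi>A (cal_G A Gloc Ghis))
          + c1 * (t n powr \<alpha> * S.h\<^sup>2)
          + (c2 * (t n powr \<alpha> * max_over {2..n} (\<lambda>k. t (k - 1) powr (\<sigma> - 2) * (step t k)\<^sup>2))
            + c3 * (step t 1 powr (\<sigma> + \<alpha>) / \<sigma>)))))" by simp
    also have "\<dots> \<le> mittag_leffler \<alpha> (4 * max 1 \<rho> * \<pi>A * max \<kappa> 0 * t n powr \<alpha>)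
        * (Cu * (grid_norm S.h M (S.err 0) + step t 1 powr (\<sigma> + \<alpha>) / \<sigma> + t n powr \<alpha> * S.h\<^sup>2
          + t n powr \<alpha> * max_over {2..n} (\<lambda>k. t (k - 1) powr (\<sigma> - 2) * (step t k)\<^sup>2)
          + (\<rho> + 1) * max_over {1..n} (Xi t \<alpha> \<pi>A (cal_G A Gloc Ghis))))"
      unfolding Cu_def
    proof (intro mult_left_mono absorb_constants c)
      show "0 \<le> mittag_leffler \<alpha> (4 * max 1 \<rho> * \<pi>A * max \<kappa> 0 * t n powr \<alpha>)"
        by (rule S.mittag_leffler_factor_nonneg)
      show "0 \<le> grid_norm S.h M (S.err 0)" using S.h_pos by (intro grid_norm_nonneg) simp
      show "0 \<le> (\<rho> + 1) * max_over {1..n} (Xi t \<alpha> \<pi>A (cal_G A Gloc Ghis))" by (rule S.max_Xi_nonneg[OF n])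
      show "0 \<le> t n powr \<alpha> * max_over {2..n} (\<lambda>k. t (k - 1) powr (\<sigma> - 2) * (step t k)\<^sup>2)"
        by (intro mult_nonneg_nonneg max_over_nonneg) auto
    qed (use sigma in auto)
    finally show ?case by (simp add: S.err_def[abs_def] mult_ac)
  next
    case (3 \<alpha> \<theta> \<rho> f u0 u M N t A U Gloc Ghis n)
    note n = \<open>n \<in> {1..N}\<close>
    have alpha: "0 < \<alpha>" "\<alpha> < 1" using 3(1) by blast+
    have adm: "\<forall>n\<in>{1..N}. \<theta> = 0 \<or> \<theta> \<le> theta_bound A n" using 3(2) by blast
    interpret S: subdiffusion_scheme \<alpha> \<pi>A \<rho> T N t A xl xr \<kappa> \<theta> \<sigma> Creg f u u0 M U Gloc Ghis
      by (rule subdiffusion_schemeI[OF assms(1,3) sigma(2) assms(5) adm]) (use 3(1) in blast)+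
    have g: "\<gamma>0 \<le> Gamma (1 + \<alpha>)" using gamma(2)[of "1 + \<alpha>"] alpha by auto
    have "S.weighted_size k S.averaging_error \<le> 0" for k
      by (simp add: S.weighted_size_def S.averaging_error_0[OF 3(2)] grid_norm_def grid_inner_def)
    then have "grid_norm S.h M (S.err n)
      \<le> 2 * mittag_leffler \<alpha> (4 * max 1 \<rho> * \<pi>A * max \<kappa> 0 * t n powr \<alpha>)
        * (grid_norm S.h M (S.err 0) + 2 * ((\<rho> + 1) * max_over {1..n} (Xi t \<alpha> \<pi>A (cal_G A Gloc Ghis))
          + c1 * (t n powr \<alpha> * S.h\<^sup>2) + 0))"
      unfolding c1_def by (rule S.error_bound[OF n gamma(1) g])
    also have "\<dots> = mittag_leffler \<alpha> (4 * max 1 \<rho> * \<pi>A * max \<kappa> 0 * t n powr \<alpha>)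
        * (2 * (grid_norm S.h M (S.err 0) + 2 * ((\<rho> + 1) * max_over {1..n} (Xi t \<alpha> \<pi>A (cal_G A Gloc Ghis))
          + c1 * (t n powr \<alpha> * S.h\<^sup>2) + (c2 * 0 + c3 * 0))))" by simp
    also have "\<dots> \<le> mittag_leffler \<alpha> (4 * max 1 \<rho> * \<pi>A * max \<kappa> 0 * t n powr \<alpha>)
        * (Cu * (grid_norm S.h M (S.err 0) + 0 + t n powr \<alpha> * S.h\<^sup>2 + 0
          + (\<rho> + 1) * max_over {1..n} (Xi t \<alpha> \<pi>A (cal_G A Gloc Ghis))))"
      unfolding Cu_def
    proof (intro mult_left_mono absorb_constants c)
      show "0 \<le> mittag_leffler \<alpha> (4 * max 1 \<rho> * \<pi>A * max \<kappa> 0 * t n powr \<alpha>)"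
        by (rule S.mittag_leffler_factor_nonneg)
      show "0 \<le> grid_norm S.h M (S.err 0)" using S.h_pos by (intro grid_norm_nonneg) simp
      show "0 \<le> (\<rho> + 1) * max_over {1..n} (Xi t \<alpha> \<pi>A (cal_G A Gloc Ghis))" by (rule S.max_Xi_nonneg[OF n])
    qed auto
    finally show ?case by (simp add: S.err_def[abs_def] mult_ac)
  qed
qed

end
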